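(* Let $k\ge1$ be an integer, $4\mid N$, let $\psi$ be an even Dirichlet character modulo $N$, and let $h=\sum_{n\ge0}c(n)q^n\in M_{k+1/2}(\Gamma_0(N),\psi)$. Let $S_0,S_1,S_2,S_3$ be the lifts defined in the context. (1) Let $D$ be a fundamental discriminant of sign $(-1)^k$ and assume the conductor of $\psi$ divides $N/4$. Then $$S_1(h;D)(\tau)=S_2(h;D)(\tau)-\psi_{N/4}\chi_D(2)\,2^{k-1}\,S_2(h;D)(2\tau).$$ In particular, if $N/4$ is even or $D$ is even, then $S_1(h;D)=S_2(h;D)$. (2) If $D$ is an odd fundamental discriminant of sign $(-1)^k$, then $S_1(h;D)=S_0(h;(-1)^kD)=S_0(h;|D|)$. (3) If $D$ is an even fundamental discriminant of sign $(-1)^k$, then $$S_1(h;D)(\tau)=S_0(h;|D|/4)(\tau)|_{2k}U_2=\frac{S_0(h;|D|/4)(\tau/2)+S_0(h;|D|/4)((\tau+1)/2)}{2}.$$ If $\psi=\chi_{-4}\psi'$ for a Dirichlet character $\psi'$ modulo $N/4$, and $D\equiv0\pmod 4$ is a fundamental discriminant of sign $(-1)^{k+1}$, then $$S_3(h;D)(\tau)=S_0(h;|D|/4)(\tau)|_{2k}U_2=\frac{S_0(h;|D|/4)(\tau/2)+S_0(h;|D|/4)((\tau+1)/2)}{2}.$$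
   Context: $q=e^{2\pi i\tau}$. With $\theta(\tau)=\sum_{s\in\mathbb Z}q^{s^2}$, $h\in M_{k+1/2}(\Gamma_0(N),\psi)$ means that $h$ is holomorphic on the upper half-plane and at the cusps and $h/\theta^{2k+1}$ transforms under $\begin{pmatrix}a&b\\c&d\end{pmatrix}\in\Gamma_0(N)$ by the factor $\psi(d)$. $\chi_D(n)=\left(\frac Dn\right)$. A character modulo $N$ vanishes exactly on integers not coprime to $N$; products of characters are pointwise products, not replaced by the primitive character, and $L(\cdot,s)$ denotes the $L$-function of the possibly imprimitive character. If the conductor of $\psi$ divides $M\mid N$, $\psi_M$ denotes the character modulo $M$ induced by the same primitive character as $\psi$. $D=1$ counts as a fundamental discriminant. $U_2$ sends $\sum a(n)q^n$ to $\sum a(2n)q^n$. Definitions. - For $t$ a positive squarefree integer, let $D_t$ be the fundamental discriminant among $(-1)^kt$, $(-1)^k4t$ corresponding to $(-1)^kt$ (the discriminant of $\mathbb Q(\sqrt{(-1)^kt})$, or $1$): $$S_0(h;t)=\frac{c(0)}2L(\psi\chi_{D_t},1-k)+\sum_{n\ge1}\Big(\sum_{d\mid n}\psi\chi_{D_t}(d)d^{k-1}c((n/d)^2t)\Big)q^n.$$ - For $D$ a fundamental discriminant of sign $(-1)^k$: $$S_1(h;D)=\frac{c(0)}2L(\psi\chi_D,1-k)+\sum_{n\ge1}\Big(\sum_{d\mid n}\psi\chi_D(d)d^{k-1}c((n/d)^2|D|)\Big)q^n.$$ - If moreover the conductor of $\psi$ divides $N/4$: $$S_2(h;D)=\frac{c(0)}2L(\psi_{N/4}\chi_D,1-k)+\sum_{n\ge1}\Big(\sum_{d\mid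 n}\psi_{N/4}\chi_D(d)d^{k-1}c((n/d)^2|D|)\Big)q^n.$$ - If $\psi=\chi_{-4}\psi'$ with $\psi'$ a Dirichlet character modulo $N/4$, and $D\equiv0\pmod4$ is a fundamental discriminant of sign $(-1)^{k+1}$: $$S_3(h;D)=\frac{c(0)}2L(\psi'\chi_D,1-k)+\sum_{n\ge1}\Big(\sum_{d\mid n}\psi'\chi_D(d)d^{k-1}c((n/d)^2|D|)\Big)q^n.$$ *)

theory Defs
  imports
    "HOL-Complex_Analysis.Complex_Analysis"
    "HOL-Number_Theory.Number_Theory"
    "HOL-Computational_Algebra.Squarefree"
begin

section \<open>Dirichlet characters\<close>

text \<open>
  Characters are functions on all integers. The value at 1 is nonzero and hence equal to 1 by
  multiplicativity.
\<close>

definition dirichlet_char :: "nat \<Rightarrow> (int \<Rightarrow> complex) \<Rightarrow> bool" where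
  "dirichlet_char N \<phi> \<longleftrightarrow>
     N > 0 \<and>
     (\<forall>m n. \<phi> (m * n) = \<phi> m * \<phi> n) \<and>
     (\<forall>n. \<phi> (n + int N) = \<phi> n) \<and>
     (\<forall>n. \<phi> n \<noteq> 0 \<longleftrightarrow> coprime n (int N))"

text \<open>\<open>induces N M \<phi> \<psi>\<close>: the character \<open>\<psi>\<close> modulo \<open>N\<close> is induced by the character \<open>\<phi>\<close> modulo \<open>M\<close>.\<close>

definition induces :: "nat \<Rightarrow> nat \<Rightarrow> (int \<Rightarrow> complex) \<Rightarrow> (int \<Rightarrow> complex) \<Rightarrow> bool" where
  "induces N M \<phi> \<psi> \<longleftrightarrow>
     M dvd N \<and> dirichlet_char M \<phi> \<and> (\<forall>n. coprime n (int N) \<longrightarrow> \<psi> n = \<phi> n)"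

definition conductor :: "nat \<Rightarrow> (int \<Rightarrow> complex) \<Rightarrow> nat" where
  "conductor N \<psi> = (LEAST M. \<exists>\<phi>. induces N M \<phi> \<psi>)"

definition primitive_char :: "nat \<Rightarrow> (int \<Rightarrow> complex) \<Rightarrow> (int \<Rightarrow> complex)" where
  "primitive_char N \<psi> = (THE \<phi>. induces N (conductor N \<psi>) \<phi> \<psi>)"

text \<open>
  The character \<open>\<psi>\<^sub>M\<close> modulo \<open>M\<close> with the same underlying primitive character as \<open>\<psi>\<close>
  (a character modulo \<open>N\<close>); meaningful when the conductor of \<open>\<psi>\<close> divides \<open>M\<close>.
\<close>

definition char_to_modulus :: "nat \<Rightarrow> (int \<Rightarrow> complex) \<Rightarrow> nat \<Rightarrow> (int \<Rightarrow> complex)" where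
  "char_to_modulus N \<psi> M = (\<lambda>n. if coprime n (int M) then primitive_char N \<psi> n else 0)"

section \<open>Fundamental discriminants and the Kronecker symbol\<close>

definition fundamental_discriminant :: "int \<Rightarrow> bool" where
  "fundamental_discriminant D \<longleftrightarrow>
     D mod 4 = 1 \<and> squarefree D \<or>
     (\<exists>m. D = 4 * m \<and> squarefree m \<and> m mod 4 \<in> {2, 3})"

definition kronecker_prime :: "int \<Rightarrow> nat \<Rightarrow> int" where
  "kronecker_prime D p =
     (if p = 2 then (if even D then 0 else if D mod 8 \<in> {1, 7} then 1 else -1)
      else Legendre D (int p))"

definition kronecker :: "int \<Rightarrow> int \<Rightarrow> int" where
  "kronecker D n =
     (if n = 0 then (if \<bar>D\<bar> = 1 then 1 else 0)
      else (if n < 0 \<and> D < 0 then -1 else 1) *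
           (\<Prod>p\<in>prime_factors (nat \<bar>n\<bar>). kronecker_prime D p ^ multiplicity p (nat \<bar>n\<bar>)))"

definition kronecker_char :: "int \<Rightarrow> int \<Rightarrow> complex" where
  "kronecker_char D n = of_int (kronecker D n)"

section \<open>L-functions\<close>

text \<open>
  The value at \<open>s \<noteq> 1\<close> of the analytic continuation to the plane minus the point 1 of
  the Dirichlet series with coefficients \<open>\<phi> n\<close>. The continuation is unique
  by the identity theorem, since the punctured plane is connected.
\<close>

definition L_function :: "(int \<Rightarrow> complex) \<Rightarrow> complex \<Rightarrow> complex" where
  "L_function \<phi> s =
     (THE w. \<exists>f. f holomorphic_on (- {1}) \<and>
        (\<forall>z. Re z > 1 \<longrightarrow> f z = (\<Sum>n. \<phi> (int (Suc n)) * of_nat (Suc n) powr (- z))) \<and>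
        w = f s)"

section \<open>Modular forms of half-integral weight\<close>

definition upper_half_plane :: "complex set" where
  "upper_half_plane = {\<tau>. Im \<tau> > 0}"

definition nome :: "complex \<Rightarrow> complex" where
  "nome \<tau> = exp (2 * of_real pi * \<i> * \<tau>)"

definition qseries :: "(nat \<Rightarrow> complex) \<Rightarrow> complex \<Rightarrow> complex" where
  "qseries a \<tau> = (\<Sum>n. a n * nome \<tau> ^ n)"

definition theta :: "complex \<Rightarrow> complex" where
  "theta \<tau> = (\<Sum>\<^sub>\<infinity>s::int. nome \<tau> ^ nat (s\<^sup>2))"

definition moebius_act :: "int \<Rightarrow> int \<Rightarrow> int \<Rightarrow> int \<Rightarrow> complex \<Rightarrow> complex" where
  "moebius_act a b c d \<tau> = (of_int a * \<tau> + of_int b) / (of_int c * \<tau> + of_int d)"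

text \<open>
  Holomorphy at all cusps in weight \<open>k + 1/2\<close>: for every matrix in the full modular group, the
  transformed function has an expansion in nonnegative powers of \<open>exp (2 \<pi> i \<tau> / M)\<close> for
  some \<open>M\<close>. The power is the principal branch; another branch of the square root
  only changes the sign of the whole expansion. A possible nontrivial root of unity
  in the translation behaviour at a cusp is absorbed by taking \<open>M\<close> to be
  a multiple of the cusp width.
\<close>

definition holomorphic_at_cusps :: "nat \<Rightarrow> (complex \<Rightarrow> complex) \<Rightarrow> bool" where
  "holomorphic_at_cusps k h \<longleftrightarrow>
     (\<forall>a b c d :: int. a * d - b * c = 1 \<longrightarrow>
       (\<exists>M :: nat. M > 0 \<and> (\<exists>e :: nat \<Rightarrow> complex. \<forall>\<tau>\<in>upper_half_plane.
          (\<lambda>n. e n * nome (\<tau> / of_nat M) ^ n) sums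
            ((of_int c * \<tau> + of_int d) powr (- (of_nat k + 1 / 2)) * h (moebius_act a b c d \<tau>)))))"

text \<open>The set of modular forms of weight \<open>k + 1/2\<close>, level \<open>N\<close> and character \<open>\<psi>\<close>.\<close>

definition half_integral_forms ::
    "nat \<Rightarrow> nat \<Rightarrow> (int \<Rightarrow> complex) \<Rightarrow> (complex \<Rightarrow> complex) set" where
  "half_integral_forms k N \<psi> =
     {h. h holomorphic_on upper_half_plane \<and> holomorphic_at_cusps k h \<and>
         (\<forall>a b c d :: int. a * d - b * c = 1 \<and> int N dvd c \<longrightarrow>
           (\<forall>\<tau>\<in>upper_half_plane.
              h (moebius_act a b c d \<tau>) / theta (moebius_act a b c d \<tau>) ^ (2 * k + 1) =
              \<psi> d * (h \<tau> / theta \<tau> ^ (2 * k + 1))))}"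

section \<open>Shimura-type lifts\<close>

text \<open>
  The lifts are given by their coefficient sequences, in terms of the coefficients \<open>c\<close> of \<open>h\<close>;
  as functions on the upper half-plane they are obtained by applying \<^const>\<open>qseries\<close>.
\<close>

definition lift_coeff ::
    "nat \<Rightarrow> (int \<Rightarrow> complex) \<Rightarrow> (nat \<Rightarrow> complex) \<Rightarrow> nat \<Rightarrow> nat \<Rightarrow> complex" where
  "lift_coeff k \<phi> c m n =
     (if n = 0 then c 0 / 2 * L_function \<phi> (1 - of_nat k)
      else (\<Sum>d | d dvd n. \<phi> (int d) * of_nat d ^ (k - 1) * c ((n div d)\<^sup>2 * m)))"

definition disc_of :: "nat \<Rightarrow> int \<Rightarrow> int" where
  "disc_of k t = (THE D. D \<in> {(-1) ^ k * t, (-1) ^ k * (4 * t)} \<and> fundamental_discriminant D)"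

definition S0_coeff :: "nat \<Rightarrow> (int \<Rightarrow> complex) \<Rightarrow> (nat \<Rightarrow> complex) \<Rightarrow> int \<Rightarrow> nat \<Rightarrow> complex" where
  "S0_coeff k \<psi> c t = lift_coeff k (\<lambda>n. \<psi> n * kronecker_char (disc_of k t) n) c (nat t)"

definition S1_coeff :: "nat \<Rightarrow> (int \<Rightarrow> complex) \<Rightarrow> (nat \<Rightarrow> complex) \<Rightarrow> int \<Rightarrow> nat \<Rightarrow> complex" where
  "S1_coeff k \<psi> c D = lift_coeff k (\<lambda>n. \<psi> n * kronecker_char D n) c (nat \<bar>D\<bar>)"

definition S2_coeff ::
    "nat \<Rightarrow> nat \<Rightarrow> (int \<Rightarrow> complex) \<Rightarrow> (nat \<Rightarrow> complex) \<Rightarrow> int \<Rightarrow> nat \<Rightarrow> complex" where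
  "S2_coeff k N \<psi> c D =
     lift_coeff k (\<lambda>n. char_to_modulus N \<psi> (N div 4) n * kronecker_char D n) c (nat \<bar>D\<bar>)"

text \<open>Here \<open>\<psi>'\<close> is the character modulo \<open>N / 4\<close> with \<open>\<psi> = \<chi>\<^sub>-\<^sub>4 \<psi>'\<close>.\<close>

definition S3_coeff :: "nat \<Rightarrow> (int \<Rightarrow> complex) \<Rightarrow> (nat \<Rightarrow> complex) \<Rightarrow> int \<Rightarrow> nat \<Rightarrow> complex" where
  "S3_coeff k \<psi>' c D = lift_coeff k (\<lambda>n. \<psi>' n * kronecker_char D n) c (nat \<bar>D\<bar>)"

definition U2 :: "(nat \<Rightarrow> complex) \<Rightarrow> nat \<Rightarrow> complex" where
  "U2 a n = a (2 * n)"

definition S0 :: "nat \<Rightarrow> (int \<Rightarrow> complex) \<Rightarrow> (nat \<Rightarrow> complex) \<Rightarrow> int \<Rightarrow> complex \<Rightarrow> complex" where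
  "S0 k \<psi> c t = qseries (S0_coeff k \<psi> c t)"

definition S1 :: "nat \<Rightarrow> (int \<Rightarrow> complex) \<Rightarrow> (nat \<Rightarrow> complex) \<Rightarrow> int \<Rightarrow> complex \<Rightarrow> complex" where
  "S1 k \<psi> c D = qseries (S1_coeff k \<psi> c D)"

definition S2 ::
    "nat \<Rightarrow> nat \<Rightarrow> (int \<Rightarrow> complex) \<Rightarrow> (nat \<Rightarrow> complex) \<Rightarrow> int \<Rightarrow> complex \<Rightarrow> complex" where
  "S2 k N \<psi> c D = qseries (S2_coeff k N \<psi> c D)"

definition S3 :: "nat \<Rightarrow> (int \<Rightarrow> complex) \<Rightarrow> (nat \<Rightarrow> complex) \<Rightarrow> int \<Rightarrow> complex \<Rightarrow> complex" where
  "S3 k \<psi>' c D = qseries (S3_coeff k \<psi>' c D)"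

end

(*
On coefficients the identities are rearrangements of divisor sums: psi kills the even d, and
passing to the character modulo N/4 only restores the Euler factor at 2. Two analytic facts are
needed to turn them into identities of functions.

The constant terms need the continuation of L(phi, s) for periodic phi. The Hurwitz series
W(s) = (s - 1) * sum_j (x + j)^(-s) is continued from one half plane to the next by summing the
Taylor expansion of (y + 1)^(1 - s) over y = x + j, where the left-hand side telescopes. The
Kronecker symbol of an odd fundamental discriminant is periodic by quadratic reciprocity.

The q-series converge because the coefficients of h grow at most polynomially. For this,
|theta|^4 Im(tau) is invariant under Gamma0(4), hence |h|^4 Im(tau)^(2k+1) under Gamma0(N); with
the expansions at the finitely many cusps this bounds |h| by a power of 1 / Im(tau) near the
real axis, and Cauchy's inequality applies. The inversion formula for theta is obtained, after
Polya, as the limit m = t l^2 of the average of (2 cos(pi j / l))^(2m) over j modulo l, computed by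
the binomial theorem and roots of unity: one side tends to a theta series at t, the other at 1/t.
*)
theory Submission
  imports Defs "HOL-Real_Asymp.Real_Asymp"
begin

section \<open>Continuation of Dirichlet series with periodic coefficients\<close>

text \<open>\<open>qseries\<close> and \<open>L_function\<close> are total: a divergent series or a
  missing continuation would still denote something, but nothing provable. So summability has to be
  established wherever a q-series is split or recombined, and a continuation has to be exhibited
  before the constant terms of (1) can be compared when N/4 and D are both odd, the case in which
  the two characters differ at even integers.

  Weight k + 1/2 brings square roots of the automorphy factor. Fourth powers of absolute values turn
  them into integral powers and hide the choice of branch, so the multiplier of theta never has to
  be computed. The rule for h is stated for the quotient h / theta^(2k+1), which says 0 = 0 at a
  zero of theta; invariance reaches such points by continuity.

  The averaging argument takes l odd and t l^2 integral, hence t rational. It gives the inversion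
  formula only at points of the imaginary axis with such t, and a sequence of them accumulating
  inside the upper half-plane feeds the identity theorem.\<close>

lemma holomorphic_on_suminf:
  fixes f :: "nat \<Rightarrow> complex \<Rightarrow> complex"
  assumes S: "open S" and hol: "\<And>n. f n holomorphic_on S"
    and bound: "\<And>z. z \<in> S \<Longrightarrow> \<exists>r>0. \<exists>M. cball z r \<subseteq> S \<and> summable M \<and> (\<forall>n. \<forall>w\<in>cball z r. norm (f n w) \<le> M n)"
  shows "(\<lambda>z. \<Sum>n. f n z) holomorphic_on S"
proof (rule holomorphic_uniform_sequence[OF S])
  show "(\<lambda>z. \<Sum>i<n. f i z) holomorphic_on S" for n
    by (intro holomorphic_on_sum hol)
  fix z assume "z \<in> S"
  from bound[OF this] obtain r M where r: "r > 0" "cball z r \<subseteq> S" "summable M"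
    "\<forall>n. \<forall>w\<in>cball z r. norm (f n w) \<le> M n"
    by (elim exE conjE)
  have "uniform_limit (cball z r) (\<lambda>n z. \<Sum>i<n. f i z) (\<lambda>z. \<Sum>n. f n z) sequentially"
    using r by (intro Weierstrass_m_test) auto
  then show "\<exists>d>0. cball z d \<subseteq> S \<and> uniform_limit (cball z d) (\<lambda>n z. \<Sum>i<n. f i z) (\<lambda>z. \<Sum>n. f n z) sequentially"
    using r by blast
qed

section \<open>The Hurwitz zeta function and its Taylor remainders\<close>

lemma summable_shifted_powr:
  fixes x a :: real
  assumes "x > 0" "a > 1"
  shows "summable (\<lambda>j. (x + real j) powr (- a))"
proof (rule summable_comparison_test)
  show "summable (\<lambda>n. real n powr (- a))"
    using assms by (simp add: summable_real_powr_iff)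
  show "\<exists>N. \<forall>n\<ge>N. norm ((x + real n) powr - a) \<le> real n powr - a"
    using assms by (intro exI[of _ 1]) (auto intro!: powr_mono2')
qed

text \<open>The falling factorial of 1 - s, that is, the coefficient in the i-th derivative of
  u^(1-s).\<close>

definition falling :: "complex \<Rightarrow> nat \<Rightarrow> complex" where
  "falling s i = (\<Prod>j<i. 1 - s - of_nat j)"

definition powr_remainder :: "nat \<Rightarrow> complex \<Rightarrow> real \<Rightarrow> complex" where
  "powr_remainder K s y = of_real (y + 1) powr (1 - s)
     - (\<Sum>i\<le>K. falling s i * of_real y powr (1 - s - of_nat i) / fact i)"

text \<open>Taylor's bound on the segment from y to y + 1, whose length 1 removes the powers of the
  increment. The derivative of order K + 1 carries u^(-s-K), and the condition on s makes its
  modulus largest at the left end y.\<close>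

lemma norm_powr_remainder_le:
  assumes y: "y > 0" and s: "Re s + real K \<ge> 0"
  shows "norm (powr_remainder K s y) \<le> norm (falling s (Suc K)) * y powr (- Re s - real K)"
proof -
  define S :: "complex set" where "S = closed_segment (of_real y) (of_real (y + 1))"
  define f where "f = (\<lambda>i u. falling s i * u powr (1 - s - of_nat i))"
  have S: "\<exists>v. u = of_real v \<and> y \<le> v" if "u \<in> S" for u
    using that unfolding S_def closed_segment_of_real
    by (auto simp: closed_segment_eq_real_ivl)
  have "cmod (f 0 (of_real (y+1)) - (\<Sum>i\<le>K. f i (of_real y) * (of_real (y+1) - of_real y) ^ i / fact i))
      \<le> (norm (falling s (Suc K)) * y powr (- Re s - real K)) * cmod (of_real (y+1) - of_real y) ^ Suc K / fact K"
  proof (rule complex_Taylor[of S])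
    show "convex S" by (simp add: S_def)
    show "of_real y \<in> S" "of_real (y+1) \<in> S" by (auto simp: S_def)
    fix u assume "u \<in> S"
    then obtain v where v: "u = of_real v" "y \<le> v" using S by blast
    show "(f i has_field_derivative f (Suc i) u) (at u within S)" for i
      unfolding f_def using v y
      by (auto intro!: derivative_eq_intros simp: falling_def algebra_simps)
    have "norm (u powr (1 - s - of_nat (Suc K))) = v powr (- Re s - real K)"
      using v y by (simp add: norm_powr_real_powr)
    also have "\<dots> \<le> y powr (- Re s - real K)"
      using v y s by (intro powr_mono2') auto
    finally show "cmod (f (Suc K) u) \<le> norm (falling s (Suc K)) * y powr (- Re s - real K)"
      unfolding f_def norm_mult by (intro mult_left_mono) auto
  qed
  also have "f 0 (of_real (y+1)) - (\<Sum>i\<le>K. f i (of_real y) * (of_real (y+1) - of_real y) ^ i / fact i)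
     = powr_remainder K s y"
    by (simp add: powr_remainder_def f_def falling_def)
  also have "(norm (falling s (Suc K)) * y powr (- Re s - real K)) * cmod (of_real (y+1) - of_real y) ^ Suc K / fact K
     = (norm (falling s (Suc K)) * y powr (- Re s - real K)) / fact K"
    by simp
  also have "\<dots> \<le> (norm (falling s (Suc K)) * y powr (- Re s - real K)) / 1"
    by (intro divide_left_mono) (auto simp: fact_ge_1)
  finally show ?thesis by simp
qed

lemma holomorphic_on_falling [holomorphic_intros]: "(\<lambda>s. falling s i) holomorphic_on S"
  unfolding falling_def by (intro holomorphic_intros)

text \<open>The remainder decays like j^(-Re s - K), which is summable in exactly this half-plane:
  every further Taylor term gains one unit to the left.\<close>

lemma holomorphic_sum_powr_remainder:
  assumes x: "x > 0"
  shows "(\<lambda>s. \<Sum>j. powr_remainder K s (x + real j)) holomorphic_on {s. Re s > 1 - real K}"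
proof (rule holomorphic_on_suminf)
  show "open {s. Re s > 1 - real K}" by (rule open_halfspace_Re_gt)
  show "(\<lambda>s. powr_remainder K s (x + real n)) holomorphic_on {s. Re s > 1 - real K}" for n
    unfolding powr_remainder_def using x
    by (intro holomorphic_intros) auto
  fix z assume z: "z \<in> {s. Re s > 1 - real K}"
  define r where "r = (Re z - (1 - real K)) / 2"
  have r: "r > 0" "Re z - r > 1 - real K" using z by (auto simp: r_def field_simps)
  have "compact ((\<lambda>s. falling s (Suc K)) ` cball z r)"
    by (intro compact_continuous_image holomorphic_on_imp_continuous_on holomorphic_intros) auto
  then have "bounded ((\<lambda>s. falling s (Suc K)) ` cball z r)" by (rule compact_imp_bounded)
  then obtain C where "\<forall>v\<in>(\<lambda>s. falling s (Suc K)) ` cball z r. norm v \<le> C"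
    unfolding bounded_iff by blast
  then have C: "norm (falling w (Suc K)) \<le> C" if "w \<in> cball z r" for w
    using that by blast
  have C0: "C \<ge> 0" using C[of z] r by (auto intro: order_trans[OF norm_ge_zero])
  \<comment> \<open>Finitely many bases x + j may lie below 1, where powers are monotone in the
    exponent in the opposite direction. Adding the powers for both extreme real parts on the disc
    covers either case.\<close>
  define M where "M = (\<lambda>j. C * ((x + real j) powr (- (Re z - r + real K)) + (x + real j) powr (- (Re z + r + real K))))"
  have re: "\<bar>Re z - Re w\<bar> \<le> r" if "w \<in> cball z r" for w
    using that abs_Re_le_cmod[of "z - w"] by (simp add: dist_norm)
  have "summable M"
    unfolding M_def using r x by (intro summable_mult summable_add summable_shifted_powr) auto
  moreover have "cball z r \<subseteq> {s. Re s > 1 - real K}"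
    using re r by (smt (verit) mem_Collect_eq subsetI)
  moreover have "norm (powr_remainder K w (x + real n)) \<le> M n" if w: "w \<in> cball z r" for n w
  proof -
    have y: "x + real n > 0" using x by simp
    have rw: "Re z - r \<le> Re w" "Re w \<le> Re z + r" using re[OF w] by auto
    have "(x + real n) powr (- Re w - real K) \<le> 
       (x + real n) powr (- (Re z - r + real K)) + (x + real n) powr (- (Re z + r + real K))"
    proof (cases "x + real n \<ge> 1")
      case True
      then have "(x + real n) powr (- Re w - real K) \<le> (x + real n) powr (- (Re z - r + real K))"
        using rw by (intro powr_mono) auto
      then show ?thesis by (smt (verit) powr_ge_zero)
    next
      case False
      then have "(x + real n) powr (- Re w - real K) \<le> (x + real n) powr (- (Re z + r + real K))"
        using rw y by (intro powr_mono') auto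
      then show ?thesis by (smt (verit) powr_ge_zero)
    qed
    moreover have "norm (powr_remainder K w (x + real n)) \<le> norm (falling w (Suc K)) * (x + real n) powr (- Re w - real K)"
      using y rw r by (intro norm_powr_remainder_le) auto
    ultimately show ?thesis unfolding M_def using C[OF w] C0
      by (smt (verit) mult_mono powr_ge_zero norm_ge_zero)
  qed
  ultimately show "\<exists>r>0. \<exists>M. cball z r \<subseteq> {s. Re s > 1 - real K} \<and> summable M \<and>
      (\<forall>n. \<forall>w\<in>cball z r. norm (powr_remainder K w (x + real n)) \<le> M n)"
    using r by blast
qed

text \<open>The Hurwitz zeta function \<zeta>(s, x), given by its series and so meaningful for Re s
  > 1.\<close>

definition hurwitz_series :: "real \<Rightarrow> complex \<Rightarrow> complex" where
  "hurwitz_series x s = (\<Sum>j. of_real (x + real j) powr (- s))"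

lemma hurwitz_series_sums:
  assumes "x > 0" "Re s > 1"
  shows "(\<lambda>j. of_real (x + real j) powr (- s)) sums hurwitz_series x s"
  unfolding hurwitz_series_def
proof (intro summable_sums summable_norm_cancel[of "\<lambda>j. of_real (x + real j) powr (- s)"])
  have "norm (of_real (x + real j) powr (- s)) = (x + real j) powr (- Re s)" for j
    using assms by (subst norm_powr_real_powr) auto
  then show "summable (\<lambda>j. norm (of_real (x + real j) powr (- s)))"
    using summable_shifted_powr[of x "Re s"] assms by simp
qed

text \<open>Over y = x + j the differences (y + 1)^(1-s) - y^(1-s) telescope to -x^(1-s). The Taylor
  term i = 1 yields (1 - s) \<zeta>(s, x), and the terms i >= 2 involve \<zeta>(s + i - 1, x). The
  last factor of \<open>falling s i\<close> is minus ((s + i - 1) - 1), precisely the factor that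
  cancels the pole of that value, so the recursion closes for the function (s - 1) \<zeta>(s,
  x).\<close>

lemma hurwitz_series_recursion:
  assumes x: "x > 0" and s: "Re s > 1"
  shows "(s - 1) * hurwitz_series x s = of_real x powr (1 - s)
    - (\<Sum>i\<in>{2..Suc K}. falling s (i - 1) / fact i * ((s + of_nat (i - 1) - 1) * hurwitz_series x (s + of_nat (i - 1))))
    + (\<Sum>j. powr_remainder (Suc K) s (x + real j))"
proof -
  define g where "g = (\<lambda>j. of_real (x + real j) powr (1 - s) :: complex)"
  have ng: "norm (g j) = (x + real j) powr (1 - Re s)" for j
    unfolding g_def using x by (subst norm_powr_real_powr) auto
  have "((\<lambda>j. (x + real j) powr (1 - Re s)) \<longlongrightarrow> 0) sequentially"
    by (rule tendsto_neg_powr) (use s in \<open>auto intro!: filterlim_tendsto_add_at_top filterlim_real_sequentially\<close>)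
  then have "g \<longlonglongrightarrow> 0"
    by (subst tendsto_norm_zero_iff[symmetric]) (simp add: ng)
  then have tel: "(\<lambda>j. g (Suc j) - g j) sums (0 - g 0)"
    by (rule telescope_sums)
  have trm: "(\<lambda>j. falling s i / fact i * of_real (x + real j) powr (- (s + of_nat (i - 1)))) sums
      (falling s i / fact i * hurwitz_series x (s + of_nat (i - 1)))" for i
    using x s by (intro sums_mult hurwitz_series_sums) auto
  have "(\<lambda>j. g (Suc j) - g j - (\<Sum>i\<in>{1..Suc K}. falling s i / fact i * of_real (x + real j) powr (- (s + of_nat (i - 1)))))
     sums (0 - g 0 - (\<Sum>i\<in>{1..Suc K}. falling s i / fact i * hurwitz_series x (s + of_nat (i - 1))))"
    by (intro sums_diff tel sums_sum trm)
  moreover have "g (Suc j) - g j - (\<Sum>i\<in>{1..Suc K}. falling s i / fact i * of_real (x + real j) powr (- (s + of_nat (i - 1))))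
      = powr_remainder (Suc K) s (x + real j)" for j
  proof -
    have "(\<Sum>i\<le>Suc K. falling s i * of_real (x + real j) powr (1 - s - of_nat i) / fact i) =
        g j + (\<Sum>i\<in>{1..Suc K}. falling s i * of_real (x + real j) powr (1 - s - of_nat i) / fact i)"
      by (simp add: g_def falling_def atMost_atLeast0 sum.atLeast_Suc_atMost del: sum.cl_ivl_Suc)
    also have "(\<Sum>i\<in>{1..Suc K}. falling s i * of_real (x + real j) powr (1 - s - of_nat i) / fact i) =
       (\<Sum>i\<in>{1..Suc K}. falling s i / fact i * of_real (x + real j) powr (- (s + of_nat (i - 1))))"
      by (intro sum.cong refl) (auto simp: of_nat_diff algebra_simps)
    finally show ?thesis
      by (simp add: powr_remainder_def g_def add_ac)
  qed
  ultimately have "(\<lambda>j. powr_remainder (Suc K) s (x + real j)) sums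
     (0 - g 0 - (\<Sum>i\<in>{1..Suc K}. falling s i / fact i * hurwitz_series x (s + of_nat (i - 1))))"
    by (simp only:)
  then have "(\<Sum>j. powr_remainder (Suc K) s (x + real j)) =
     0 - g 0 - (\<Sum>i\<in>{1..Suc K}. falling s i / fact i * hurwitz_series x (s + of_nat (i - 1)))"
    by (rule sums_unique[symmetric])
  also have "(\<Sum>i\<in>{1..Suc K}. falling s i / fact i * hurwitz_series x (s + of_nat (i - 1))) =
     (1 - s) * hurwitz_series x s + (\<Sum>i\<in>{2..Suc K}. falling s i / fact i * hurwitz_series x (s + of_nat (i - 1)))"
    by (subst sum.atLeast_Suc_atMost) (auto simp: falling_def numeral_2_eq_2)
  also have "(\<Sum>i\<in>{2..Suc K}. falling s i / fact i * hurwitz_series x (s + of_nat (i - 1))) =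
    - (\<Sum>i\<in>{2..Suc K}. falling s (i - 1) / fact i * ((s + of_nat (i - 1) - 1) * hurwitz_series x (s + of_nat (i - 1))))"
    unfolding sum_negf[symmetric]
  proof (intro sum.cong refl)
    fix i assume "i \<in> {2..Suc K}"
    then obtain n where n: "i = Suc n" by (cases i) auto
    show "falling s i / fact i * hurwitz_series x (s + of_nat (i - 1)) =
       - (falling s (i - 1) / fact i * ((s + of_nat (i - 1) - 1) * hurwitz_series x (s + of_nat (i - 1))))"
      unfolding n by (simp add: falling_def field_simps del: fact_Suc)
  qed
  finally show ?thesis by (simp add: g_def algebra_simps)
qed

text \<open>In the recursion the values at s + i - 1 with i >= 2 lie at least one unit to the right,
  where W is already available, and the remainder of order K + 1 sums for Re s > -K.\<close>

lemma hurwitz_halfplane_continuation: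
  assumes x: "x > 0"
  shows "\<exists>W. W holomorphic_on {s. Re s > 1 - real K} \<and>
     (\<forall>s. Re s > 1 \<longrightarrow> W s = (s - 1) * hurwitz_series x s)"
proof (induction K)
  case 0
  have "(\<lambda>s. hurwitz_series x s) holomorphic_on {s. Re s > 1 - real 0}"
    unfolding hurwitz_series_def
  proof (rule holomorphic_on_suminf)
    show "open {s. Re s > 1 - real 0}" by (rule open_halfspace_Re_gt)
    show "(\<lambda>s. of_real (x + real n) powr - s) holomorphic_on {s. Re s > 1 - real 0}" for n
      by (intro holomorphic_intros)
    fix z assume z: "z \<in> {s. Re s > 1 - real 0}"
    define r where "r = (Re z - 1) / 2"
    have r: "r > 0" "Re z - r > 1" using z by (auto simp: r_def field_simps)
    define M where "M = (\<lambda>j. (x + real j) powr (- (Re z - r)) + (x + real j) powr (- (Re z + r)))"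
    have re: "\<bar>Re z - Re w\<bar> \<le> r" if "w \<in> cball z r" for w
      using that abs_Re_le_cmod[of "z - w"] by (simp add: dist_norm)
    have "summable M"
      unfolding M_def using r x by (intro summable_add summable_shifted_powr) auto
    moreover have "cball z r \<subseteq> {s. Re s > 1 - real 0}"
      using re r by (smt (verit) mem_Collect_eq subsetI of_nat_0)
    moreover have "norm (of_real (x + real n) powr - w) \<le> M n" if w: "w \<in> cball z r" for n w
    proof -
      have rw: "Re z - r \<le> Re w" "Re w \<le> Re z + r" using re[OF w] by auto
      have "norm (of_real (x + real n) powr - w) = (x + real n) powr (- Re w)"
        using x by (subst norm_powr_real_powr) auto
      also have "\<dots> \<le> M n"
      proof (cases "x + real n \<ge> 1")
        case True
        then have "(x + real n) powr (- Re w) \<le> (x + real n) powr (- (Re z - r))"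
          using rw by (intro powr_mono) auto
        then show ?thesis unfolding M_def by (smt (verit) powr_ge_zero)
      next
        case False
        then have "(x + real n) powr (- Re w) \<le> (x + real n) powr (- (Re z + r))"
          using rw x by (intro powr_mono') auto
        then show ?thesis unfolding M_def by (smt (verit) powr_ge_zero)
      qed
      finally show ?thesis .
    qed
    ultimately show "\<exists>r>0. \<exists>M. cball z r \<subseteq> {s. Re s > 1 - real 0} \<and> summable M \<and>
        (\<forall>n. \<forall>w\<in>cball z r. norm (of_real (x + real n) powr - w) \<le> M n)"
      using r by blast
  qed
  then have "(\<lambda>s. (s - 1) * hurwitz_series x s) holomorphic_on {s. Re s > 1 - real 0}"
    by (intro holomorphic_intros)
  then show ?case by blast
next
  case (Suc K)
  then obtain W where W: "W holomorphic_on {s. Re s > 1 - real K}"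
    "\<And>s. Re s > 1 \<Longrightarrow> W s = (s - 1) * hurwitz_series x s" by blast
  define V where "V = (\<lambda>s. of_real x powr (1 - s)
    - (\<Sum>i\<in>{2..Suc K}. falling s (i - 1) / fact i * W (s + of_nat (i - 1)))
    + (\<Sum>j. powr_remainder (Suc K) s (x + real j)))"
  have hW: "(\<lambda>s. W (s + of_nat (i - 1))) holomorphic_on {s. Re s > 1 - real (Suc K)}" if "i \<in> {2..Suc K}" for i
    using that
    by (intro holomorphic_on_compose[OF _ holomorphic_on_subset[OF W(1)], unfolded o_def])
       (auto intro!: holomorphic_intros)
  have "V holomorphic_on {s. Re s > 1 - real (Suc K)}"
    unfolding V_def using x
    by (intro holomorphic_on_add holomorphic_on_diff holomorphic_on_sum holomorphic_on_mult
          holomorphic_sum_powr_remainder hW) (auto intro!: holomorphic_intros)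
  moreover have "V s = (s - 1) * hurwitz_series x s" if "Re s > 1" for s
    unfolding V_def hurwitz_series_recursion[OF x that, of K]
    using that by (simp add: W(2))
  ultimately show ?case by blast
qed

lemma hurwitz_continuation:
  assumes x: "x > 0"
  obtains W where "W holomorphic_on UNIV" "\<And>s. Re s > 1 \<Longrightarrow> W s = (s - 1) * hurwitz_series x s"
proof -
  from hurwitz_halfplane_continuation[OF x] obtain W where
    W: "\<And>K. W K holomorphic_on {s. Re s > 1 - real K}"
       "\<And>K s. Re s > 1 \<Longrightarrow> W K s = (s - 1) * hurwitz_series x s"
    by metis
  \<comment> \<open>The chosen index exceeds 1 - Re s, so s lies in the half-plane of that W. Any
    other K whose half-plane contains s gives the same value by the identity theorem.\<close>
  define V where "V = (\<lambda>s. W (nat \<lceil>2 - Re s\<rceil>) s)"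
  have VW: "V s = W K s" if s: "Re s > 1 - real K" for K s
  proof -
    define L where "L = nat \<lceil>2 - Re s\<rceil>"
    have sL: "Re s > 1 - real L" unfolding L_def by linarith
    have "W L s = W K s"
    proof (rule analytic_continuation_open[of "{s. Re s > 1}" "{s. Re s > 1 - real (min L K)}" "W L" "W K"])
      show "{s. Re s > 1} \<noteq> {}" using complex_Re_of_int[of 2] by (metis empty_iff mem_Collect_eq one_less_numeral_iff Re_complex_of_real numeral_less_iff semiring_norm(76) one_less_numeral of_int_numeral)
      show "connected {s. 1 - real (min L K) < Re s}"
        by (intro convex_connected convex_halfspace_Re_gt)
    qed (use sL s W in \<open>auto intro!: holomorphic_on_subset[OF W(1)] open_halfspace_Re_gt\<close>)
    then show ?thesis by (simp add: V_def L_def)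
  qed
  have "V holomorphic_on UNIV"
  proof (rule holomorphic_onI)
    fix s :: complex
    define K where "K = nat \<lceil>2 - Re s\<rceil>"
    have "Re s > 1 - real K" unfolding K_def by linarith
    moreover have "V holomorphic_on {s. Re s > 1 - real K}"
      using W(1)[of K] by (rule holomorphic_transform) (auto simp: VW)
    ultimately have "V field_differentiable at s"
      by (auto simp: holomorphic_on_open open_halfspace_Re_gt field_differentiable_def)
    then show "V field_differentiable at s within UNIV" by simp
  qed
  then show thesis using that W(2) unfolding V_def by blast
qed

section \<open>Dirichlet series with periodic coefficients and their Euler factor at 2\<close>

lemma periodic_int_add_mult:
  fixes \<phi> :: "int \<Rightarrow> 'a"
  assumes "\<And>n. \<phi> (n + int q) = \<phi> n"
  shows "\<phi> (n + int q * int j) = \<phi> n"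
proof (induction j)
  case (Suc j)
  have "\<phi> (n + int q * int (Suc j)) = \<phi> ((n + int q * int j) + int q)"
    by (simp add: algebra_simps)
  then show ?case using assms Suc by simp
qed simp

lemma summable_dirichlet_series:
  assumes B: "\<And>n. norm (a n) \<le> B" and z: "Re z > 1"
  shows "summable (\<lambda>n. norm (a n * of_nat (Suc n) powr (- z)))"
proof (rule summable_comparison_test)
  show "summable (\<lambda>n. B * (1 + real n) powr (- Re z))"
    using z by (intro summable_mult summable_shifted_powr) auto
  have "norm (a n * of_nat (Suc n) powr (- z)) \<le> B * (1 + real n) powr (- Re z)" for n
  proof -
    have "norm (of_nat (Suc n) powr (- z) :: complex) = (1 + real n) powr (- Re z)"
      using norm_powr_real_powr[of "of_nat (Suc n)" "-z"] by simp
    then show ?thesis using B[of n] by (auto simp: norm_mult intro!: mult_right_mono)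
  qed
  then show "\<exists>N. \<forall>n\<ge>N. norm (norm (a n * of_nat (Suc n) powr (- z))) \<le> B * (1 + real n) powr (- Re z)"
    by simp
qed

text \<open>Periodicity is asked at positive n, where the Kronecker symbol is shown to be periodic
  and where a Dirichlet series looks. The bound is the sum of the absolute values over one
  period.\<close>

lemma periodic_imp_bounded:
  fixes \<phi> :: "int \<Rightarrow> complex"
  assumes q: "q > 0" and per: "\<And>n. n > 0 \<Longrightarrow> \<phi> (n + int q) = \<phi> n"
  obtains B where "\<And>n. norm (\<phi> (int (Suc n))) \<le> B"
proof -
  define \<phi>' where "\<phi>' n = \<phi> (int n + 1)" for n
  have per': "\<phi>' (n + q * j) = \<phi>' n" for n j
  proof (induction j)
    case (Suc j)
    have "\<phi>' (n + q * Suc j) = \<phi> ((int n + int q * int j + 1) + int q)"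
      by (simp add: \<phi>'_def algebra_simps)
    also have "\<dots> = \<phi> (int n + int q * int j + 1)" by (rule per) simp
    finally show ?case using Suc by (simp add: \<phi>'_def)
  qed simp
  have "norm (\<phi>' n) \<le> (\<Sum>i<q. norm (\<phi>' i))" for n
  proof -
    have "\<phi>' n = \<phi>' (n mod q)"
      using per'[of "n mod q" "n div q"] by simp
    moreover have "norm (\<phi>' (n mod q)) \<le> (\<Sum>i<q. norm (\<phi>' i))"
      using q by (intro member_le_sum) auto
    ultimately show ?thesis by simp
  qed
  then show thesis using that unfolding \<phi>'_def by (metis of_nat_Suc add.commute)
qed

text \<open>Sorting by residues, the series is q^(-s) times the sum of \<phi>(r) \<zeta>(s, r/q)
  over r = 1, ..., q.\<close>

lemma periodic_dirichlet_series_continuation: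
  fixes \<phi> :: "int \<Rightarrow> complex"
  assumes q: "q > 0" and per: "\<And>n. n > 0 \<Longrightarrow> \<phi> (n + int q) = \<phi> n"
  obtains F where "F holomorphic_on - {1}"
    "\<And>z. Re z > 1 \<Longrightarrow> F z = (\<Sum>n. \<phi> (int (Suc n)) * of_nat (Suc n) powr (- z))"
proof -
  have "\<exists>W. W holomorphic_on UNIV \<and> (\<forall>s. Re s > 1 \<longrightarrow> W s = (s - 1) * hurwitz_series (real (Suc r) / real q) s)" for r
    using hurwitz_continuation[of "real (Suc r) / real q"] q by (metis divide_pos_pos of_nat_0_less_iff zero_less_Suc)
  then obtain W where W: "\<And>r. W r holomorphic_on UNIV"
    "\<And>r s. Re s > 1 \<Longrightarrow> W r s = (s - 1) * hurwitz_series (real (Suc r) / real q) s"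
    by metis
  \<comment> \<open>The representatives are 1, ..., q rather than 0, ..., q - 1, so that the Hurwitz
    parameter is positive. Dividing by s - 1 undoes the factor contained in W, which is why the
    point 1 is excluded.\<close>
  define F where "F = (\<lambda>s. of_nat q powr (- s) * (\<Sum>r<q. \<phi> (int (Suc r)) * W r s) / (s - 1))"
  have per': "\<phi> (int (Suc (j * q + r))) = \<phi> (int (Suc r))" for j r
  proof (induction j)
    case (Suc j)
    have "\<phi> (int (Suc (Suc j * q + r))) = \<phi> (int (Suc (j * q + r)) + int q)"
      by (simp add: algebra_simps)
    also have "\<dots> = \<phi> (int (Suc (j * q + r)))"
      by (rule per) (metis of_nat_0_less_iff zero_less_Suc)
    finally show ?case using Suc by simp
  qed simp
  have "F holomorphic_on - {1}"
    unfolding F_def using q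
    by (intro holomorphic_intros holomorphic_on_subset[OF W(1)]) auto
  moreover have "F z = (\<Sum>n. \<phi> (int (Suc n)) * of_nat (Suc n) powr (- z))" if z: "Re z > 1" for z
  proof -
    obtain B where B: "\<And>n. norm (\<phi> (int (Suc n))) \<le> B"
      using periodic_imp_bounded[of q \<phi>, OF q per] by blast
    have "summable (\<lambda>n. \<phi> (int (Suc n)) * of_nat (Suc n) powr (- z))"
      by (rule summable_norm_cancel, rule summable_dirichlet_series[OF B z])
    then have "(\<lambda>n. sum (\<lambda>n. \<phi> (int (Suc n)) * of_nat (Suc n) powr (- z)) {n*q..<n*q+q}) sums
       (\<Sum>n. \<phi> (int (Suc n)) * of_nat (Suc n) powr (- z))"
      using q by (intro sums_group summable_sums) auto
    moreover have "sum (\<lambda>n. \<phi> (int (Suc n)) * of_nat (Suc n) powr (- z)) {j*q..<j*q+q} =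
       (\<Sum>r<q. \<phi> (int (Suc r)) * of_nat q powr (- z) * of_real (real (Suc r) / real q + real j) powr (- z))" for j
    proof -
      have "sum (\<lambda>n. \<phi> (int (Suc n)) * of_nat (Suc n) powr (- z)) {j*q..<j*q+q} =
        (\<Sum>r<q. \<phi> (int (Suc (j * q + r))) * of_nat (Suc (j * q + r)) powr (- z))"
        by (rule sum.reindex_bij_witness[of _ "\<lambda>r. j * q + r" "\<lambda>n. n - j * q"]) auto
      also have "\<dots> = (\<Sum>r<q. \<phi> (int (Suc r)) * of_nat q powr (- z) * of_real (real (Suc r) / real q + real j) powr (- z))"
      proof (intro sum.cong refl)
        fix r
        have "real (Suc (j * q + r)) = real q * (real (Suc r) / real q + real j)"
          using q by (simp add: field_simps)
        from arg_cong[OF this, of complex_of_real]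
        have eq: "of_nat (Suc (j * q + r)) = (of_nat q :: complex) * of_real (real (Suc r) / real q + real j)"
          by (simp only: of_real_mult of_real_of_nat_eq)
        have "of_nat (Suc (j * q + r)) powr (- z) = of_nat q powr (- z) * of_real (real (Suc r) / real q + real j) powr (- z)"
          unfolding eq by (rule powr_times_real) auto
        then show "\<phi> (int (Suc (j * q + r))) * of_nat (Suc (j * q + r)) powr (- z) =
           \<phi> (int (Suc r)) * of_nat q powr (- z) * of_real (real (Suc r) / real q + real j) powr (- z)"
          using per'[of j r] by simp
      qed
      finally show ?thesis .
    qed
    moreover have "(\<lambda>j. \<Sum>r<q. \<phi> (int (Suc r)) * of_nat q powr (- z) * of_real (real (Suc r) / real q + real j) powr (- z)) sums
       (\<Sum>r<q. \<phi> (int (Suc r)) * of_nat q powr (- z) * hurwitz_series (real (Suc r) / real q) z)"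
      using q z by (intro sums_sum sums_mult hurwitz_series_sums) auto
    ultimately have "(\<Sum>n. \<phi> (int (Suc n)) * of_nat (Suc n) powr (- z)) =
       (\<Sum>r<q. \<phi> (int (Suc r)) * of_nat q powr (- z) * hurwitz_series (real (Suc r) / real q) z)"
      using sums_unique2 by fastforce
    also have "\<dots> = F z"
    proof -
      have "z - 1 \<noteq> 0" using z by auto
      then show ?thesis
        unfolding F_def by (simp add: W(2)[OF z] sum_distrib_left sum_divide_distrib mult_ac)
    qed
    finally show ?thesis by simp
  qed
  ultimately show thesis using that by blast
qed

text \<open>Resolves the definite description in \<open>L_function\<close>: one continuation is
  exhibited, and since the punctured plane is connected, the half-plane of convergence determines
  it.\<close>

lemma L_function_eqI:
  assumes "F holomorphic_on - {1}"
    and "\<And>z. Re z > 1 \<Longrightarrow> F z = (\<Sum>n. \<phi> (int (Suc n)) * of_nat (Suc n) powr (- z))"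
    and "s \<noteq> 1"
  shows "L_function \<phi> s = F s"
  unfolding L_function_def
proof (rule the_equality)
  show "\<exists>f. f holomorphic_on - {1} \<and>
      (\<forall>z. Re z > 1 \<longrightarrow> f z = (\<Sum>n. \<phi> (int (Suc n)) * of_nat (Suc n) powr (- z))) \<and> F s = f s"
    using assms by blast
  fix w assume "\<exists>f. f holomorphic_on - {1} \<and>
      (\<forall>z. Re z > 1 \<longrightarrow> f z = (\<Sum>n. \<phi> (int (Suc n)) * of_nat (Suc n) powr (- z))) \<and> w = f s"
  then obtain f where f: "f holomorphic_on - {1}" "w = f s"
     "\<And>z. Re z > 1 \<Longrightarrow> f z = (\<Sum>n. \<phi> (int (Suc n)) * of_nat (Suc n) powr (- z))" by blast
  have "f s = F s"
  proof (rule analytic_continuation_open[of "{s. Re s > 1}" "- {1}" f F])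
    have "2 \<in> {s. Re s > 1}" by simp
    then show "{s. Re s > 1} \<noteq> {}" by blast
    show "connected (- {1::complex})"
      by (intro connected_punctured_universe) simp
  qed (use f assms in \<open>auto intro: open_halfspace_Re_gt\<close>)
  then show "w = F s" using f by simp
qed

text \<open>The even terms of the series for \<phi> are \<phi>(2) 2^(-z) times the whole series, so
  deleting them multiplies by the Euler factor. The product of this factor with the continuation for
  \<phi> is then the continuation for \<eta>.\<close>

lemma L_function_remove_2:
  assumes q: "q > 0" and per: "\<And>n. n > 0 \<Longrightarrow> \<phi> (n + int q) = \<phi> n"
    and mult: "\<And>n. n > 0 \<Longrightarrow> \<phi> (2 * n) = \<phi> 2 * \<phi> n"
    and \<eta>: "\<And>n. n > 0 \<Longrightarrow> \<eta> n = (if even n then 0 else \<phi> n)"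
    and s: "s \<noteq> 1"
  shows "L_function \<eta> s = (1 - \<phi> 2 * 2 powr (- s)) * L_function \<phi> s"
proof -
  obtain F where F: "F holomorphic_on - {1}"
    "\<And>z. Re z > 1 \<Longrightarrow> F z = (\<Sum>n. \<phi> (int (Suc n)) * of_nat (Suc n) powr (- z))"
    using periodic_dirichlet_series_continuation[of q \<phi>, OF q per] by blast
  obtain B where B: "\<And>n. norm (\<phi> (int (Suc n))) \<le> B"
    using periodic_imp_bounded[of q \<phi>, OF q per] by blast
  have "L_function \<eta> s = (1 - \<phi> 2 * 2 powr (- s)) * F s"
  proof (rule L_function_eqI[OF _ _ s])
    show "(\<lambda>s. (1 - \<phi> 2 * 2 powr - s) * F s) holomorphic_on - {1}"
      by (intro holomorphic_intros F) auto
    fix z :: complex assume z: "Re z > 1"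
    define t where "t = (\<lambda>n. \<phi> (int n) * of_nat n powr (- z))"
    have t: "(\<lambda>n. t (Suc n)) sums F z"
      unfolding F(2)[OF z] t_def
      by (intro summable_sums summable_norm_cancel[OF summable_dirichlet_series[OF B z]])
    have t2: "t (2 * n) = \<phi> 2 * 2 powr (- z) * t n" if "n > 0" for n
    proof -
      have "of_nat (2 * n) powr (- z) = 2 powr (- z) * (of_nat n :: complex) powr (- z)"
        using powr_times_real[of 2 "of_nat n" "-z"] by simp
      then show ?thesis using mult[of "int n"] that by (simp add: t_def)
    qed
    have ev: "(\<lambda>n. t (2 * Suc n)) sums (\<phi> 2 * 2 powr (- z) * F z)"
      unfolding t2[OF zero_less_Suc] by (intro sums_mult t)
    \<comment> \<open>The series is indexed by m standing for m + 1, so the even integers occur at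
      the odd indices m = 2n + 1.\<close>
    have inj: "strict_mono (\<lambda>n::nat. 2 * n + 1)" by (auto simp: strict_mono_def)
    have "(\<lambda>m. if even (Suc m) then t (Suc m) else 0) sums (\<phi> 2 * 2 powr (- z) * F z)"
    proof -
      have "(\<lambda>n. (\<lambda>m. if even (Suc m) then t (Suc m) else 0) (2 * n + 1)) sums (\<phi> 2 * 2 powr (- z) * F z)"
        using ev by simp
      then show ?thesis
        by (subst (asm) sums_mono_reindex[OF inj]) (auto elim!: oddE)
    qed
    from sums_diff[OF t this]
    have "(\<lambda>m. t (Suc m) - (if even (Suc m) then t (Suc m) else 0)) sums ((1 - \<phi> 2 * 2 powr (- z)) * F z)"
      by (simp add: algebra_simps)
    also have "(\<lambda>m. t (Suc m) - (if even (Suc m) then t (Suc m) else 0)) =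
        (\<lambda>m. \<eta> (int (Suc m)) * of_nat (Suc m) powr (- z))"
    proof
      fix m
      show "t (Suc m) - (if even (Suc m) then t (Suc m) else 0) = \<eta> (int (Suc m)) * of_nat (Suc m) powr (- z)"
        by (subst \<eta>) (auto simp: t_def)
    qed
    finally show "(1 - \<phi> 2 * 2 powr - z) * F z = (\<Sum>n. \<eta> (int (Suc n)) * of_nat (Suc n) powr - z)"
      by (simp add: sums_iff)
  qed
  also have "F s = L_function \<phi> s"
    using L_function_eqI[OF F s] by simp
  finally show ?thesis .
qed

section \<open>The inversion formula for theta\<close>

text \<open>Expand 2 cos x = e^(-ix) (e^(2ix) + 1) by the binomial theorem at x = pi j / l. Summing
  over j is orthogonality of the l-th roots of unity and leaves the i congruent to m modulo l. The
  shift by -m is encoded as m (l - 1), which agrees modulo l and stays in the natural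
  numbers.\<close>

lemma sum_cos_power_eq_binomial:
  fixes l m :: nat
  assumes l: "l > 0"
  shows "(\<Sum>j<l. (2 * cos (pi * real j / real l)) ^ (2 * m)) =
    real l * (\<Sum>i | i \<le> 2 * m \<and> l dvd i + m * (l - 1). real (2 * m choose i))"
proof -
  define \<omega> where "\<omega> = (\<lambda>j e::nat. exp (2 * of_real pi * \<i> * of_nat (j * e) / of_nat l :: complex))"
  have \<omega>_pow: "\<omega> j e = \<omega> 1 e ^ j" for j e
    unfolding \<omega>_def by (subst exp_of_nat_mult[symmetric]) (simp add: field_simps)
  have \<omega>_1: "\<omega> 1 e = 1 \<longleftrightarrow> l dvd e" for e
    using complex_root_unity_eq_1[of l e] l unfolding \<omega>_def by simp
  have orth: "(\<Sum>j<l. \<omega> j e) = (if l dvd e then of_nat l else 0)" for e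
  proof (cases "l dvd e")
    case True
    then have "\<omega> 1 e = 1" using \<omega>_1 by blast
    then show ?thesis using True by (subst \<omega>_pow) simp
  next
    case False
    have "\<omega> 1 e ^ l = 1"
    proof -
      have "\<omega> 1 (l * e) = 1" using \<omega>_1 by simp
      moreover have "\<omega> 1 (l * e) = \<omega> l e" by (simp add: \<omega>_def)
      ultimately show ?thesis using \<omega>_pow[of l e] by simp
    qed
    moreover have "\<omega> 1 e \<noteq> 1" using False \<omega>_1 by blast
    ultimately show ?thesis using False geometric_sum[of "\<omega> 1 e" l] by (subst \<omega>_pow) simp
  qed
  have cosine: "of_real ((2 * cos (pi * real j / real l)) ^ (2 * m)) =
      (\<Sum>i\<le>2*m. of_nat (2 * m choose i) * \<omega> j (i + m * (l - 1)))" for j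
  proof -
    define x where "x = pi * real j / real l"
    define y where "y = 2 * cos x"
    have "of_real y = exp (- (\<i> * of_real x)) * (exp (2 * (\<i> * of_real x)) + 1)"
      by (simp add: y_def cos_of_real[symmetric] cos_exp_eq distrib_left exp_add[symmetric])
    then have "of_real (y ^ (2 * m)) =
        exp (- (\<i> * of_real x)) ^ (2 * m) * (\<Sum>i\<le>2*m. of_nat (2 * m choose i) * exp (2 * (\<i> * of_real x)) ^ i)"
      by (simp only: of_real_power power_mult_distrib binomial_ring power_one mult_1_right)
    also have "\<dots> = (\<Sum>i\<le>2*m. of_nat (2 * m choose i) * (exp (- (\<i> * of_real x)) ^ (2 * m) * exp (2 * (\<i> * of_real x)) ^ i))"
      by (simp add: sum_distrib_left mult_ac)
    also have "\<dots> = (\<Sum>i\<le>2*m. of_nat (2 * m choose i) * \<omega> j (i + m * (l - 1)))"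
    proof (intro sum.cong refl arg_cong2[where f = "(*)"])
      fix i
      show "exp (- (\<i> * of_real x)) ^ (2 * m) * exp (2 * (\<i> * of_real x)) ^ i = \<omega> j (i + m * (l - 1))"
      proof -
      \<comment> \<open>Replacing -m by m (l - 1) costs the multiple j m of the period 2 pi
        i.\<close>
      have "2 * of_real pi * \<i> * of_nat (j * (i + m * (l - 1))) / of_nat l =
          of_nat (2 * m) * (- (\<i> * of_real x)) + of_nat i * (2 * (\<i> * of_real x)) + of_nat (j * m) * (2 * of_real pi * \<i>)"
      proof -
        define L where "L = (of_nat l :: complex)"
        have L: "L \<noteq> 0" "of_nat (l - 1) = L - 1" using l by (auto simp: L_def of_nat_diff)
        then show ?thesis
          unfolding of_nat_add of_nat_mult L(2) by (simp add: x_def L_def[symmetric] field_simps)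
      qed
      then have "\<omega> j (i + m * (l - 1)) = exp (of_nat (2 * m) * (- (\<i> * of_real x))) *
         exp (of_nat i * (2 * (\<i> * of_real x))) * exp (of_nat (j * m) * (2 * of_real pi * \<i>))"
        unfolding \<omega>_def by (simp only: exp_add)
      also have "exp (of_nat (j * m) * (2 * of_real pi * \<i>)) = 1"
        by (subst exp_of_nat_mult) simp
      finally show ?thesis by (simp only: exp_of_nat_mult mult_1_right)
      qed
    qed
    finally show ?thesis by (simp add: x_def y_def)
  qed
  have "of_real (\<Sum>j<l. (2 * cos (pi * real j / real l)) ^ (2 * m)) =
      (\<Sum>j<l. \<Sum>i\<le>2*m. of_nat (2 * m choose i) * \<omega> j (i + m * (l - 1)))"
    by (simp only: of_real_sum cosine)
  also have "\<dots> = (\<Sum>i\<le>2*m. of_nat (2 * m choose i) * (\<Sum>j<l. \<omega> j (i + m * (l - 1))))"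
    by (subst sum.swap) (simp add: sum_distrib_left)
  also have "\<dots> = (\<Sum>i | i \<le> 2 * m \<and> l dvd i + m * (l - 1). of_nat (2 * m choose i) * of_nat l)"
    unfolding orth by (rule sum.mono_neutral_cong_right) auto
  also have "\<dots> = of_real (real l * (\<Sum>i | i \<le> 2 * m \<and> l dvd i + m * (l - 1). real (2 * m choose i)))"
    by (simp add: sum_distrib_left mult.commute)
  finally show ?thesis by (simp only: of_real_eq_iff)
qed

text \<open>The divisibility says that i is congruent to m modulo l, so i = m + r l or i = m - r l
  with r l <= m. The symmetry of the binomial coefficients about m folds the two families
  together.\<close>

lemma sum_binomial_residue_class:
  fixes l m :: nat
  assumes l: "l > 0"
  shows "(\<Sum>i | i \<le> 2 * m \<and> l dvd i + m * (l - 1). real (2 * m choose i)) =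
    real (2 * m choose m) + 2 * (\<Sum>r\<in>{1..m div l}. real (2 * m choose (m + r * l)))"
proof -
  let ?U = "(\<lambda>r. m + r * l) ` {1..m div l}" and ?L = "(\<lambda>r. m - r * l) ` {1..m div l}"
  have rl: "r * l \<le> m" if "r \<le> m div l" for r
    using that by (metis div_times_less_eq_dividend le_trans mult_le_mono1)
  have dvd_iff: "l dvd i + m * (l - 1) \<longleftrightarrow> int l dvd int i - int m" for i
  proof -
    have "int (i + m * (l - 1)) = (int i - int m) + int l * int m"
      using l by (cases l) (auto simp: algebra_simps)
    then show ?thesis
      by (metis dvd_add_left_iff dvd_triv_left int_dvd_int_iff)
  qed
  have eq: "{i. i \<le> 2 * m \<and> l dvd i + m * (l - 1)} = {m} \<union> (?U \<union> ?L)"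
  proof (intro equalityI subsetI)
    fix i assume "i \<in> {i. i \<le> 2 * m \<and> l dvd i + m * (l - 1)}"
    then have i: "i \<le> 2 * m" "int l dvd int i - int m" using dvd_iff[of i] by auto
    consider "i = m" | "i > m" | "i < m" by linarith
    then show "i \<in> {m} \<union> (?U \<union> ?L)"
    proof cases
      case 2
      then have "int l dvd int (i - m)" using i by (simp add: of_nat_diff)
      then obtain r where r: "i - m = r * l" by (metis int_dvd_int_iff dvdE mult.commute)
      have "r \<le> m div l" using r i l by (metis less_eq_div_iff_mult_less_eq diff_le_mono mult_2 diff_add_inverse2)
      moreover have "r \<noteq> 0" using r 2 by (metis mult_0 diff_is_0_eq leD)
      ultimately show ?thesis using r 2 by (auto intro!: image_eqI[of _ _ r])
    next
      case 3
      then have "int l dvd int (m - i)" using i by (simp add: of_nat_diff dvd_diff_commute)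
      then obtain r where r: "m - i = r * l" by (metis int_dvd_int_iff dvdE mult.commute)
      have "r \<le> m div l" using r l by (metis less_eq_div_iff_mult_less_eq diff_le_self)
      moreover have "r \<noteq> 0" using r 3 by (metis mult_0 diff_is_0_eq leD)
      ultimately show ?thesis using r 3 by (auto intro!: image_eqI[of _ _ r])
    qed auto
  next
    fix i assume "i \<in> {m} \<union> (?U \<union> ?L)"
    then show "i \<in> {i. i \<le> 2 * m \<and> l dvd i + m * (l - 1)}"
      using rl by (auto simp: dvd_iff[simplified] of_nat_diff)
  qed
  have injU: "inj_on (\<lambda>r. m + r * l) {1..m div l}" using l by (auto simp: inj_on_def)
  have injL: "inj_on (\<lambda>r. m - r * l) {1..m div l}"
  proof (rule inj_onI)
    fix r s assume *: "r \<in> {1..m div l}" "s \<in> {1..m div l}" "m - r * l = m - s * l"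
    then have "r * l = s * l" using rl[of r] rl[of s] by (metis atLeastAtMost_iff diff_diff_cancel)
    then show "r = s" using l by simp
  qed
  have sL: "(\<Sum>i\<in>?L. real (2 * m choose i)) = (\<Sum>r\<in>{1..m div l}. real (2 * m choose (m + r * l)))"
    unfolding sum.reindex[OF injL] o_def
  proof (intro sum.cong refl)
    fix r assume "r \<in> {1..m div l}"
    then have "r * l \<le> m" using rl by auto
    then have "2 * m - (m - r * l) = m + r * l" by simp
    then show "real (2 * m choose (m - r * l)) = real (2 * m choose (m + r * l))"
      using binomial_symmetric[of "m - r * l" "2 * m"] by simp
  qed
  have sU: "(\<Sum>i\<in>?U. real (2 * m choose i)) = (\<Sum>r\<in>{1..m div l}. real (2 * m choose (m + r * l)))"
    unfolding sum.reindex[OF injU] o_def ..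
  have "m + r * l \<noteq> m - s * l" if "r \<ge> 1" for r s
    using l that by (metis add_diff_cancel_left' diff_le_self le_antisym le_add1 mult_is_0 not_one_le_zero less_not_refl diff_self_eq_0)
  then have "?U \<inter> ?L = {}" by auto
  moreover have "m \<notin> ?U \<union> ?L"
  proof -
    have "m - r * l \<noteq> m" if r: "1 \<le> r" "r \<le> m div l" for r
    proof -
      have "0 < r * l" using r l by simp
      then show ?thesis using rl[OF r(2)] by linarith
    qed
    then have "m \<notin> ?L" by (metis (no_types, lifting) atLeastAtMost_iff imageE)
    moreover have "m \<notin> ?U" using l by auto
    ultimately show ?thesis by blast
  qed
  ultimately show ?thesis
    unfolding eq using sU sL by (simp add: sum.union_disjoint)
qed

text \<open>The reflection of j to l - j pairs the nonzero j because l = 2N + 1 is odd. The angles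
  that remain lie below pi / 2, where the cosine is positive and can be compared with an
  exponential.\<close>

lemma sum_cos_power_symmetric:
  fixes N m :: nat
  shows "(\<Sum>j<2*N+1. (cos (pi * real j / real (2*N+1))) ^ (2 * m)) =
    1 + 2 * (\<Sum>j<N. (cos (pi * real (j + 1) / real (2*N+1))) ^ (2 * m))"
proof -
  define l where "l = 2 * N + 1"
  define f where "f = (\<lambda>j. (cos (pi * real j / real l)) ^ (2 * m))"
  have refl: "f (l - j) = f j" if "j \<le> l" for j
  proof -
    have "pi * real (l - j) / real l = pi - pi * real j / real l"
      using that by (simp add: of_nat_diff l_def field_simps)
    then show ?thesis by (simp add: f_def)
  qed
  have "{..<l} = insert 0 ({1..N} \<union> {N+1..2*N})" by (auto simp: l_def)
  then have "(\<Sum>j<l. f j) = f 0 + ((\<Sum>j\<in>{1..N}. f j) + (\<Sum>j\<in>{N+1..2*N}. f j))"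
    by (simp add: sum.union_disjoint)
  also have "(\<Sum>j\<in>{N+1..2*N}. f j) = (\<Sum>j\<in>{1..N}. f j)"
    by (rule sum.reindex_bij_witness[of _ "\<lambda>j. l - j" "\<lambda>j. l - j"]) (use refl in \<open>auto simp: l_def\<close>)
  also have "(\<Sum>j\<in>{1..N}. f j) = (\<Sum>j<N. f (j + 1))"
    by (rule sum.reindex_bij_witness[of _ "\<lambda>j. j + 1" "\<lambda>j. j - 1"]) auto
  finally show ?thesis by (simp add: f_def l_def)
qed

section \<open>Binomial coefficients near the centre and their Gaussian limit\<close>

definition central_ratio :: "nat \<Rightarrow> nat \<Rightarrow> real" where
  "central_ratio m R = real (2 * m choose (m + R)) / real (2 * m choose m)"

lemma central_ratio_0 [simp]: "central_ratio m 0 = 1"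
  by (simp add: central_ratio_def)

lemma central_ratio_Suc:
  "R \<le> m \<Longrightarrow> central_ratio m (Suc R) = central_ratio m R * (real m - real R) / (real m + real R + 1)"
proof -
  assume R: "R \<le> m"
  have "Suc (m + R) * (2 * m choose Suc (m + R)) = (2 * m - (m + R)) * (2 * m choose (m + R))"
    by (metis binomial_absorb_comp binomial_absorption)
  then have "real (Suc (m + R)) * real (2 * m choose Suc (m + R)) = real (2 * m - (m + R)) * real (2 * m choose (m + R))"
    by (metis of_nat_mult)
  moreover have "real (2 * m - (m + R)) = real m - real R" "real (Suc (m + R)) = real m + real R + 1"
    using R by auto
  ultimately have "(real m + real R + 1) * real (2 * m choose Suc (m + R)) = (real m - real R) * real (2 * m choose (m + R))"
    by metis
  then have "real (2 * m choose Suc (m + R)) = (real m - real R) * real (2 * m choose (m + R)) / (real m + real R + 1)"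
    by (simp add: field_simps)
  then show ?thesis by (simp add: central_ratio_def mult_ac)
qed

lemma central_ratio_nonneg: "central_ratio m R \<ge> 0"
  by (simp add: central_ratio_def)

text \<open>Each factor (m - s) / (m + s + 1) equals 1 - (2s + 1) / (m + s + 1), which is at most
  the exponential of -(2s + 1) / (m + R). The odd numbers 2s + 1 with s < R add up to R^2.\<close>

lemma central_ratio_le:
  assumes "R \<le> m"
  shows "central_ratio m R \<le> exp (- (real R)\<^sup>2 / (real m + real R))"
proof -
  \<comment> \<open>The denominator keeps the final R while s grows, so the exponents share one
    denominator and add.\<close>
  have "central_ratio m s \<le> exp (- (real s)\<^sup>2 / (real m + real R))" if "s \<le> R" for s
    using that
  proof (induction s)
    case (Suc s)
    have pos: "real m + real s + 1 > 0" "real m + real R > 0" using Suc.prems assms by auto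
    have "(real m - real s) / (real m + real s + 1) = 1 + (- (2 * real s + 1) / (real m + real s + 1))"
      using pos by (simp add: field_simps)
    also have "\<dots> \<le> exp (- (2 * real s + 1) / (real m + real s + 1))"
      by (rule exp_ge_add_one_self)
    also have "\<dots> \<le> exp (- (2 * real s + 1) / (real m + real R))"
      using Suc.prems pos unfolding minus_divide_left[symmetric] exp_le_cancel_iff neg_le_iff_le
      by (intro divide_left_mono mult_pos_pos) auto
    finally have *: "(real m - real s) / (real m + real s + 1) \<le> exp (- (2 * real s + 1) / (real m + real R))" .
    have "central_ratio m (Suc s) = central_ratio m s * ((real m - real s) / (real m + real s + 1))"
      using Suc.prems assms by (subst central_ratio_Suc) auto
    also have "\<dots> \<le> exp (- (real s)\<^sup>2 / (real m + real R)) * exp (- (2 * real s + 1) / (real m + real R))"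
      using Suc * assms by (intro mult_mono) auto
    also have "\<dots> = exp (- (real (Suc s))\<^sup>2 / (real m + real R))"
      by (simp add: exp_add[symmetric] add_divide_distrib[symmetric] power2_eq_square algebra_simps)
    finally show ?case .
  qed simp
  then show ?thesis by simp
qed

text \<open>Here 1 + x <= exp x is applied to the inverse factor (m + s + 1) / (m - s) = 1 + (2s +
  1) / (m - s), with m - s >= m + 1 - R. Both bounds tend to exp(-r^2 / t) when R = r l and m = t
  l^2.\<close>

lemma central_ratio_ge:
  assumes "R \<le> m"
  shows "central_ratio m R \<ge> exp (- (real R)\<^sup>2 / (real m + 1 - real R))"
proof -
  have "central_ratio m s \<ge> exp (- (real s)\<^sup>2 / (real m + 1 - real R))" if "s \<le> R" for s
    using that
  proof (induction s)
    case (Suc s)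
    have pos: "real m - real s > 0" "real m + 1 - real R > 0" "real m + real s + 1 > 0" using Suc.prems assms by auto
    have "exp (- (2 * real s + 1) / (real m + 1 - real R)) \<le> exp (- (2 * real s + 1) / (real m - real s))"
      using Suc.prems pos unfolding minus_divide_left[symmetric] exp_le_cancel_iff neg_le_iff_le
      by (intro divide_left_mono mult_pos_pos) auto
    also have "\<dots> = 1 / exp ((2 * real s + 1) / (real m - real s))"
      by (simp add: exp_minus inverse_eq_divide minus_divide_left[symmetric] del: minus_add_distrib)
    also have "\<dots> \<le> 1 / (1 + (2 * real s + 1) / (real m - real s))"
      using pos by (intro divide_left_mono exp_ge_add_one_self mult_pos_pos add_pos_nonneg) auto
    also have "\<dots> = (real m - real s) / (real m + real s + 1)"
      using pos by (simp add: field_simps)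
    finally have *: "exp (- (2 * real s + 1) / (real m + 1 - real R)) \<le> (real m - real s) / (real m + real s + 1)" .
    have "exp (- (real (Suc s))\<^sup>2 / (real m + 1 - real R)) = 
       exp (- (real s)\<^sup>2 / (real m + 1 - real R)) * exp (- (2 * real s + 1) / (real m + 1 - real R))"
      by (simp add: exp_add[symmetric] add_divide_distrib[symmetric] power2_eq_square algebra_simps)
    also have "\<dots> \<le> central_ratio m s * ((real m - real s) / (real m + real s + 1))"
      using Suc * assms central_ratio_nonneg by (intro mult_mono) auto
    also have "\<dots> = central_ratio m (Suc s)"
      using Suc.prems assms by (subst central_ratio_Suc) auto
    finally show ?case .
  qed simp
  then show ?thesis by simp
qed

text \<open>From cos x = 1 - 2 sin^2(x/2) and sin(x/2) >= x/4; the latter is the mean value theorem,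
  the cosine being at least 1/2 up to pi/3. The constant 8 is far from sharp, but a majorant only
  asks for some positive multiple of x^2.\<close>

lemma cos_le_exp:
  fixes x :: real
  assumes "0 \<le> x" "x \<le> pi / 2"
  shows "cos x \<le> exp (- x\<^sup>2 / 8)"
proof -
  have "x / 4 \<le> sin (x / 2)"
  proof (cases "x = 0")
    case False
    then have x: "0 < x / 2" using assms by simp
    obtain z where z: "0 < z" "z < x / 2" "sin (x / 2) - sin 0 = (x / 2 - 0) * cos z"
      using MVT2[OF x, of sin cos] by (auto intro: DERIV_sin)
    have "cos (pi / 3) \<le> cos z"
      using z assms by (intro cos_monotone_0_pi_le) auto
    then have "1 / 2 \<le> cos z" by (simp add: cos_60)
    then have "x / 2 * (1 / 2) \<le> x / 2 * cos z" using x by (intro mult_left_mono) auto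
    also have "\<dots> = sin (x / 2)" using z by simp
    finally show ?thesis by simp
  qed simp
  then have "(x / 4)\<^sup>2 \<le> (sin (x / 2))\<^sup>2" using assms by (intro power_mono) auto
  then have "cos x \<le> 1 + - x\<^sup>2 / 8"
    using cos_double_sin[of "x / 2"] by (simp add: power_divide)
  also have "\<dots> \<le> exp (- x\<^sup>2 / 8)" by (rule exp_ge_add_one_self)
  finally show ?thesis .
qed

text \<open>With a_m the central binomial coefficient divided by 4^m, the partial Wallis products
  are 1 / (a_m^2 (2m + 1)), so m a_m^2 tends to 1 / pi.\<close>

lemma wallis_binomial:
  "(\<lambda>m. sqrt (real m) * real (2 * m choose m) / 4 ^ m) \<longlonglongrightarrow> 1 / sqrt pi"
proof -
  define a where "a = (\<lambda>m. real (2 * m choose m) / 4 ^ m)"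
  have a_Suc: "a (Suc m) = a m * (2 * real m + 1) / (2 * real m + 2)" for m
  proof -
    define u v w where "u = real (2 * Suc m choose Suc m)" and "v = real (Suc (2 * m) choose m)" and "w = real (2 * m choose m)"
    have "Suc m * (Suc (Suc (2 * m)) choose Suc m) = Suc (Suc (2 * m)) * (Suc (2 * m) choose m)"
      by (metis Suc_times_binomial_eq mult.commute)
    then have "real (Suc m) * u = real (Suc (Suc (2 * m))) * v"
      unfolding u_def v_def by (metis of_nat_mult mult_Suc_right add_2_eq_Suc)
    then have u: "(real m + 1) * u = 2 * (real m + 1) * v" by (simp add: algebra_simps)
    have "Suc m * (Suc (2 * m) choose Suc m) = Suc (2 * m) * (2 * m choose m)"
      by (metis Suc_times_binomial_eq mult.commute)
    moreover have "Suc (2 * m) choose m = Suc (2 * m) choose Suc m"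
      using binomial_symmetric[of m "Suc (2 * m)"] by simp
    ultimately have "Suc m * (Suc (2 * m) choose m) = Suc (2 * m) * (2 * m choose m)" by simp
    then have "real (Suc m) * v = real (Suc (2 * m)) * w"
      unfolding v_def w_def by (metis of_nat_mult)
    then have v: "v = (2 * real m + 1) * w / (real m + 1)" by (simp add: field_simps)
    have "(real m + 1) * (u - 2 * v) = 0" using u by (simp add: algebra_simps)
    then have "u = 2 * v" by (simp add: add_nonneg_eq_0_iff)
    then have "u = 4 * (w * (2 * real m + 1) / (2 * real m + 2))"
      unfolding v by (simp add: field_simps)
    then have "u / (4 * 4 ^ m) = w / 4 ^ m * (2 * real m + 1) / (2 * real m + 2)"
      by simp
    then show ?thesis by (simp add: a_def u_def w_def)
  qed
  have apos: "a m > 0" for m by (simp add: a_def)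
  have "(\<Prod>k=1..m. (4*real k^2) / (4*real k^2 - 1)) = 1 / ((a m)\<^sup>2 * (2 * real m + 1))" for m
  proof (induction m)
    case 0 then show ?case by (simp add: a_def)
  next
    case (Suc m)
    have "4 * (real (Suc m))\<^sup>2 - 1 = (2 * real m + 1) * (2 * real m + 3)"
      by (simp add: power2_eq_square algebra_simps)
    then have "(4 * (real (Suc m))\<^sup>2) / (4 * (real (Suc m))\<^sup>2 - 1) = (2 * real m + 2)\<^sup>2 / ((2 * real m + 1) * (2 * real m + 3))"
      by (simp add: power2_eq_square algebra_simps)
    then have "(\<Prod>k=1..Suc m. (4*real k^2) / (4*real k^2 - 1)) =
       1 / ((a m)\<^sup>2 * (2 * real m + 1)) * ((2 * real m + 2)\<^sup>2 / ((2 * real m + 1) * (2 * real m + 3)))"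
      using Suc by (simp add: prod.nat_ivl_Suc')
    also have "\<dots> = 1 / ((a (Suc m))\<^sup>2 * (2 * real (Suc m) + 1))"
    proof -
      have "1 / (A\<^sup>2 * p) * (q\<^sup>2 / (p * r)) = 1 / ((A * p / q)\<^sup>2 * r)"
        if "p > 0" "q > 0" "r > 0" "A > 0" for A p q r :: real
        using that by (simp add: power_divide power_mult_distrib power2_eq_square)
      from this[of "2 * real m + 1" "2 * real m + 2" "2 * real m + 3" "a m"] show ?thesis
        using apos[of m] by (simp add: a_Suc add_ac)
    qed
    finally show ?case .
  qed
  then have "(\<lambda>m. 1 / ((a m)\<^sup>2 * (2 * real m + 1))) \<longlonglongrightarrow> pi / 2"
    using wallis by simp
  then have "(\<lambda>m. inverse (1 / ((a m)\<^sup>2 * (2 * real m + 1)))) \<longlonglongrightarrow> inverse (pi / 2)"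
    by (intro tendsto_inverse) auto
  moreover have "(\<lambda>m. real m / (2 * real m + 1)) \<longlonglongrightarrow> 1 / 2" by real_asymp
  ultimately have "(\<lambda>m. inverse (1 / ((a m)\<^sup>2 * (2 * real m + 1))) * (real m / (2 * real m + 1))) \<longlonglongrightarrow> inverse (pi / 2) * (1 / 2)"
    by (rule tendsto_mult)
  also have "(\<lambda>m. inverse (1 / ((a m)\<^sup>2 * (2 * real m + 1))) * (real m / (2 * real m + 1))) = (\<lambda>m. (a m)\<^sup>2 * real m)"
  proof
    fix m
    have "inverse (1 / (X * Y)) * (Z / Y) = X * Z" if "Y \<noteq> 0" for X Y Z :: real
      using that by simp
    then show "inverse (1 / ((a m)\<^sup>2 * (2 * real m + 1))) * (real m / (2 * real m + 1)) = (a m)\<^sup>2 * real m"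
      by (smt (verit) of_nat_0_le_iff)
  qed
  finally have "(\<lambda>m. sqrt ((a m)\<^sup>2 * real m)) \<longlonglongrightarrow> sqrt (inverse (pi / 2) * (1 / 2))"
    by (rule tendsto_real_sqrt)
  moreover have "sqrt ((a m)\<^sup>2 * real m) = sqrt (real m) * real (2 * m choose m) / 4 ^ m" for m
    using apos[of m] by (simp add: real_sqrt_mult a_def)
  moreover have "sqrt (inverse (pi / 2) * (1 / 2)) = 1 / sqrt pi"
    by (simp add: real_sqrt_divide inverse_eq_divide)
  ultimately show ?thesis by simp
qed

text \<open>The finite identity is divided by 4^m, with l = 2N + 1 and m = t l^2. On the left cos(pi
  J / l)^(2m) tends to exp(-pi^2 t J^2); on the right the binomial ratio at distance J l tends to
  exp(-J^2 / t), and the prefactor l a_m, with a_m the central binomial coefficient over 4^m,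
  supplies 1 / sqrt(pi t). Geometric majorants justify the interchange of limit and sum by Tannery's
  theorem.\<close>

lemma gaussian_sum_inversion:
  fixes t :: real and N m :: "nat \<Rightarrow> nat"
  assumes t: "t > 0" and N: "filterlim N at_top sequentially"
    and m: "\<And>n. real (m n) = t * (real (2 * N n + 1))\<^sup>2"
  shows "1 + 2 * (\<Sum>j. exp (- (pi\<^sup>2 * t) * (real (j + 1))\<^sup>2)) =
     1 / sqrt (pi * t) * (1 + 2 * (\<Sum>r. exp (- (real (r + 1))\<^sup>2 / t)))"
proof -
  define l where "l = (\<lambda>n. 2 * N n + 1)"
  define L where "L = (\<lambda>n. real (l n))"
  have lpos: "l n > 0" and Lpos: "L n > 0" for n by (auto simp: l_def L_def)
  have Lne: "L n \<noteq> 0" for n using Lpos[of n] by simp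
  have m': "real (m n) = t * (L n)\<^sup>2" for n using m by (simp add: L_def l_def)
  have Llim: "filterlim L at_top sequentially"
  proof (rule filterlim_at_top_mono)
    show "filterlim (\<lambda>n. real (N n)) at_top sequentially"
      by (rule filterlim_compose[OF filterlim_real_sequentially N])
    show "\<forall>\<^sub>F n in sequentially. real (N n) \<le> L n" by (auto simp: L_def l_def)
  qed
  \<comment> \<open>Tannery's theorem wants infinite series: \<open>a\<close> is extended by zero
    beyond N, while in \<open>b\<close> the binomial coefficient vanishes by itself once the
    distance exceeds m.\<close>
  define a where "a = (\<lambda>j n. if j < N n then cos (pi * real (j + 1) / L n) ^ (2 * m n) else 0)"
  define b where "b = (\<lambda>r n. central_ratio (m n) ((r + 1) * l n))"
  define C where "C = (\<lambda>n. L n * real (2 * m n choose m n) / 4 ^ m n)"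
  have ident: "1 + 2 * (\<Sum>j. a j n) = C n * (1 + 2 * (\<Sum>r. b r n))" for n
  proof -
    have "(\<Sum>j. a j n) = (\<Sum>j<N n. a j n)"
      by (rule suminf_finite) (auto simp: a_def)
    also have "\<dots> = (\<Sum>j<N n. cos (pi * real (j + 1) / real (2 * N n + 1)) ^ (2 * m n))"
      by (intro sum.cong) (auto simp: a_def L_def l_def)
    finally have "1 + 2 * (\<Sum>j. a j n) = (\<Sum>j<l n. cos (pi * real j / real (l n)) ^ (2 * m n))"
      unfolding l_def sum_cos_power_symmetric by simp
    also have "\<dots> = (\<Sum>j<l n. (2 * cos (pi * real j / real (l n))) ^ (2 * m n)) / 4 ^ m n"
      by (simp add: power_mult_distrib power_mult sum_distrib_left[symmetric])
    also have "\<dots> = real (l n) * (real (2 * m n choose m n) + 2 * (\<Sum>r\<in>{1..m n div l n}. real (2 * m n choose (m n + r * l n)))) / 4 ^ m n"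
      unfolding sum_cos_power_eq_binomial[OF lpos] sum_binomial_residue_class[OF lpos] ..
    also have "(\<Sum>r\<in>{1..m n div l n}. real (2 * m n choose (m n + r * l n))) =
       real (2 * m n choose m n) * (\<Sum>r\<in>{1..m n div l n}. central_ratio (m n) (r * l n))"
      by (simp add: central_ratio_def sum_distrib_left)
    also have "(\<Sum>r\<in>{1..m n div l n}. central_ratio (m n) (r * l n)) = (\<Sum>r<m n div l n. b r n)"
      unfolding b_def by (rule sum.reindex_bij_witness[of _ "\<lambda>r. r + 1" "\<lambda>r. r - 1"]) auto
    also have "\<dots> = (\<Sum>r. b r n)"
    proof (rule suminf_finite[symmetric])
      fix r assume "r \<notin> {..<m n div l n}"
      then have "m n div l n < r + 1" by simp
      then have "m n < (r + 1) * l n" using lpos[of n] by (simp add: div_less_iff_less_mult)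
      then have "2 * m n < m n + (r + 1) * l n" by linarith
      then show "b r n = 0" unfolding b_def central_ratio_def by (simp add: binomial_eq_0)
    qed simp
    finally show ?thesis by (simp add: C_def L_def algebra_simps)
  qed
  have alim: "a j \<longlonglongrightarrow> exp (- (pi\<^sup>2 * t) * (real (j + 1))\<^sup>2)" for j
  proof -
    define J where "J = real (j + 1)"
    have J: "J > 0" by (simp add: J_def)
    have x0: "filterlim (\<lambda>n. pi * J / L n) (at_right 0) sequentially"
      unfolding filterlim_at using J Lpos Lne
      by (auto intro!: always_eventually tendsto_divide_0[OF tendsto_const] filterlim_at_top_imp_at_infinity Llim)
    \<comment> \<open>With x = pi J / l the exponent 2m equals 2 t (pi J)^2 / x^2, which reduces the
      claim to the behaviour of cos x to the power 1 / x^2 at 0.\<close>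
    have "((\<lambda>x::real. cos x powr (1 / x\<^sup>2)) \<longlongrightarrow> exp (-1/2)) (at_right 0)"
      by real_asymp
    from filterlim_compose[OF this x0]
    have "(\<lambda>n. cos (pi * J / L n) powr (1 / (pi * J / L n)\<^sup>2)) \<longlonglongrightarrow> exp (-1/2)" .
    then have "(\<lambda>n. (cos (pi * J / L n) powr (1 / (pi * J / L n)\<^sup>2)) powr (2 * t * (pi * J)\<^sup>2)) \<longlonglongrightarrow> exp (-1/2) powr (2 * t * (pi * J)\<^sup>2)"
      by (intro tendsto_intros) auto
    also have "exp (-1/2) powr (2 * t * (pi * J)\<^sup>2) = exp (- (pi\<^sup>2 * t) * J\<^sup>2)"
      by (simp add: powr_def power_mult_distrib algebra_simps)
    finally have lim: "(\<lambda>n. (cos (pi * J / L n) powr (1 / (pi * J / L n)\<^sup>2)) powr (2 * t * (pi * J)\<^sup>2)) \<longlonglongrightarrow> exp (- (pi\<^sup>2 * t) * J\<^sup>2)" .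
    have "eventually (\<lambda>n. N n > j) sequentially"
      by (rule eventually_compose_filterlim[OF eventually_gt_at_top N])
    then have "eventually (\<lambda>n. (cos (pi * J / L n) powr (1 / (pi * J / L n)\<^sup>2)) powr (2 * t * (pi * J)\<^sup>2) = a j n) sequentially"
    proof eventually_elim
      case (elim n)
      have "2 * J < L n" using elim by (simp add: J_def L_def l_def)
      then have "pi * J / L n < pi / 2" using Lpos[of n] by (simp add: field_simps)
      then have c: "cos (pi * J / L n) > 0" using J Lpos[of n] by (intro cos_gt_zero_pi) (auto intro: less_le_trans[of _ 0])
      have "1 / (X / L n)\<^sup>2 * (2 * t * X\<^sup>2) = real (2 * m n)" if "X \<noteq> 0" for X
        using that by (simp add: m' power_divide)
      from this[of "pi * J"]
      have e: "1 / (pi * J / L n)\<^sup>2 * (2 * t * (pi * J)\<^sup>2) = real (2 * m n)"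
        using J by simp
      have "cos (pi * J / L n) powr real (2 * m n) = cos (pi * J / L n) ^ (2 * m n)"
        by (rule powr_realpow[OF c])
      then show ?case using elim unfolding powr_powr e by (simp only: a_def J_def if_True)
    qed
    from Lim_transform_eventually[OF lim this] show ?thesis by (simp add: J_def)
  qed
  \<comment> \<open>Uniformly in n, the Gaussian is weakened through (j + 1)^2 >= j to a geometric
    majorant.\<close>
  have abound: "norm (a j n) \<le> exp (- (pi\<^sup>2 * t) / 4) ^ j" for j n
  proof (cases "j < N n")
    case True
    define J where "J = real (j + 1)"
    have J: "J > 0" by (simp add: J_def)
    define x where "x = pi * J / L n"
    have "2 * J < L n" using True by (simp add: J_def L_def l_def)
    then have x: "0 \<le> x" "x \<le> pi / 2" using Lpos[of n] J by (auto simp: x_def field_simps)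
    have "cos x ^ (2 * m n) \<le> exp (- x\<^sup>2 / 8) ^ (2 * m n)"
      using x by (intro power_mono cos_le_exp cos_ge_zero) auto
    also have "\<dots> = exp (real (2 * m n) * (- x\<^sup>2 / 8))" by (rule exp_of_nat_mult[symmetric])
    also have "real (2 * m n) * (- x\<^sup>2 / 8) = - (pi\<^sup>2 * t) / 4 * J\<^sup>2"
      using Lpos[of n] by (simp add: m' x_def field_simps power2_eq_square)
    also have "\<dots> \<le> real j * (- (pi\<^sup>2 * t) / 4)"
    proof -
      have "real j \<le> J\<^sup>2" unfolding J_def power2_eq_square
        by (simp add: algebra_simps)
      then have "real j * (pi\<^sup>2 * t / 4) \<le> J\<^sup>2 * (pi\<^sup>2 * t / 4)"
        using t by (intro mult_right_mono) auto
      then show ?thesis by (simp add: mult_ac)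
    qed
    finally have "cos x ^ (2 * m n) \<le> exp (real j * (- (pi\<^sup>2 * t) / 4))" by simp
    then show ?thesis using True x unfolding exp_of_nat_mult a_def x_def J_def
      by (simp add: power_mult)
  qed (simp add: a_def)
  have blim: "b r \<longlonglongrightarrow> exp (- (real (r + 1))\<^sup>2 / t)" for r
  proof -
    define J where "J = real (r + 1)"
    have J: "J > 0" by (simp add: J_def)
    have bR: "real ((r + 1) * l n) = J * L n" for n by (simp only: J_def L_def of_nat_mult)
    have "((\<lambda>x. exp (- (J * x)\<^sup>2 / (t * x\<^sup>2 + 1 - J * x))) \<longlongrightarrow> exp (- J\<^sup>2 / t)) at_top"
      using J t by (real_asymp simp: power_mult_distrib divide_inverse)
    from filterlim_compose[OF this Llim]
    have lo: "(\<lambda>n. exp (- (J * L n)\<^sup>2 / (real (m n) + 1 - J * L n))) \<longlonglongrightarrow> exp (- J\<^sup>2 / t)"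
      by (simp add: m')
    have "((\<lambda>x. exp (- (J * x)\<^sup>2 / (t * x\<^sup>2 + J * x))) \<longlongrightarrow> exp (- J\<^sup>2 / t)) at_top"
      using J t by (real_asymp simp: power_mult_distrib divide_inverse)
    from filterlim_compose[OF this Llim]
    have hi: "(\<lambda>n. exp (- (J * L n)\<^sup>2 / (real (m n) + J * L n))) \<longlonglongrightarrow> exp (- J\<^sup>2 / t)"
      by (simp add: m')
    have ev: "eventually (\<lambda>n. L n > J / t) sequentially"
      using Llim by (simp add: filterlim_at_top_dense)
    have le: "(r + 1) * l n \<le> m n" if "L n > J / t" for n
    proof -
      have "J * L n \<le> t * L n * L n" using that t Lpos[of n] by (intro mult_right_mono) (auto simp: field_simps)
      then have "real ((r + 1) * l n) \<le> real (m n)" unfolding bR m' by (simp add: power2_eq_square mult_ac)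
      then show ?thesis by (simp only: of_nat_le_iff)
    qed
    show ?thesis
    proof (rule tendsto_sandwich[OF _ _ lo[unfolded J_def] hi[unfolded J_def]])
      show "\<forall>\<^sub>F n in sequentially. exp (- (real (r + 1) * L n)\<^sup>2 / (real (m n) + 1 - real (r + 1) * L n)) \<le> b r n"
        using ev
      proof eventually_elim
        case (elim n)
        from central_ratio_ge[OF le[OF elim]] show ?case unfolding bR b_def by (simp add: J_def)
      qed
      show "\<forall>\<^sub>F n in sequentially. b r n \<le> exp (- (real (r + 1) * L n)\<^sup>2 / (real (m n) + real (r + 1) * L n))"
        using ev
      proof eventually_elim
        case (elim n)
        from central_ratio_le[OF le[OF elim]] show ?case unfolding bR b_def by (simp add: J_def)
      qed
    qed
  qed
  \<comment> \<open>For a distance R <= m the denominator m + R is at most 2m, which costs a factor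
    2 in the exponent; for R > m the binomial coefficient is zero.\<close>
  have bbound: "norm (b r n) \<le> exp (- 1 / (2 * t)) ^ r" for r n
  proof (cases "(r + 1) * l n \<le> m n")
    case True
    define J where "J = real (r + 1)"
    have bR: "real ((r + 1) * l n) = J * L n" by (simp only: J_def L_def of_nat_mult)
    have J: "J > 0" by (simp add: J_def)
    have JL: "J * L n \<le> real (m n)" "J * L n > 0" using True bR J Lpos[of n] by (metis of_nat_le_iff, simp)
    have "b r n \<le> exp (- (J * L n)\<^sup>2 / (real (m n) + J * L n))"
      using central_ratio_le[OF True] by (simp only: bR b_def)
    also have "\<dots> \<le> exp (- (J * L n)\<^sup>2 / (2 * real (m n)))"
      using JL unfolding minus_divide_left[symmetric] exp_le_cancel_iff neg_le_iff_le
      by (intro divide_left_mono mult_pos_pos) auto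
    also have "- (J * L n)\<^sup>2 / (2 * real (m n)) = - J\<^sup>2 / (2 * t)"
      using Lpos[of n] t by (simp add: m' field_simps)
    also have "\<dots> \<le> real r * (- 1 / (2 * t))"
    proof -
      have "real r \<le> J\<^sup>2" unfolding J_def power2_eq_square by (simp add: algebra_simps)
      then show ?thesis using t by (simp add: divide_right_mono)
    qed
    finally have "b r n \<le> exp (real r * (- 1 / (2 * t)))" by simp
    then show ?thesis unfolding exp_of_nat_mult using central_ratio_nonneg by (simp add: b_def)
  next
    case False
    then have "2 * m n < m n + (r + 1) * l n" by linarith
    then show ?thesis unfolding b_def central_ratio_def by (simp add: binomial_eq_0)
  qed
  have Clim: "C \<longlonglongrightarrow> 1 / sqrt (pi * t)"
  proof -
    have "filterlim (\<lambda>n. real (m n)) at_top sequentially"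
      unfolding m' using t
      by (intro filterlim_tendsto_pos_mult_at_top[OF tendsto_const] filterlim_pow_at_top Llim) auto
    then have "filterlim m at_top sequentially"
      by (simp add: filterlim_sequentially_iff_filterlim_real)
    note lim = filterlim_compose[OF wallis_binomial this]
    have "(\<lambda>n. sqrt (real (m n)) * real (2 * m n choose m n) / 4 ^ m n / sqrt t) \<longlonglongrightarrow> 1 / sqrt pi / sqrt t"
      by (rule tendsto_divide[OF lim tendsto_const]) (use t in simp)
    moreover have "sqrt (real (m n)) * real (2 * m n choose m n) / 4 ^ m n / sqrt t = C n" for n
      using t Lpos[of n] by (simp add: m' real_sqrt_mult C_def)
    ultimately show ?thesis by (simp add: real_sqrt_mult)
  qed
  have sa: "summable (\<lambda>j. exp (- (pi\<^sup>2 * t) / 4) ^ j)"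
    using t by (intro summable_geometric) simp
  have sb: "summable (\<lambda>j. exp (- 1 / (2 * t)) ^ j)"
    using t by (intro summable_geometric) simp
  have Sa: "(\<lambda>n. \<Sum>j. a j n) \<longlonglongrightarrow> (\<Sum>j. exp (- (pi\<^sup>2 * t) * (real (j + 1))\<^sup>2))"
    using tannerys_theorem[of a "\<lambda>j. exp (- (pi\<^sup>2 * t) * (real (j + 1))\<^sup>2)" sequentially, OF alim _ sa]
      abound by (simp only: case_prod_unfold sequentially_bot eventually_True simp_thms)
  have Sb: "(\<lambda>n. \<Sum>r. b r n) \<longlonglongrightarrow> (\<Sum>r. exp (- (real (r + 1))\<^sup>2 / t))"
    using tannerys_theorem[of b "\<lambda>r. exp (- (real (r + 1))\<^sup>2 / t)" sequentially, OF blim _ sb]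
      bbound by (simp only: case_prod_unfold sequentially_bot eventually_True simp_thms)
  have "(\<lambda>n. 1 + 2 * (\<Sum>j. a j n)) \<longlonglongrightarrow> 1 + 2 * (\<Sum>j. exp (- (pi\<^sup>2 * t) * (real (j + 1))\<^sup>2))"
    by (rule tendsto_add[OF tendsto_const tendsto_mult[OF tendsto_const Sa]])
  moreover have "(\<lambda>n. C n * (1 + 2 * (\<Sum>r. b r n))) \<longlonglongrightarrow>
      1 / sqrt (pi * t) * (1 + 2 * (\<Sum>r. exp (- (real (r + 1))\<^sup>2 / t)))"
    by (rule tendsto_mult[OF Clim tendsto_add[OF tendsto_const tendsto_mult[OF tendsto_const Sb]]])
  ultimately show ?thesis unfolding ident using LIMSEQ_unique by blast
qed

section \<open>Theta as a lacunary power series in the nome, and its inversion\<close>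

definition theta_series :: "complex \<Rightarrow> complex" where
  "theta_series w = 1 + 2 * (\<Sum>j. w ^ (j + 1)\<^sup>2)"

lemma norm_power_square_le:
  assumes "norm w \<le> \<rho>" "\<rho> \<le> 1"
  shows "norm (w ^ (j + 1)\<^sup>2 :: complex) \<le> \<rho> ^ j"
proof -
  have "0 \<le> \<rho>" using assms norm_ge_zero order_trans by blast
  have "norm (w ^ (j + 1)\<^sup>2) \<le> \<rho> ^ (j + 1)\<^sup>2"
    using assms by (simp only: norm_power) (intro power_mono, auto)
  also have "\<dots> \<le> \<rho> ^ j"
    using assms \<open>0 \<le> \<rho>\<close> by (intro power_decreasing) (auto simp: power2_eq_square)
  finally show ?thesis .
qed

lemma summable_theta_series:
  assumes "norm (w::complex) < 1"
  shows "summable (\<lambda>j. norm (w ^ (j + 1)\<^sup>2))"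
proof (rule summable_comparison_test)
  show "summable (\<lambda>j. norm w ^ j)" using assms by (intro summable_geometric) auto
  show "\<exists>N. \<forall>n\<ge>N. norm (norm (w ^ (n + 1)\<^sup>2)) \<le> norm w ^ n"
    using norm_power_square_le[of w "norm w"] assms by auto
qed

lemma holomorphic_theta_series: "theta_series holomorphic_on ball 0 1"
proof -
  have "(\<lambda>w. \<Sum>j. w ^ (j + 1)\<^sup>2 :: complex) holomorphic_on ball 0 1"
  proof (rule holomorphic_on_suminf)
    fix z :: complex assume z: "z \<in> ball 0 1"
    define r where "r = (1 - norm z) / 2"
    define \<rho> where "\<rho> = norm z + r"
    have r: "r > 0" "\<rho> < 1" "0 \<le> \<rho>" using z by (auto simp: r_def \<rho>_def field_simps)
    have n: "norm w \<le> \<rho>" if "w \<in> cball z r" for w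
      using that norm_triangle_ineq2[of w z] by (auto simp: \<rho>_def dist_norm norm_minus_commute)
    have "cball z r \<subseteq> ball 0 1" using n r by force
    moreover have "summable (\<lambda>j. \<rho> ^ j)" using r by (intro summable_geometric) auto
    moreover have "\<forall>j. \<forall>w\<in>cball z r. norm (w ^ (j + 1)\<^sup>2) \<le> \<rho> ^ j"
      using n r by (intro allI ballI norm_power_square_le) auto
    ultimately show "\<exists>r>0. \<exists>M. cball z r \<subseteq> ball 0 1 \<and> summable M \<and> (\<forall>j. \<forall>w\<in>cball z r. norm (w ^ (j + 1)\<^sup>2) \<le> M j)"
      using r by blast
  qed (auto intro!: holomorphic_intros)
  then show ?thesis unfolding theta_series_def by (intro holomorphic_intros)
qed

lemma norm_nome: "norm (nome \<tau>) = exp (- 2 * pi * Im \<tau>)"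
  by (simp add: nome_def)

lemma norm_nome_less_1: "\<tau> \<in> upper_half_plane \<Longrightarrow> norm (nome \<tau>) < 1"
  by (simp add: norm_nome upper_half_plane_def)

lemma theta_eq_series:
  assumes "\<tau> \<in> upper_half_plane"
  shows "theta \<tau> = theta_series (nome \<tau>)"
proof -
  define w where "w = nome \<tau>"
  have w: "norm w < 1" using norm_nome_less_1[OF assms] by (simp add: w_def)
  define S where "S = (\<Sum>j. w ^ (j + 1)\<^sup>2)"
  have nat: "((\<lambda>j. w ^ (j + 1)\<^sup>2) has_sum S) UNIV"
    unfolding S_def by (rule norm_summable_imp_has_sum[OF summable_theta_series[OF w]])
       (rule summable_sums[OF summable_norm_cancel[OF summable_theta_series[OF w]]])
  have pos: "((\<lambda>s. w ^ nat (s\<^sup>2)) has_sum S) (range (\<lambda>j. int (j + 1)))"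
  proof (subst has_sum_reindex)
    show "inj (\<lambda>j. int (j + 1))" by (auto simp: inj_def)
    have "nat ((int (j + 1))\<^sup>2) = (j + 1)\<^sup>2" for j by (metis nat_int of_nat_power)
    then show "((\<lambda>s. w ^ nat (s\<^sup>2)) \<circ> (\<lambda>j. int (j + 1)) has_sum S) UNIV"
      unfolding o_def using nat by presburger
  qed
  have neg: "((\<lambda>s. w ^ nat (s\<^sup>2)) has_sum S) (range (\<lambda>j. - int (j + 1)))"
  proof (subst has_sum_reindex)
    show "inj (\<lambda>j. - int (j + 1))" by (auto simp: inj_def)
    have "nat ((- int (j + 1))\<^sup>2) = (j + 1)\<^sup>2" for j by (metis nat_int of_nat_power power2_minus)
    then show "((\<lambda>s. w ^ nat (s\<^sup>2)) \<circ> (\<lambda>j. - int (j + 1)) has_sum S) UNIV"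
      unfolding o_def using nat by presburger
  qed
  have zero: "((\<lambda>s::int. w ^ nat (s\<^sup>2)) has_sum 1) {0}"
    by (rule has_sum_finiteI) auto
  have "((\<lambda>s. w ^ nat (s\<^sup>2)) has_sum (1 + (S + S))) ({0} \<union> (range (\<lambda>j. int (j + 1)) \<union> range (\<lambda>j. - int (j + 1))))"
    by (intro has_sum_Un_disjoint pos neg zero) auto
  also have "({0} \<union> (range (\<lambda>j. int (j + 1)) \<union> range (\<lambda>j. - int (j + 1)))) = (UNIV :: int set)"
  proof (intro equalityI subsetI)
    fix s :: int
    consider "s = 0" | "s > 0" | "s < 0" by linarith
    then show "s \<in> {0} \<union> (range (\<lambda>j. int (j + 1)) \<union> range (\<lambda>j. - int (j + 1)))"
    proof cases
      case 2
      then have "s = int (nat (s - 1) + 1)" by simp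
      then show ?thesis by blast
    next
      case 3
      then have "s = - int (nat (- s - 1) + 1)" by simp
      then show ?thesis by blast
    qed auto
  qed auto
  finally have "infsum (\<lambda>s::int. w ^ nat (s\<^sup>2)) UNIV = 1 + (S + S)" by (rule infsumI)
  then show ?thesis by (simp add: theta_def theta_series_def w_def S_def)
qed

lemma holomorphic_nome [holomorphic_intros]: "nome holomorphic_on A"
  unfolding nome_def by (intro holomorphic_intros)

lemma holomorphic_theta: "theta holomorphic_on upper_half_plane"
proof -
  have "(\<lambda>\<tau>. theta_series (nome \<tau>)) holomorphic_on upper_half_plane"
    using norm_nome_less_1
    by (intro holomorphic_on_compose_gen[OF holomorphic_nome holomorphic_theta_series, unfolded o_def]) auto
  then show ?thesis by (rule holomorphic_transform) (simp add: theta_eq_series)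
qed

text \<open>All terms are positive on the imaginary axis, so theta is at least 1 there. Nonvanishing
  serves later to know that the zeros of theta are isolated.\<close>

lemma theta_imaginary_axis:
  assumes "y > 0"
  shows "theta (\<i> * of_real y) = of_real (1 + 2 * (\<Sum>j. exp (- (2 * pi * y) * (real (j + 1))\<^sup>2)))"
    and "theta (\<i> * of_real y) \<noteq> 0"
proof -
  have n: "nome (\<i> * of_real y) = of_real (exp (- (2 * pi * y)))"
    unfolding nome_def by (simp add: exp_of_real[symmetric] mult_ac)
  have H: "\<i> * of_real y \<in> upper_half_plane" using assms by (simp add: upper_half_plane_def)
  have "exp (- (2 * pi * y)) ^ (j + 1)\<^sup>2 = exp (- (2 * pi * y) * (real (j + 1))\<^sup>2)" for j
    by (subst exp_of_nat_mult[symmetric]) (simp add: mult_ac)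
  then have p: "nome (\<i> * of_real y) ^ (j + 1)\<^sup>2 = of_real (exp (- (2 * pi * y) * (real (j + 1))\<^sup>2))" for j
    unfolding n by (metis of_real_power)
  have "summable (\<lambda>j. of_real (exp (- (2 * pi * y) * (real (j + 1))\<^sup>2)) :: complex)"
    using summable_norm_cancel[OF summable_theta_series[OF norm_nome_less_1[OF H]]] unfolding p .
  then have sm: "summable (\<lambda>j. exp (- (2 * pi * y) * (real (j + 1))\<^sup>2))"
    by (simp only: summable_of_real_iff)
  from suminf_of_real[OF this, where ?'a = complex]
  show *: "theta (\<i> * of_real y) = of_real (1 + 2 * (\<Sum>j. exp (- (2 * pi * y) * (real (j + 1))\<^sup>2)))"
    unfolding theta_eq_series[OF H] theta_series_def p by simp
  have "(\<Sum>j. exp (- (2 * pi * y) * (real (j + 1))\<^sup>2)) \<ge> 0"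
    by (rule suminf_nonneg[OF sm]) simp
  then show "theta (\<i> * of_real y) \<noteq> 0" unfolding * of_real_eq_0_iff by linarith
qed

lemma open_upper_half_plane: "open upper_half_plane"
  unfolding upper_half_plane_def by (rule open_halfspace_Im_gt)

lemma connected_upper_half_plane: "connected upper_half_plane"
  unfolding upper_half_plane_def by (intro convex_connected convex_halfspace_Im_gt)

lemma inversion_upper_half_plane:
  assumes "\<tau> \<in> upper_half_plane"
  shows "- 1 / (4 * \<tau>) \<in> upper_half_plane" "Im (- 1 / (4 * \<tau>)) = Im \<tau> / (4 * (norm \<tau>)\<^sup>2)"
proof -
  have "\<tau> \<noteq> 0" using assms by (auto simp: upper_half_plane_def)
  show *: "Im (- 1 / (4 * \<tau>)) = Im \<tau> / (4 * (norm \<tau>)\<^sup>2)"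
  proof -
    have "- 1 / (4 * \<tau>) = - inverse \<tau> / 4" by (simp add: inverse_eq_divide)
    moreover have "Im (inverse \<tau>) = - Im \<tau> / (norm \<tau>)\<^sup>2" by (simp only: inverse_complex.sel cmod_power2)
    moreover have "Im (- inverse \<tau> / 4) = - Im (inverse \<tau>) / 4" by (simp only: Im_divide_numeral uminus_complex.sel)
    ultimately have "Im (- 1 / (4 * \<tau>)) = - (- Im \<tau> / (norm \<tau>)\<^sup>2) / 4" by (simp only:)
    also have "\<dots> = Im \<tau> / (4 * (norm \<tau>)\<^sup>2)" by simp
    finally show ?thesis .
  qed
  show "- 1 / (4 * \<tau>) \<in> upper_half_plane"
    using assms \<open>\<tau> \<noteq> 0\<close> unfolding upper_half_plane_def mem_Collect_eq * by simp
qed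

text \<open>The fourth power of theta(-1/(4\<tau>)) = sqrt(-2i\<tau>) theta(\<tau>), which is free
  of a branch of the root. \<open>F\<close> is the difference of the two sides; it vanishes on a
  sequence with a limit point in the upper half-plane.\<close>

theorem theta_inversion:
  assumes "\<tau> \<in> upper_half_plane"
  shows "theta (- 1 / (4 * \<tau>)) ^ 4 = - 4 * \<tau>\<^sup>2 * theta \<tau> ^ 4"
proof -
  define F where "F = (\<lambda>\<tau>. theta (- 1 / (4 * \<tau>)) ^ 4 + 4 * \<tau>\<^sup>2 * theta \<tau> ^ 4)"
  have nz: "\<tau> \<noteq> 0" if "\<tau> \<in> upper_half_plane" for \<tau>
    using that by (auto simp: upper_half_plane_def)
  have "(\<lambda>\<tau>. theta (- 1 / (4 * \<tau>))) holomorphic_on upper_half_plane"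
    using inversion_upper_half_plane(1) nz
    by (intro holomorphic_on_compose_gen[OF _ holomorphic_theta, unfolded o_def, where f = "\<lambda>\<tau>. - 1 / (4 * \<tau>)"])
       (auto intro!: holomorphic_intros)
  then have holF: "F holomorphic_on upper_half_plane"
    unfolding F_def by (intro holomorphic_intros holomorphic_theta)
  \<comment> \<open>For an index i this is (2i + 2) / (2i + 1), with odd denominator: for the odd
    number l = (2i + 1)(2n + 1), the product t l^2 = (2i + 2)(2i + 1)(2n + 1)^2 is an integer, as
    \<open>gaussian_sum_inversion\<close> demands. The height y = pi t / 2 is chosen so that 2 pi y
    = pi^2 t.\<close>
  define t where "t = (\<lambda>i::nat. 1 + 1 / (2 * real i + 1))"
  define \<xi> where "\<xi> = (\<lambda>i. \<i> * of_real (pi * t i / 2) :: complex)"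
  have tpos: "t i > 0" for i by (simp add: t_def add_pos_pos)
  have "F (\<xi> i) = 0" for i
  proof -
    define N where "N = (\<lambda>n. 2 * i * n + i + n)"
    define m where "m = (\<lambda>n. (2 * i + 2) * (2 * i + 1) * (2 * n + 1)\<^sup>2)"
    have odd: "2 * N n + 1 = (2 * i + 1) * (2 * n + 1)" for n by (simp add: N_def algebra_simps)
    have tt: "t i = (2 * real i + 2) / (2 * real i + 1)" by (simp add: t_def field_simps)
    define p q where "p = 2 * real i + 2" and "q = 2 * real i + 1"
    have "q > 0" by (simp add: q_def)
    have "real (m n) = t i * (real (2 * N n + 1))\<^sup>2" for n
    proof -
      have "real (m n) = p * q * (real (2 * n + 1))\<^sup>2"
        unfolding m_def p_def q_def
        by (simp only: of_nat_mult of_nat_add of_nat_power of_nat_numeral of_nat_1)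
      moreover have "real (2 * N n + 1) = q * real (2 * n + 1)"
        unfolding odd of_nat_mult by (simp add: q_def)
      ultimately show ?thesis using \<open>q > 0\<close>
        unfolding tt p_def[symmetric] q_def[symmetric] by (simp add: power_mult_distrib power2_eq_square)
    qed
    moreover have "filterlim N at_top sequentially"
      by (rule filterlim_at_top_mono[OF filterlim_ident]) (auto simp: N_def)
    ultimately have "1 + 2 * (\<Sum>j. exp (- (pi\<^sup>2 * t i) * (real (j + 1))\<^sup>2)) =
       1 / sqrt (pi * t i) * (1 + 2 * (\<Sum>r. exp (- (real (r + 1))\<^sup>2 / t i)))" (is "?A = _ * ?B")
      by (intro gaussian_sum_inversion[OF tpos])
    then have AB: "?B = sqrt (pi * t i) * ?A" using tpos[of i] by simp
    have "theta (\<xi> i) = of_real ?A"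
      unfolding \<xi>_def using tpos[of i]
      by (subst theta_imaginary_axis(1)) (auto simp: power2_eq_square mult_ac)
    moreover have "- 1 / (4 * \<xi> i) = \<i> * of_real (1 / (2 * pi * t i))"
      unfolding \<xi>_def using tpos[of i] by (simp add: field_simps)
    then have "theta (- 1 / (4 * \<xi> i)) = of_real ?B"
      using tpos[of i] by (simp only:) (subst theta_imaginary_axis(1), auto simp: field_simps)
    ultimately have "F (\<xi> i) = of_real (?B ^ 4 - (pi * t i)\<^sup>2 * ?A ^ 4)"
      unfolding F_def by (simp add: \<xi>_def power_mult_distrib power_divide)
    also have "?B ^ 4 = (pi * t i)\<^sup>2 * ?A ^ 4"
    proof -
      have "sqrt (pi * t i) ^ 4 = (sqrt (pi * t i) ^ 2) ^ 2" by (simp add: power_mult[symmetric])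
      also have "\<dots> = (pi * t i)\<^sup>2" using tpos[of i] by simp
      finally show ?thesis unfolding AB power_mult_distrib by simp
    qed
    finally show ?thesis by simp
  qed
  moreover have "(\<i> * of_real (pi / 2)) islimpt range \<xi>"
    unfolding islimpt_sequential
  proof (intro exI conjI allI)
    show "\<xi> i \<in> range \<xi> - {\<i> * of_real (pi / 2)}" for i
      by (auto simp: \<xi>_def t_def complex_eq_iff add_nonneg_eq_0_iff)
    have "t \<longlonglongrightarrow> 1" unfolding t_def by real_asymp
    then have "\<xi> \<longlonglongrightarrow> \<i> * of_real (pi * 1 / 2)"
      unfolding \<xi>_def by (intro tendsto_intros) auto
    then show "\<xi> \<longlonglongrightarrow> \<i> * of_real (pi / 2)" by simp
  qed
  moreover have "range \<xi> \<subseteq> upper_half_plane"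
    using tpos by (auto simp: \<xi>_def upper_half_plane_def)
  moreover have "\<i> * of_real (pi / 2) \<in> upper_half_plane" by (simp add: upper_half_plane_def)
  ultimately have "F \<tau> = 0"
    using analytic_continuation[OF holF open_upper_half_plane connected_upper_half_plane _ _ _ _ assms] by blast
  then show ?thesis by (simp add: F_def add_eq_0_iff)
qed

section \<open>Invariant heights and the growth of coefficients\<close>

lemma moebius_act_upper_half_plane:
  assumes det: "a * d - b * c = (1::int)" and \<tau>: "\<tau> \<in> upper_half_plane"
  shows "of_int c * \<tau> + of_int d \<noteq> 0"
    and "Im (moebius_act a b c d \<tau>) = Im \<tau> / (norm (of_int c * \<tau> + of_int d))\<^sup>2"
    and "moebius_act a b c d \<tau> \<in> upper_half_plane"
proof -
  define w where "w = of_int c * \<tau> + of_int d"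
  show w0: "of_int c * \<tau> + of_int d \<noteq> 0"
  proof
    assume *: "of_int c * \<tau> + of_int d = 0"
    have "of_int c * Im \<tau> = 0" using arg_cong[OF *, of Im] by simp
    then have "c = 0" using \<tau> by (auto simp: upper_half_plane_def)
    with * have "d = 0" by simp
    with \<open>c = 0\<close> det show False by simp
  qed
  have "Im (moebius_act a b c d \<tau>) = (of_int a * Im \<tau> * (of_int c * Re \<tau> + of_int d) - (of_int a * Re \<tau> + of_int b) * (of_int c * Im \<tau>)) / (norm w)\<^sup>2"
    by (simp add: moebius_act_def Im_divide cmod_power2 w_def)
  also have "of_int a * Im \<tau> * (of_int c * Re \<tau> + of_int d) - (of_int a * Re \<tau> + of_int b) * (of_int c * Im \<tau>) = of_int (a * d - b * c) * Im \<tau>"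
    by (simp add: algebra_simps)
  finally show im: "Im (moebius_act a b c d \<tau>) = Im \<tau> / (norm (of_int c * \<tau> + of_int d))\<^sup>2"
    by (simp only: det w_def of_int_1 mult_1)
  show "moebius_act a b c d \<tau> \<in> upper_half_plane"
    using w0 \<tau> im by (simp add: upper_half_plane_def)
qed

lemma moebius_act_compose:
  assumes "of_int c' * \<tau> + of_int d' \<noteq> (0::complex)"
  shows "moebius_act a b c d (moebius_act a' b' c' d' \<tau>) =
    moebius_act (a * a' + b * c') (a * b' + b * d') (c * a' + d * c') (c * b' + d * d') \<tau>"
proof -
  define p q where "p = of_int a' * \<tau> + of_int b'" and "q = of_int c' * \<tau> + of_int d'"
  have q: "q \<noteq> 0" using assms by (simp add: q_def)
  have "moebius_act a b c d (moebius_act a' b' c' d' \<tau>) =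
     ((of_int a * p + of_int b * q) / q) / ((of_int c * p + of_int d * q) / q)"
    unfolding moebius_act_def p_def[symmetric] q_def[symmetric] using q by (simp add: add_divide_distrib)
  also have "\<dots> = (of_int a * p + of_int b * q) / (of_int c * p + of_int d * q)"
    using q by simp
  also have "of_int a * p + of_int b * q = of_int (a * a' + b * c') * \<tau> + of_int (a * b' + b * d')"
    by (simp add: p_def q_def algebra_simps)
  also have "of_int c * p + of_int d * q = of_int (c * a' + d * c') * \<tau> + of_int (c * b' + d * d')"
    by (simp add: p_def q_def algebra_simps)
  finally show ?thesis by (simp add: moebius_act_def)
qed

text \<open>Theta has weight 1/2, so |theta|^4 acquires the factor |c\<tau> + d|^2, which the
  imaginary part compensates.\<close>

definition theta_height :: "complex \<Rightarrow> real" where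
  "theta_height \<tau> = norm (theta \<tau>) ^ 4 * Im \<tau>"

lemma nome_add_int: "nome (\<tau> + of_int n) = nome \<tau>"
proof -
  have "nome (\<tau> + of_int n) = nome \<tau> * exp (of_int n * (2 * of_real pi * \<i>))"
    by (simp add: nome_def exp_add[symmetric] algebra_simps)
  also have "exp (of_int n * (2 * of_real pi * \<i>)) = (1 :: complex)"
    using exp_integer_2pi[of "of_int n"] by (simp add: mult_ac)
  finally show ?thesis by simp
qed

lemma theta_height_add_int: "theta_height (\<tau> + of_int n) = theta_height \<tau>"
  by (simp add: theta_height_def theta_def nome_add_int)

lemma theta_height_inversion:
  assumes "\<tau> \<in> upper_half_plane"
  shows "theta_height (- 1 / (4 * \<tau>)) = theta_height \<tau>"
proof -
  have "\<tau> \<noteq> 0" using assms by (auto simp: upper_half_plane_def)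
  then have n: "norm \<tau> \<noteq> 0" by simp
  have "norm (theta (- 1 / (4 * \<tau>))) ^ 4 = norm (theta (- 1 / (4 * \<tau>)) ^ 4)"
    by (simp only: norm_power)
  also have "\<dots> = 4 * (norm \<tau>)\<^sup>2 * norm (theta \<tau>) ^ 4"
    unfolding theta_inversion[OF assms] by (simp add: norm_mult norm_power)
  finally have "theta_height (- 1 / (4 * \<tau>)) = 4 * (norm \<tau>)\<^sup>2 * norm (theta \<tau>) ^ 4 * (Im \<tau> / (4 * (norm \<tau>)\<^sup>2))"
    by (simp only: theta_height_def inversion_upper_half_plane(2)[OF assms])
  then show ?thesis using n by (simp add: theta_height_def)
qed

text \<open>The map is the translation by -n conjugated by the inversion that sends \<tau> to
  -1/(4\<tau>), and the height is invariant under both.\<close>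

lemma theta_height_lower_unipotent:
  assumes "\<tau> \<in> upper_half_plane"
  shows "theta_height (moebius_act 1 0 (4 * n) 1 \<tau>) = theta_height \<tau>"
proof -
  have \<tau>0: "\<tau> \<noteq> 0" using assms by (auto simp: upper_half_plane_def)
  define \<sigma> where "\<sigma> = - 1 / (4 * \<tau>) + of_int (- n)"
  have \<sigma>: "\<sigma> \<in> upper_half_plane"
    using inversion_upper_half_plane(1)[OF assms] by (simp add: \<sigma>_def upper_half_plane_def)
  have nz: "of_int (4 * n) * \<tau> + of_int 1 \<noteq> 0"
    using moebius_act_upper_half_plane(1)[of 1 1 0 "4 * n" \<tau>] assms by simp
  have "4 * \<sigma> = - (of_int (4 * n) * \<tau> + of_int 1) / \<tau>"
    using \<tau>0 by (simp add: \<sigma>_def field_simps)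
  moreover have "- 1 / (- X / \<tau>) = \<tau> / X" for X by simp
  ultimately have "- 1 / (4 * \<sigma>) = moebius_act 1 0 (4 * n) 1 \<tau>"
    by (simp only: moebius_act_def of_int_0 of_int_1 mult_1 add_0_right)
  then show ?thesis
    using theta_height_inversion[OF \<sigma>] theta_height_inversion[OF assms]
    unfolding \<sigma>_def theta_height_add_int by simp
qed

lemma int_nearest_multiple:
  fixes c d :: int
  assumes "c \<noteq> 0"
  obtains n where "2 * \<bar>d + n * c\<bar> \<le> \<bar>c\<bar>"
proof -
  define r where "r = d mod \<bar>c\<bar>"
  have r: "0 \<le> r" "r < \<bar>c\<bar>" using assms by (auto simp: r_def)
  have d: "d = r + (d div \<bar>c\<bar>) * \<bar>c\<bar>" unfolding r_def by simp
  show thesis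
  proof (cases "2 * r \<le> \<bar>c\<bar>")
    case True
    have e: "d + (- (d div \<bar>c\<bar>) * sgn c) * c = r" using d by (simp add: abs_sgn mult.assoc mult.commute)
    show thesis by (rule that[of "- (d div \<bar>c\<bar>) * sgn c"]) (unfold e, use True r in simp)
  next
    case False
    have e: "d + (- (d div \<bar>c\<bar> + 1) * sgn c) * c = r - \<bar>c\<bar>" using d by (simp add: abs_sgn algebra_simps)
    show thesis by (rule that[of "- (d div \<bar>c\<bar> + 1) * sgn c"]) (unfold e, use False r in simp)
  qed
qed

text \<open>The descent is the Euclidean algorithm with least absolute remainders: the oddness of \<open>d\<close>
  makes the remainder of \<open>d\<close> modulo \<open>c\<close> strictly smaller than \<open>\<bar>c\<bar> / 2\<close>.\<close>
theorem theta_height_Gamma0_4: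
  assumes "a * d - b * c = (1::int)" "4 dvd c" "\<tau> \<in> upper_half_plane"
  shows "theta_height (moebius_act a b c d \<tau>) = theta_height \<tau>"
  using assms
proof (induction "nat \<bar>c\<bar>" arbitrary: a b c d \<tau> rule: less_induct)
  case less
  show ?case
  proof (cases "c = 0")
    case True
    then have "a * d = 1" using less.prems by simp
    then consider "a = 1" "d = 1" | "a = - 1" "d = - 1" by (auto simp: zmult_eq_1_iff)
    then show ?thesis
    proof cases
      case 1
      then have "moebius_act a b c d \<tau> = \<tau> + of_int b" using True by (simp add: moebius_act_def)
      then show ?thesis by (simp only: theta_height_add_int)
    next
      case 2
      then have "moebius_act a b c d \<tau> = \<tau> + of_int (- b)" using True by (simp add: moebius_act_def)
      then show ?thesis by (simp only: theta_height_add_int)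
    qed
  next
    case False
    obtain n where n: "2 * \<bar>d + n * c\<bar> \<le> \<bar>c\<bar>" using int_nearest_multiple[OF False] .
    define d' b' where "d' = d + n * c" and "b' = b + n * a"
    have det': "a * d' - b' * c = 1" using less.prems(1) by (simp add: d'_def b'_def algebra_simps)
    have "odd d'"
    proof
      assume "even d'"
      moreover have "even c" using less.prems(2) by (metis dvd_trans even_numeral)
      ultimately have "even (a * d' - b' * c)" by simp
      then show False using det' by simp
    qed
    then have "d' \<noteq> 0" by auto
    have "2 * \<bar>d'\<bar> \<noteq> \<bar>c\<bar>"
    proof
      assume "2 * \<bar>d'\<bar> = \<bar>c\<bar>"
      moreover have "4 dvd \<bar>c\<bar>" using less.prems(2) by simp
      ultimately have "4 dvd 2 * \<bar>d'\<bar>" by simp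
      then have "even d'" by presburger
      then show False using \<open>odd d'\<close> by simp
    qed
    then have small: "2 * \<bar>d'\<bar> < \<bar>c\<bar>" using n by (simp add: d'_def)
    \<comment> \<open>The second reduction is modulo 4 d', because the lower unipotent matrices at
      hand have entry divisible by 4. Least remainders still give |c''| <= 2 |d'| < |c|.\<close>
    have "4 * d' \<noteq> 0" using \<open>d' \<noteq> 0\<close> by simp
    then obtain k where k: "2 * \<bar>c + k * (4 * d')\<bar> \<le> \<bar>4 * d'\<bar>"
      using int_nearest_multiple by blast
    define c'' a'' where "c'' = c + k * (4 * d')" and "a'' = a + k * (4 * b')"
    have det'': "a'' * d' - b' * c'' = 1" using det' by (simp add: c''_def a''_def algebra_simps)
    have "\<bar>c''\<bar> < \<bar>c\<bar>" using k small by (simp add: c''_def abs_mult)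
    then have less'': "nat \<bar>c''\<bar> < nat \<bar>c\<bar>" by simp
    have dvd'': "4 dvd c''" using less.prems(2) by (simp add: c''_def)
    define \<tau>1 where "\<tau>1 = \<tau> + of_int (- n)"
    have \<tau>1: "\<tau>1 \<in> upper_half_plane" using less.prems(3) by (simp add: \<tau>1_def upper_half_plane_def)
    define \<tau>2 where "\<tau>2 = moebius_act 1 0 (4 * (- k)) 1 \<tau>1"
    have nz: "of_int (4 * (- k)) * \<tau>1 + of_int 1 \<noteq> 0"
      using moebius_act_upper_half_plane(1)[of 1 1 0 "4 * (- k)" \<tau>1] \<tau>1 by simp
    have \<tau>2: "\<tau>2 \<in> upper_half_plane"
      unfolding \<tau>2_def by (rule moebius_act_upper_half_plane(3)) (use \<tau>1 in auto)
    have "moebius_act a b c d \<tau> = moebius_act a b' c d' \<tau>1"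
      by (simp add: moebius_act_def \<tau>1_def b'_def d'_def algebra_simps)
    also have "\<dots> = moebius_act a'' b' c'' d' \<tau>2"
      unfolding \<tau>2_def moebius_act_compose[OF nz]
      by (simp add: a''_def c''_def algebra_simps)
    finally have "theta_height (moebius_act a b c d \<tau>) = theta_height (moebius_act a'' b' c'' d' \<tau>2)" by simp
    also have "\<dots> = theta_height \<tau>2" by (rule less.hyps[OF less'' det'' dvd'' \<tau>2])
    also have "\<dots> = theta_height \<tau>1" unfolding \<tau>2_def by (rule theta_height_lower_unipotent[OF \<tau>1])
    also have "\<dots> = theta_height \<tau>" unfolding \<tau>1_def by (rule theta_height_add_int)
    finally show ?thesis .
  qed
qed

section \<open>Values of Dirichlet characters\<close>

lemma dirichlet_char_mod:
  assumes "dirichlet_char N \<phi>"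
  shows "\<phi> (n mod int N) = \<phi> n"
proof -
  have per: "\<phi> (n + int N * int j) = \<phi> n" for n j
    using assms by (intro periodic_int_add_mult) (auto simp: dirichlet_char_def)
  show ?thesis
  proof (cases "n div int N \<ge> 0")
    case True
    then have "n = n mod int N + int N * int (nat (n div int N))" by simp
    then show ?thesis using per by metis
  next
    case False
    then have "n mod int N = n + int N * int (nat (- (n div int N)))"
      by (simp add: minus_div_mult_eq_mod[symmetric] algebra_simps)
    then show ?thesis using per by metis
  qed
qed

lemma dirichlet_char_cong:
  assumes "dirichlet_char N \<phi>" "[m = n] (mod int N)"
  shows "\<phi> m = \<phi> n"
  using assms dirichlet_char_mod by (metis cong_def)

lemma dirichlet_char_1: "dirichlet_char N \<phi> \<Longrightarrow> \<phi> 1 = 1"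
  unfolding dirichlet_char_def by (metis coprime_1_left mult_1 mult_cancel_right1)

text \<open>By Euler's theorem a value at an integer prime to N is a root of unity of order dividing
  \<open>totient N\<close>.\<close>

lemma norm_dirichlet_char:
  assumes \<phi>: "dirichlet_char N \<phi>"
  shows "coprime n (int N) \<Longrightarrow> norm (\<phi> n) = 1" and "norm (\<phi> n) \<le> 1"
proof -
  show *: "norm (\<phi> n) = 1" if cop: "coprime n (int N)" for n
  proof -
    have N: "N > 0" using \<phi> by (simp add: dirichlet_char_def)
    define m where "m = nat (n mod int N)"
    have m: "int m = n mod int N" using N by (simp add: m_def)
    have "coprime (int m) (int N)" using cop N by (simp add: m coprime_mod_left_iff)
    then have "coprime m N" by simp
    then have "[m ^ totient N = 1] (mod N)" by (rule euler_theorem)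
    then have "[int m ^ totient N = 1] (mod int N)" by (metis cong_int_iff of_nat_1 of_nat_power)
    then have "\<phi> (int m ^ totient N) = 1"
      using dirichlet_char_cong[OF \<phi>] dirichlet_char_1[OF \<phi>] by metis
    moreover have "\<phi> (x ^ j) = \<phi> x ^ j" for x j
      using \<phi> dirichlet_char_1[OF \<phi>] by (induction j) (auto simp: dirichlet_char_def)
    ultimately have "\<phi> (int m) ^ totient N = 1" by simp
    then have "norm (\<phi> (int m)) = 1 \<or> totient N = 0" by (rule power_eq_1_iff)
    then have "norm (\<phi> (int m)) = 1" using N by simp
    then show ?thesis unfolding m dirichlet_char_mod[OF \<phi>] .
  qed
  show "norm (\<phi> n) \<le> 1"
  proof (cases "coprime n (int N)")
    case False
    then have "\<phi> n = 0" using \<phi> by (auto simp: dirichlet_char_def)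
    then show ?thesis by simp
  qed (simp add: *)
qed

section \<open>Growth of forms of half-integral weight near the real axis\<close>

definition form_height :: "nat \<Rightarrow> (complex \<Rightarrow> complex) \<Rightarrow> complex \<Rightarrow> real" where
  "form_height k h \<tau> = norm (h \<tau>) ^ 4 * Im \<tau> ^ (2 * k + 1)"

text \<open>The modulus of the rule for h / theta^(2k+1) is raised to the fourth power and
  multiplied by the (2k+1)-st power of the invariant theta height. The theta factors cancel, and
  \<psi>(d) has modulus 1 because d is prime to N.\<close>

theorem form_height_Gamma0:
  assumes h: "h \<in> half_integral_forms k N \<psi>" and \<psi>: "dirichlet_char N \<psi>" and N: "4 dvd N"
    and det: "a * d - b * c = 1" and c: "int N dvd c" and \<tau>: "\<tau> \<in> upper_half_plane"
  shows "form_height k h (moebius_act a b c d \<tau>) = form_height k h \<tau>"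
proof -
  define \<gamma> where "\<gamma> = moebius_act a b c d"
  have c4: "4 dvd c" using N c by (metis dvd_trans int_dvd_int_iff of_nat_numeral)
  have \<gamma>H: "\<gamma> z \<in> upper_half_plane" if "z \<in> upper_half_plane" for z
    unfolding \<gamma>_def using moebius_act_upper_half_plane(3)[OF det that] .
  have "coprime d (int N)"
  proof (rule coprimeI)
    fix e assume "e dvd d" "e dvd int N"
    then have "e dvd a * d - b * c" using c by (metis dvd_diff dvd_mult dvd_trans)
    then show "is_unit e" using det by simp
  qed
  then have \<psi>1: "norm (\<psi> d) = 1" by (rule norm_dirichlet_char(1)[OF \<psi>])
  have nonzero: "form_height k h (\<gamma> z) = form_height k h z"
    if z: "z \<in> upper_half_plane" and nz: "theta z \<noteq> 0" for z
  proof -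
    have TH: "norm (theta (\<gamma> z)) ^ 4 * Im (\<gamma> z) = norm (theta z) ^ 4 * Im z"
      using theta_height_Gamma0_4[OF det c4 z] by (simp only: theta_height_def \<gamma>_def)
    have "norm (theta z) ^ 4 * Im z \<noteq> 0" using nz z by (simp add: upper_half_plane_def)
    then have nz': "theta (\<gamma> z) \<noteq> 0" using TH by (metis mult_zero_left norm_zero power_zero_numeral)
    have "h (\<gamma> z) / theta (\<gamma> z) ^ (2 * k + 1) = \<psi> d * (h z / theta z ^ (2 * k + 1))"
      using h det c z unfolding half_integral_forms_def \<gamma>_def by blast
    then have "norm (h (\<gamma> z)) / norm (theta (\<gamma> z)) ^ (2 * k + 1) = norm (h z) / norm (theta z) ^ (2 * k + 1)"
      using \<psi>1 by (metis norm_divide norm_mult norm_power mult_1)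
    then have eq: "norm (h (\<gamma> z)) * norm (theta z) ^ (2 * k + 1) = norm (h z) * norm (theta (\<gamma> z)) ^ (2 * k + 1)"
      using nz nz' by (simp add: divide_eq_eq eq_divide_eq)
    define A B where "A = norm (theta z)" and "B = norm (theta (\<gamma> z))"
    have AB: "A > 0" "B > 0" using nz nz' by (auto simp: A_def B_def)
    have "form_height k h (\<gamma> z) * (A ^ 4) ^ (2 * k + 1) = (norm (h (\<gamma> z)) * A ^ (2 * k + 1)) ^ 4 * Im (\<gamma> z) ^ (2 * k + 1)"
      by (simp only: form_height_def power_mult_distrib power_mult[symmetric] mult_ac)
    also have "\<dots> = norm (h z) ^ 4 * (B ^ 4 * Im (\<gamma> z)) ^ (2 * k + 1)"
      unfolding A_def eq B_def by (simp only: power_mult_distrib power_mult[symmetric] mult_ac)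
    also have "\<dots> = form_height k h z * (A ^ 4) ^ (2 * k + 1)"
      unfolding B_def TH A_def by (simp only: form_height_def power_mult_distrib power_mult[symmetric] mult_ac)
    finally show ?thesis using AB by simp
  qed
  show ?thesis
  proof (cases "theta \<tau> = 0")
    case False
    then show ?thesis using nonzero[OF \<tau>] by (simp add: \<gamma>_def)
  next
    case True
    \<comment> \<open>Theta is nonzero at the imaginary unit, so its zeros are isolated; both
      heights are continuous and agree on a punctured disc around \<tau>.\<close>
    have "\<i> * of_real 1 \<in> upper_half_plane" by (simp add: upper_half_plane_def)
    moreover have "theta (\<i> * of_real 1) \<noteq> 0" by (rule theta_imaginary_axis(2)) simp
    ultimately obtain r where r: "r > 0" "ball \<tau> r \<subseteq> upper_half_plane"
       "\<And>z. z \<in> ball \<tau> r - {\<tau>} \<Longrightarrow> theta z \<noteq> 0"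
      using isolated_zeros[OF holomorphic_theta open_upper_half_plane connected_upper_half_plane \<tau> True] by metis
    have hol: "h holomorphic_on upper_half_plane" using h by (simp add: half_integral_forms_def)
    have conth: "isCont h z" if "z \<in> upper_half_plane" for z
      using hol that by (meson continuous_on_eq_continuous_at holomorphic_on_imp_continuous_on open_upper_half_plane)
    have cont\<gamma>: "isCont \<gamma> \<tau>"
      unfolding \<gamma>_def moebius_act_def using moebius_act_upper_half_plane(1)[OF det \<tau>]
      by (intro continuous_intros) auto
    have contFH: "isCont (form_height k h) z" if "z \<in> upper_half_plane" for z
      unfolding form_height_def by (intro continuous_intros conth that continuous_Im[OF continuous_ident])
    have "isCont (\<lambda>z. form_height k h (\<gamma> z) - form_height k h z) \<tau>"
      by (intro continuous_diff isCont_o2[OF cont\<gamma> contFH[OF \<gamma>H[OF \<tau>]]] contFH[OF \<tau>])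
    then have "((\<lambda>z. form_height k h (\<gamma> z) - form_height k h z) \<longlongrightarrow> form_height k h (\<gamma> \<tau>) - form_height k h \<tau>) (at \<tau>)"
      by (simp only: isCont_def)
    moreover have "eventually (\<lambda>z. form_height k h (\<gamma> z) - form_height k h z = 0) (at \<tau>)"
      unfolding eventually_at
    proof (intro exI[of _ r] conjI ballI impI r(1))
      fix z assume "z \<noteq> \<tau> \<and> dist z \<tau> < r"
      then have "z \<in> ball \<tau> r - {\<tau>}" by (auto simp: dist_commute)
      then show "form_height k h (\<gamma> z) - form_height k h z = 0" using nonzero r by force
    qed
    then have "((\<lambda>z. form_height k h (\<gamma> z) - form_height k h z) \<longlongrightarrow> 0) (at \<tau>)"
      by (rule tendsto_eventually)
    ultimately have "form_height k h (\<gamma> \<tau>) - form_height k h \<tau> = 0"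
      by (intro tendsto_unique[of "at \<tau>"]) auto
    then show ?thesis by (simp add: \<gamma>_def)
  qed
qed

text \<open>The exponent of the automorphy factor is real, so its modulus is a power of |c\<tau> +
  d|, and the fourth power is exactly the factor relating the imaginary parts of \<tau> and its
  image. The cusp expansion is bounded by the sum of the moduli of its terms at height 1/5, the
  height that \<open>moebius_act_away_from_real_axis\<close> provides.\<close>

lemma form_height_cusp_bound:
  assumes h: "h \<in> half_integral_forms k N \<psi>" and det: "a * d - b * c = (1::int)"
  shows "\<exists>C\<ge>0. \<forall>\<tau>. Im \<tau> \<ge> 1 / 5 \<longrightarrow> form_height k h (moebius_act a b c d \<tau>) \<le> C * Im \<tau> ^ (2 * k + 1)"
proof -
  have "holomorphic_at_cusps k h" using h by (simp add: half_integral_forms_def)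
  from this[unfolded holomorphic_at_cusps_def, rule_format, OF det]
  obtain M e where M: "M > 0" and e': "\<forall>\<tau>\<in>upper_half_plane.
      (\<lambda>n. e n * nome (\<tau> / of_nat M) ^ n) sums
        ((of_int c * \<tau> + of_int d) powr (- (of_nat k + 1 / 2)) * h (moebius_act a b c d \<tau>))"
    by (elim exE conjE)
  have e: "\<And>\<tau>. \<tau> \<in> upper_half_plane \<Longrightarrow>
      (\<lambda>n. e n * nome (\<tau> / of_nat M) ^ n) sums
        ((of_int c * \<tau> + of_int d) powr (- (of_nat k + 1 / 2)) * h (moebius_act a b c d \<tau>))"
    using e' by (rule bspec)
  define r where "r = exp (- 2 * pi * (1 / 5 / real M))"
  \<comment> \<open>Any height below 1/5 would do: convergence at a nome of larger modulus forces
    absolute convergence at radius \<open>r\<close>.\<close>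
  define \<tau>0 :: complex where "\<tau>0 = \<i> * of_real (1 / 6)"
  have "\<tau>0 \<in> upper_half_plane" by (simp add: \<tau>0_def upper_half_plane_def)
  then have "summable (\<lambda>n. e n * nome (\<tau>0 / of_nat M) ^ n)" using e sums_summable by blast
  moreover have "norm (of_real r :: complex) < norm (nome (\<tau>0 / of_nat M))"
    using M by (simp add: norm_nome r_def \<tau>0_def field_simps)
  ultimately have "summable (\<lambda>n. norm (e n * of_real r ^ n))" by (rule powser_insidea)
  then have sm: "summable (\<lambda>n. norm (e n) * r ^ n)"
    by (simp add: norm_mult norm_power r_def)
  define C where "C = (\<Sum>n. norm (e n) * r ^ n)"
  have C0: "C \<ge> 0" unfolding C_def by (rule suminf_nonneg[OF sm]) (simp add: r_def)
  have "form_height k h (moebius_act a b c d \<tau>) \<le> C ^ 4 * Im \<tau> ^ (2 * k + 1)" if im: "Im \<tau> \<ge> 1 / 5" for \<tau>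
  proof -
    have \<tau>: "\<tau> \<in> upper_half_plane" using im by (simp add: upper_half_plane_def)
    define w where "w = of_int c * \<tau> + of_int d"
    define H where "H = norm (h (moebius_act a b c d \<tau>))"
    have w0: "w \<noteq> 0" using moebius_act_upper_half_plane(1)[OF det \<tau>] by (simp add: w_def)
    have nr: "norm (nome (\<tau> / of_nat M)) \<le> r"
    proof -
      have "1 / 5 / real M \<le> Im \<tau> / real M" using im M by (intro divide_right_mono) auto
      then have "2 * pi * (1 / 5 / real M) \<le> 2 * pi * (Im \<tau> / real M)" by (intro mult_left_mono) auto
      moreover have "Im (\<tau> / of_nat M) = Im \<tau> / real M" by simp
      ultimately show ?thesis unfolding norm_nome r_def by simp
    qed
    have trm: "norm (e n * nome (\<tau> / of_nat M) ^ n) \<le> norm (e n) * r ^ n" for n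
      unfolding norm_mult norm_power using nr by (intro mult_left_mono power_mono) auto
    have sn: "summable (\<lambda>n. norm (e n * nome (\<tau> / of_nat M) ^ n))"
      by (rule summable_comparison_test[OF _ sm]) (use trm in auto)
    have "norm (w powr (- (of_nat k + 1 / 2)) * h (moebius_act a b c d \<tau>)) =
        norm (\<Sum>n. e n * nome (\<tau> / of_nat M) ^ n)"
      using sums_unique[OF e[OF \<tau>]] by (simp only: w_def)
    also have "\<dots> \<le> (\<Sum>n. norm (e n * nome (\<tau> / of_nat M) ^ n))" by (rule summable_norm[OF sn])
    also have "\<dots> \<le> C" unfolding C_def by (rule suminf_le[OF trm sn sm])
    finally have le: "norm (w powr (- (of_nat k + 1 / 2))) * H \<le> C" by (simp add: norm_mult H_def)
    define x where "x = norm w"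
    have x: "x > 0" using w0 by (simp add: x_def)
    have "- (of_nat k + 1 / 2) = (of_real (- (real k + 1 / 2)) :: complex)" by simp
    then have nw: "norm (w powr (- (of_nat k + 1 / 2))) = x powr (- (real k + 1 / 2))"
      unfolding x_def by (metis norm_powr_real_powr' Reals_of_real Re_complex_of_real)
    have "(x powr (- (real k + 1 / 2))) ^ 4 = 1 / x ^ (4 * k + 2)"
    proof -
      have "(x powr (- (real k + 1 / 2))) ^ 4 = x powr (- real (4 * k + 2))"
      proof -
        have "(x powr (- (real k + 1 / 2))) ^ 4 = (x powr (- (real k + 1 / 2))) powr real 4"
          using x by (intro powr_realpow[symmetric]) simp
        also have "\<dots> = x powr (- (real k + 1 / 2) * real 4)" by (rule powr_powr)
        also have "- (real k + 1 / 2) * real 4 = - real (4 * k + 2)" by simp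
        finally show ?thesis .
      qed
      also have "\<dots> = 1 / x ^ (4 * k + 2)"
        using x by (simp only: powr_minus_divide powr_realpow)
      finally show ?thesis .
    qed
    then have "1 / x ^ (4 * k + 2) * H ^ 4 = (x powr (- (real k + 1 / 2)) * H) ^ 4"
      by (simp add: power_mult_distrib)
    also have "\<dots> \<le> C ^ 4"
      by (rule power_mono[OF le[unfolded nw]]) (simp add: H_def)
    finally have H4: "1 / x ^ (4 * k + 2) * H ^ 4 \<le> C ^ 4" .
    have "form_height k h (moebius_act a b c d \<tau>) = H ^ 4 * (Im \<tau> / x\<^sup>2) ^ (2 * k + 1)"
      by (simp only: form_height_def H_def moebius_act_upper_half_plane(2)[OF det \<tau>] x_def w_def)
    also have "(x\<^sup>2) ^ (2 * k + 1) = x ^ (4 * k + 2)" by (simp only: power_mult[symmetric]) (simp add: algebra_simps)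
    then have "H ^ 4 * (Im \<tau> / x\<^sup>2) ^ (2 * k + 1) = (1 / x ^ (4 * k + 2) * H ^ 4) * Im \<tau> ^ (2 * k + 1)"
      by (simp only: power_divide) simp
    also have "\<dots> \<le> C ^ 4 * Im \<tau> ^ (2 * k + 1)"
      using H4 \<tau> by (intro mult_right_mono) (auto simp: upper_half_plane_def)
    finally show ?thesis .
  qed
  then show ?thesis using C0 by (intro exI[of _ "C ^ 4"]) auto
qed

text \<open>Two matrices with the same bottom row modulo N differ on the left by an element of
  Gamma0(N), which preserves the height. One representative for each pair of residues therefore
  suffices, and the sum of the finitely many constants dominates each of them.\<close>

lemma form_height_uniform_cusp_bound:
  assumes h: "h \<in> half_integral_forms k N \<psi>" and \<psi>: "dirichlet_char N \<psi>" and N: "4 dvd N"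
  obtains C where "C \<ge> 0" "\<And>a b c d \<tau>. a * d - b * c = (1::int) \<Longrightarrow> Im \<tau> \<ge> 1 / 5 \<Longrightarrow>
     form_height k h (moebius_act a b c d \<tau>) \<le> C * Im \<tau> ^ (2 * k + 1)"
proof -
  have Npos: "int N > 0" using \<psi> by (simp add: dirichlet_char_def)
  have "\<exists>C\<ge>0. \<forall>a b c d \<tau>. a * d - b * c = 1 \<and> c mod int N = u \<and> d mod int N = v \<and> Im \<tau> \<ge> 1 / 5 \<longrightarrow>
     form_height k h (moebius_act a b c d \<tau>) \<le> C * Im \<tau> ^ (2 * k + 1)" for u v :: int
  proof (cases "\<exists>a b c d :: int. a * d - b * c = 1 \<and> c mod int N = u \<and> d mod int N = v")
    case False
    then show ?thesis by (intro exI[of _ 0]) auto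
  next
    case True
    then obtain a0 b0 c0 d0 where 0: "a0 * d0 - b0 * c0 = 1" "c0 mod int N = u" "d0 mod int N = v" by blast
    obtain C where C: "C \<ge> 0" "\<And>\<tau>. Im \<tau> \<ge> 1 / 5 \<Longrightarrow> form_height k h (moebius_act a0 b0 c0 d0 \<tau>) \<le> C * Im \<tau> ^ (2 * k + 1)"
      using form_height_cusp_bound[OF h 0(1)] by blast
    show ?thesis
    proof (intro exI[of _ C] conjI allI impI C(1), elim conjE)
      fix a b c d :: int and \<tau> :: complex
      assume m: "a * d - b * c = 1" "c mod int N = u" "d mod int N = v" and im: "Im \<tau> \<ge> 1 / 5"
      have \<tau>: "\<tau> \<in> upper_half_plane" using im by (simp add: upper_half_plane_def)
      define \<sigma> where "\<sigma> = moebius_act a0 b0 c0 d0 \<tau>"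
      have \<sigma>: "\<sigma> \<in> upper_half_plane" unfolding \<sigma>_def by (rule moebius_act_upper_half_plane(3)[OF 0(1) \<tau>])
      \<comment> \<open>The entries of the first matrix times the inverse of the representative; the
        lower left entry \<open>P\<close> is divisible by N since the bottom rows agree modulo
        N.\<close>
      define A B P Q where "A = a * d0 - b * c0" and "B = b * a0 - a * b0" and "P = c * d0 - d * c0" and "Q = d * a0 - c * b0"
      have "A * Q - B * P = (a * d - b * c) * (a0 * d0 - b0 * c0)"
        by (simp add: A_def B_def P_def Q_def algebra_simps)
      then have detABPQ: "A * Q - B * P = 1" using m 0 by simp
      have "[c * d0 = c0 * d] (mod int N)" using m 0 by (intro cong_mult) (auto simp: cong_def)
      then have PN: "int N dvd P" by (simp add: P_def cong_iff_dvd_diff mult.commute)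
      have nz: "of_int c0 * \<tau> + of_int d0 \<noteq> 0" by (rule moebius_act_upper_half_plane(1)[OF 0(1) \<tau>])
      have entries: "A * a0 + B * c0 = a" "A * b0 + B * d0 = b" "P * a0 + Q * c0 = c" "P * b0 + Q * d0 = d"
      proof -
        have "A * a0 + B * c0 = a * (a0 * d0 - b0 * c0)" "A * b0 + B * d0 = b * (a0 * d0 - b0 * c0)"
          "P * a0 + Q * c0 = c * (a0 * d0 - b0 * c0)" "P * b0 + Q * d0 = d * (a0 * d0 - b0 * c0)"
          by (simp_all add: A_def B_def P_def Q_def algebra_simps)
        then show "A * a0 + B * c0 = a" "A * b0 + B * d0 = b" "P * a0 + Q * c0 = c" "P * b0 + Q * d0 = d"
          using 0(1) by simp_all
      qed
      have "moebius_act a b c d \<tau> = moebius_act A B P Q \<sigma>"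
        unfolding \<sigma>_def moebius_act_compose[OF nz] entries ..
      then have "form_height k h (moebius_act a b c d \<tau>) = form_height k h \<sigma>"
        using form_height_Gamma0[OF h \<psi> N detABPQ PN \<sigma>] by simp
      also have "\<dots> \<le> C * Im \<tau> ^ (2 * k + 1)" unfolding \<sigma>_def by (rule C(2)[OF im])
      finally show "form_height k h (moebius_act a b c d \<tau>) \<le> C * Im \<tau> ^ (2 * k + 1)" .
    qed
  qed
  then obtain C where C: "\<And>u v. C u v \<ge> 0" "\<And>u v a b c d \<tau>. a * d - b * c = 1 \<Longrightarrow> c mod int N = u \<Longrightarrow> d mod int N = v \<Longrightarrow>
     Im \<tau> \<ge> 1 / 5 \<Longrightarrow> form_height k h (moebius_act a b c d \<tau>) \<le> C u v * Im \<tau> ^ (2 * k + 1)"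
    by metis
  define S where "S = (\<Sum>u\<in>{0..<int N}. \<Sum>v\<in>{0..<int N}. C u v)"
  have S: "C u v \<le> S" if "u \<in> {0..<int N}" "v \<in> {0..<int N}" for u v
  proof -
    have "C u v \<le> (\<Sum>v\<in>{0..<int N}. C u v)" using that C(1) by (intro member_le_sum) auto
    also have "\<dots> \<le> S" unfolding S_def using that C(1) by (intro member_le_sum sum_nonneg) auto
    finally show ?thesis .
  qed
  have "S \<ge> 0" unfolding S_def by (intro sum_nonneg C(1))
  moreover have "form_height k h (moebius_act a b c d \<tau>) \<le> S * Im \<tau> ^ (2 * k + 1)"
    if "a * d - b * c = (1::int)" "Im \<tau> \<ge> 1 / 5" for a b c d \<tau>
  proof -
    have "form_height k h (moebius_act a b c d \<tau>) \<le> C (c mod int N) (d mod int N) * Im \<tau> ^ (2 * k + 1)"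
      using that by (intro C(2)) auto
    also have "\<dots> \<le> S * Im \<tau> ^ (2 * k + 1)"
      using that Npos by (intro mult_right_mono S) auto
    finally show ?thesis .
  qed
  ultimately show thesis using that by blast
qed

text \<open>Dirichlet's theorem with denominators up to \<open>1 / sqrt y\<close> replaces reduction to a fundamental domain.\<close>
lemma moebius_act_away_from_real_axis:
  assumes y: "0 < Im \<tau>" "Im \<tau> \<le> 1"
  obtains a b c d where "a * d - b * c = (1::int)" "Im (moebius_act a b c d \<tau>) \<ge> 1 / 5"
    "Im (moebius_act a b c d \<tau>) \<le> 1 / Im \<tau>"
proof -
  define y where "y = Im \<tau>"
  have y01: "0 < y" "y \<le> 1" using assms by (auto simp: y_def)
  have \<tau>: "\<tau> \<in> upper_half_plane" using assms by (simp add: upper_half_plane_def)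
  \<comment> \<open>This size balances the two parts of |c\<tau> + d|^2: the approximation error 1/N
    and the term q y are both of order sqrt y.\<close>
  define N where "N = nat \<lfloor>1 / sqrt y\<rfloor>"
  have s: "1 \<le> 1 / sqrt y" using y01 by simp
  have N: "real N \<le> 1 / sqrt y" "1 / sqrt y < real N + 1" "N \<ge> 1"
    unfolding N_def using s by linarith+
  obtain p q where pq: "coprime p q" "0 < q" "q \<le> int N" "\<bar>of_int q * Re \<tau> - of_int p\<bar> < 1 / N"
    using Dirichlet_approx_coprime[of N "Re \<tau>"] N(3) by auto
  obtain u v where uv: "u * p + v * q = 1" using pq(1) bezout_int[of p q] by (auto simp: coprime_iff_gcd_eq_1)
  define a b c d where "a = - u" and "b = - v" and "c = q" and "d = - p"
  have det: "a * d - b * c = 1" using uv by (simp add: a_def b_def c_def d_def)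
  define w where "w = of_int c * \<tau> + of_int d"
  have Re: "Re w = of_int q * Re \<tau> - of_int p" and Im: "Im w = of_int q * y"
    by (simp_all add: w_def c_def d_def y_def)
  have nw: "(norm w)\<^sup>2 = (of_int q * Re \<tau> - of_int p)\<^sup>2 + (of_int q * y)\<^sup>2"
    by (simp only: cmod_power2 Re Im)
  have "(of_int q * Re \<tau> - of_int p)\<^sup>2 \<le> (1 / N)\<^sup>2"
    using pq(4) by (intro power2_le_iff_abs_le[THEN iffD2]) auto
  also have "\<dots> \<le> (2 * sqrt y)\<^sup>2"
  proof (intro power_mono)
    have "1 / sqrt y \<le> 2 * real N" using N by linarith
    then show "1 / real N \<le> 2 * sqrt y" using y01 N(3) by (simp add: field_simps)
  qed auto
  also have "\<dots> = 4 * y" using y01 by (simp add: power_mult_distrib)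
  finally have 1: "(of_int q * Re \<tau> - of_int p)\<^sup>2 \<le> 4 * y" .
  have "of_int q * y \<le> real N * y" using pq y01 by (intro mult_right_mono) (auto simp: of_int_le_iff[symmetric] simp del: of_int_le_iff)
  also have "\<dots> \<le> 1 / sqrt y * y" using N y01 by (intro mult_right_mono) auto
  also have "\<dots> = sqrt y" using y01 by (simp add: real_div_sqrt)
  finally have "(of_int q * y)\<^sup>2 \<le> (sqrt y)\<^sup>2" using y01 pq by (intro power_mono) auto
  also have "\<dots> = y" using y01 by simp
  \<comment> \<open>The sum 4y + y of the two parts is the origin of the constant 1/5.\<close>
  finally have n5: "(norm w)\<^sup>2 \<le> 5 * y" using 1 nw by linarith
  have "y\<^sup>2 \<le> (of_int q * y)\<^sup>2" using y01 pq by (intro power_mono) auto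
  then have ny: "y\<^sup>2 \<le> (norm w)\<^sup>2" using nw by (smt (verit) zero_le_power2)
  have im: "Im (moebius_act a b c d \<tau>) = y / (norm w)\<^sup>2"
    using moebius_act_upper_half_plane(2)[OF det \<tau>] by (simp only: y_def w_def)
  have pos: "(norm w)\<^sup>2 > 0" using ny y01 by (smt (verit) zero_less_power)
  have "Im (moebius_act a b c d \<tau>) \<ge> 1 / 5" unfolding im using n5 pos by (simp add: field_simps)
  moreover have "Im (moebius_act a b c d \<tau>) \<le> 1 / y"
  proof -
    have "y / (norm w)\<^sup>2 \<le> y / y\<^sup>2" using ny y01 pos by (intro divide_left_mono mult_pos_pos) auto
    then show ?thesis unfolding im using y01 by (simp add: power2_eq_square)
  qed
  ultimately show thesis using that det by (simp add: y_def)
qed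

text \<open>The point \<tau> is the image, under the inverse matrix, of a point of height between
  1/5 and 1/y. The uniform cusp bound there gives |h|^4 y^(2k+1) <= C y^(-(2k+1)).\<close>

theorem half_integral_form_growth:
  assumes h: "h \<in> half_integral_forms k N \<psi>" and \<psi>: "dirichlet_char N \<psi>" and N: "4 dvd N"
  obtains B where "B \<ge> 0" "\<And>\<tau>. 0 < Im \<tau> \<Longrightarrow> Im \<tau> \<le> 1 \<Longrightarrow> norm (h \<tau>) \<le> B / Im \<tau> ^ (k + 1)"
proof -
  obtain C where C: "C \<ge> 0" "\<And>a b c d \<tau>. a * d - b * c = (1::int) \<Longrightarrow> Im \<tau> \<ge> 1 / 5 \<Longrightarrow>
     form_height k h (moebius_act a b c d \<tau>) \<le> C * Im \<tau> ^ (2 * k + 1)"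
    using form_height_uniform_cusp_bound[OF assms] by blast
  \<comment> \<open>Since \<open>C + 1\<close> is at least 1, its fourth power dominates
    \<open>C\<close> and no root has to be taken.\<close>
  define B where "B = C + 1"
  have B: "C \<le> B ^ 4" "B \<ge> 0"
    using C(1) self_le_power[of B 4] by (auto simp: B_def)
  have "norm (h \<tau>) \<le> B / Im \<tau> ^ (k + 1)" if \<tau>: "0 < Im \<tau>" "Im \<tau> \<le> 1" for \<tau>
  proof -
    define y where "y = Im \<tau>"
    have y: "0 < y" "y \<le> 1" using \<tau> by (auto simp: y_def)
    have \<tau>H: "\<tau> \<in> upper_half_plane" using \<tau> by (simp add: upper_half_plane_def)
    obtain a b c d where m: "a * d - b * c = (1::int)" "Im (moebius_act a b c d \<tau>) \<ge> 1 / 5"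
      "Im (moebius_act a b c d \<tau>) \<le> 1 / y"
      using moebius_act_away_from_real_axis[OF \<tau>] unfolding y_def .
    define \<sigma> where "\<sigma> = moebius_act a b c d \<tau>"
    have nz: "of_int c * \<tau> + of_int d \<noteq> 0" by (rule moebius_act_upper_half_plane(1)[OF m(1) \<tau>H])
    have det': "d * a - (- b) * (- c) = 1" using m(1) by (simp add: mult.commute)
    have e: "d * a + - b * c = 1" "d * b + - b * d = 0" "- c * a + a * c = 0" "- c * b + a * d = 1"
      using m(1) by (simp_all add: algebra_simps)
    have "moebius_act d (- b) (- c) a \<sigma> = \<tau>"
      unfolding \<sigma>_def moebius_act_compose[OF nz] e by (simp add: moebius_act_def)
    then have "form_height k h \<tau> \<le> C * Im \<sigma> ^ (2 * k + 1)"
      using C(2)[OF det', of \<sigma>] m(2) by (simp add: \<sigma>_def)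
    also have "\<dots> \<le> C * (1 / y) ^ (2 * k + 1)"
      using C(1) m by (intro mult_left_mono power_mono) (auto simp: \<sigma>_def)
    finally have "norm (h \<tau>) ^ 4 * y ^ (2 * k + 1) \<le> C / y ^ (2 * k + 1)"
      by (simp add: form_height_def y_def power_divide)
    then have "norm (h \<tau>) ^ 4 \<le> C / (y ^ (2 * k + 1) * y ^ (2 * k + 1))"
      using y by (simp add: field_simps)
    also have "\<dots> \<le> B ^ 4 / (y ^ (k + 1)) ^ 4"
    proof (intro frac_le B)
      \<comment> \<open>The exponent 4k + 2 is rounded up to 4k + 4, which only weakens the bound as
        y <= 1, so that the fourth root is an integral power of y.\<close>
      have "(y ^ (k + 1)) ^ 4 = y ^ (4 * k + 4)" by (simp only: power_mult[symmetric]) (simp add: algebra_simps)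
      also have "\<dots> \<le> y ^ (4 * k + 2)" using y by (intro power_decreasing) auto
      also have "\<dots> = y ^ (2 * k + 1) * y ^ (2 * k + 1)" by (simp only: power_add[symmetric]) (simp add: algebra_simps)
      finally show "(y ^ (k + 1)) ^ 4 \<le> y ^ (2 * k + 1) * y ^ (2 * k + 1)" .
    qed (use y B in auto)
    finally have "norm (h \<tau>) ^ 4 \<le> (B / y ^ (k + 1)) ^ 4" by (simp only: power_divide)
    moreover have "0 \<le> B / y ^ (k + 1)" using B y by (intro divide_nonneg_pos zero_less_power)
    ultimately show ?thesis
      unfolding y_def[symmetric] by (subst (asm) power_mono_iff[OF norm_ge_zero]) simp_all
  qed
  then show thesis using that B by blast
qed

section \<open>From growth to coefficients\<close>

lemma nome_surj:
  assumes "0 < norm w" "norm w < 1"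
  obtains \<tau> where "\<tau> \<in> upper_half_plane" "nome \<tau> = w" "Im \<tau> = - ln (norm w) / (2 * pi)"
proof -
  define \<tau> where "\<tau> = Ln w / (2 * of_real pi * \<i>)"
  have "nome \<tau> = w" using assms by (simp add: nome_def \<tau>_def)
  moreover have "Im \<tau> = - ln (norm w) / (2 * pi)"
  proof -
    have "\<tau> = - \<i> * Ln w / of_real (2 * pi)" by (simp add: \<tau>_def field_simps)
    then show ?thesis using assms by (simp only: Im_divide_of_real) (simp add: Re_Ln)
  qed
  moreover have "\<tau> \<in> upper_half_plane"
    using calculation assms by (auto simp: upper_half_plane_def intro!: divide_neg_pos ln_less_zero)
  ultimately show thesis using that by blast
qed

text \<open>The circle has radius exp(-2 pi / n), which is the line Im \<tau> = 1/n: there the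
  growth bound is a power of n, while the n-th power of the radius in Cauchy's inequality is the
  constant exp(-2 pi).\<close>

theorem half_integral_form_coeff_bound:
  assumes h: "h \<in> half_integral_forms k N \<psi>" and \<psi>: "dirichlet_char N \<psi>" and N: "4 dvd N"
    and c: "\<And>\<tau>. \<tau> \<in> upper_half_plane \<Longrightarrow> (\<lambda>n. c n * nome \<tau> ^ n) sums h \<tau>"
  obtains B where "B \<ge> 0" "\<And>n. n > 0 \<Longrightarrow> norm (c n) \<le> B * real n ^ (k + 1)"
proof -
  obtain B where B: "B \<ge> 0" "\<And>\<tau>. 0 < Im \<tau> \<Longrightarrow> Im \<tau> \<le> 1 \<Longrightarrow> norm (h \<tau>) \<le> B / Im \<tau> ^ (k + 1)"
    using half_integral_form_growth[OF h \<psi> N] by blast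
  \<comment> \<open>The centre 0 of the circle is not a value of \<open>nome\<close>; the power
    series provides the holomorphic extension of h, as a function of the nome, over it.\<close>
  define F where "F = Abs_fps c"
  have rad: "fps_conv_radius F \<ge> 1"
    unfolding fps_conv_radius_def
  proof (rule conv_radius_geI_ex)
    fix r :: real assume r: "0 < r" "ereal r < 1"
    then obtain \<tau> where "\<tau> \<in> upper_half_plane" "nome \<tau> = of_real r"
      using nome_surj[of "of_real r"] by auto
    then have "summable (\<lambda>n. fps_nth F n * of_real r ^ n)"
      using c sums_summable by (fastforce simp: F_def)
    then show "\<exists>z. norm z = r \<and> summable (\<lambda>n. fps_nth F n * z ^ n)"
      using r by (intro exI[of _ "of_real r"]) auto
  qed
  have sub: "A \<subseteq> eball 0 (fps_conv_radius F)" if "A \<subseteq> ball 0 1" for A :: "complex set"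
  proof
    fix z assume "z \<in> A"
    then have "ereal (norm z) < 1" using that by auto
    then show "z \<in> eball 0 (fps_conv_radius F)"
      using less_le_trans[OF _ rad] by (simp add: in_eball_iff)
  qed
  have coeff: "c n = (deriv ^^ n) (eval_fps F) 0 / fact n" for n
  proof -
    have "fps_conv_radius F > 0" using rad by (rule less_le_trans[rotated]) simp
    then show ?thesis
      using fps_nth_fps_expansion[OF eval_fps_has_fps_expansion, of F n] by (simp add: F_def)
  qed
  have "norm (c n) \<le> B * exp (2 * pi) * real n ^ (k + 1)" if n: "n > 0" for n
  proof -
    define r where "r = exp (- 2 * pi / real n)"
    have r: "0 < r" "r < 1" using n by (auto simp: r_def)
    have "norm ((deriv ^^ n) (eval_fps F) 0) \<le> fact n * (B * real n ^ (k + 1)) / r ^ n"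
    proof (rule Cauchy_inequality[OF _ _ r(1)])
      show "eval_fps F holomorphic_on ball 0 r"
        using r by (intro holomorphic_on_eval_fps sub) auto
      show "continuous_on (cball 0 r) (eval_fps F)"
        using r by (intro holomorphic_on_imp_continuous_on holomorphic_on_eval_fps sub) auto
      fix w :: complex assume "norm (0 - w) = r"
      then have w: "norm w = r" by simp
      then obtain \<tau> where \<tau>: "\<tau> \<in> upper_half_plane" "nome \<tau> = w" "Im \<tau> = - ln (norm w) / (2 * pi)"
        using nome_surj[of w] r by auto
      have im: "Im \<tau> = 1 / real n" using \<tau>(3) w by (simp add: r_def)
      have "eval_fps F w = h \<tau>"
        using sums_unique[OF c[OF \<tau>(1)]] \<tau>(2) by (simp add: eval_fps_def F_def)
      moreover have "norm (h \<tau>) \<le> B / Im \<tau> ^ (k + 1)"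
        using im n by (intro B(2)) auto
      ultimately show "norm (eval_fps F w) \<le> B * real n ^ (k + 1)"
        unfolding im by (simp add: power_divide)
    qed
    also have "r ^ n = exp (- 2 * pi)"
      unfolding r_def exp_of_nat_mult[symmetric] using n by simp
    finally have "norm (c n) \<le> B * real n ^ (k + 1) / exp (- 2 * pi)"
      unfolding coeff[of n] by (simp add: norm_divide divide_le_eq mult_ac)
    also have "\<dots> = B * exp (2 * pi) * real n ^ (k + 1)"
      by (simp add: exp_minus field_simps)
    finally show ?thesis .
  qed
  then show thesis using that[of "B * exp (2 * pi)"] B(1) by auto
qed

section \<open>Reciprocity for the Kronecker symbol\<close>

lemma Legendre_cong: "[a = b] (mod p) \<Longrightarrow> Legendre a p = Legendre b p"
  by (simp add: Legendre_def QuadRes_def cong_def)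

lemma Legendre_eq_0: "p dvd a \<Longrightarrow> Legendre a p = 0"
  by (simp add: Legendre_def cong_0_iff)

lemma Legendre_range: "Legendre a p \<in> {-1, 0, 1}"
  by (simp add: Legendre_def)

text \<open>Turns the congruences of Euler's criterion into equalities: values in {-1, 0, 1} differ
  by at most 2, which is less than p.\<close>

lemma cong_imp_eq_small:
  fixes x y :: int
  assumes "[x = y] (mod int p)" "\<bar>x\<bar> \<le> 1" "\<bar>y\<bar> \<le> 1" "2 < p"
  shows "x = y"
proof -
  have "int p dvd x - y" using assms(1) by (simp add: cong_iff_dvd_diff)
  moreover have "\<bar>x - y\<bar> < \<bar>int p\<bar>" using assms by linarith
  ultimately show ?thesis using dvd_imp_le_int[of "x - y" "int p"] by force
qed

lemma abs_Legendre_le: "\<bar>Legendre a p\<bar> \<le> 1"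
  by (simp add: Legendre_def)

lemma Legendre_mult:
  assumes "prime p" "2 < p"
  shows "Legendre (a * b) (int p) = Legendre a (int p) * Legendre b (int p)"
proof (rule cong_imp_eq_small[OF _ _ _ assms(2)])
  let ?m = "(p - 1) div 2"
  have "[Legendre (a * b) (int p) = (a * b) ^ ?m] (mod int p)" by (rule euler_criterion[OF assms])
  also have "(a * b) ^ ?m = a ^ ?m * b ^ ?m" by (rule power_mult_distrib)
  also have "[a ^ ?m * b ^ ?m = Legendre a (int p) * Legendre b (int p)] (mod int p)"
    by (intro cong_mult cong_sym[OF euler_criterion[OF assms]])
  finally show "[Legendre (a * b) (int p) = Legendre a (int p) * Legendre b (int p)] (mod int p)" .
  show "\<bar>Legendre a (int p) * Legendre b (int p)\<bar> \<le> 1"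
    unfolding abs_mult using abs_Legendre_le[of a p] abs_Legendre_le[of b p]
    by (simp add: mult_le_one)
qed (rule abs_Legendre_le)

lemma Legendre_1:
  assumes "prime p" "2 < p"
  shows "Legendre 1 (int p) = 1"
  by (rule cong_imp_eq_small[OF _ _ _ assms(2)])
     (use euler_criterion[OF assms, of 1] abs_Legendre_le in auto)

lemma Legendre_sign:
  assumes "prime p" "2 < p" "s = 1 \<or> s = - 1"
  shows "Legendre s (int p) = s ^ ((p - 1) div 2)"
proof (rule cong_imp_eq_small[OF euler_criterion[OF assms(1,2)] abs_Legendre_le _ assms(2)])
  show "\<bar>s ^ ((p - 1) div 2)\<bar> \<le> 1" using assms(3) by (auto simp: power_abs)
qed

lemma Legendre_4:
  assumes "prime p" "2 < p"
  shows "Legendre 4 (int p) = 1"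
proof -
  have "\<not> int p dvd 2" using assms(2) zdvd_imp_le[of "int p" 2] by auto
  then have "\<not> [4 = 0] (mod int p)"
    using assms(1) prime_dvd_multD[of "int p" 2 2] by (auto simp: cong_0_iff)
  moreover have "QuadRes (int p) 4" unfolding QuadRes_def by (rule exI[of _ 2]) simp
  ultimately show ?thesis by (simp add: Legendre_def)
qed

text \<open>At odd n this is the quadratic character (2/n); even n receive the default value
  -1.\<close>

definition chi8 :: "int \<Rightarrow> int" where
  "chi8 n = (if n mod 8 \<in> {1, 7} then 1 else -1)"

text \<open>Gauss's lemma. With p = 2h + 1, the doubles of 1, ..., h that exceed h come from x > h
  div 2, and the parity of their number h - h div 2 is determined by p modulo 8.\<close>

lemma Legendre_2:
  assumes p: "prime p" "2 < p"
  shows "Legendre 2 (int p) = chi8 (int p)"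
proof -
  have odd: "odd p" using p prime_odd_nat by auto
  have "\<not> int p dvd 2" using p(2) zdvd_imp_le[of "int p" 2] by auto
  then interpret G: GAUSS p 2
    by unfold_locales (use p in \<open>auto simp: cong_0_iff\<close>)
  define h where "h = (int p - 1) div 2"
  have h: "int p = 2 * h + 1" "h \<ge> 0" using odd p by (auto simp: h_def elim!: oddE)
  have "G.C = (\<lambda>x. x * 2) ` {0<..h}"
    unfolding G.C_def G.B_def G.A_def h_def[symmetric] image_image
    by (intro image_cong refl) (use h in auto)
  then have "G.E = (\<lambda>x. x * 2) ` {h div 2<..h}"
    unfolding G.E_def h_def[symmetric] using h by (auto simp: image_iff)
  then have "card G.E = card {h div 2<..h}"
    by (simp add: card_image inj_on_def)
  then have "Legendre 2 (int p) = (- 1) ^ nat (h - h div 2)"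
    using G.gauss_lemma by simp
  also have "\<dots> = (if even (h - h div 2) then 1 else - 1)"
    using h(2) by (simp add: minus_one_power_iff even_nat_iff)
  also have "even (h - h div 2) \<longleftrightarrow> int p mod 8 \<in> {1, 7}"
    unfolding h(1) insert_iff empty_iff by presburger
  finally show ?thesis by (simp add: chi8_def)
qed

lemma chi8_mult:
  assumes "odd a" "odd b"
  shows "chi8 (a * b) = chi8 a * chi8 b"
proof -
  have "a mod 8 \<in> {1, 3, 5, 7}" "b mod 8 \<in> {1, 3, 5, 7}"
    using assms unfolding insert_iff empty_iff by presburger+
  moreover have "(if A * B mod 8 \<in> {1, 7} then 1 else - 1 :: int) =
      (if A \<in> {1, 7} then 1 else - 1) * (if B \<in> {1, 7} then 1 else - 1)"
    if "A \<in> {1, 3, 5, 7}" "B \<in> {1, 3, 5, 7}" for A B :: int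
    using that by auto
  ultimately show ?thesis unfolding chi8_def mod_mult_eq[of a 8 b, symmetric] by blast
qed

lemma chi8_prod:
  assumes "finite Q" "\<And>q. q \<in> Q \<Longrightarrow> odd (f q)"
  shows "chi8 (\<Prod>q\<in>Q. f q) = (\<Prod>q\<in>Q. chi8 (f q)) \<and> odd (\<Prod>q\<in>Q. f q)"
  using assms by (induction Q rule: finite_induct) (auto simp: chi8_mult, auto simp: chi8_def)

text \<open>The exponent is the one that quadratic reciprocity produces. Comparing this congruence
  with D mod 4 = 1 is what fixes the total sign in
  \<open>kronecker_prime_reciprocity\<close>.\<close>

lemma prod_odd_mod_4:
  assumes "finite Q" "\<And>q. q \<in> Q \<Longrightarrow> odd q"
  shows "[(\<Prod>q\<in>Q. int q) = (- 1) ^ (\<Sum>q\<in>Q. (q - 1) div 2)] (mod 4)"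
  using assms
proof (induction Q rule: finite_induct)
  case (insert q Q)
  have "[int q = (- 1) ^ ((q - 1) div 2)] (mod 4)"
  proof -
    have "odd q" using insert by simp
    then obtain j where j: "q = 2 * j + 1" by (auto elim: oddE)
    have "(2 * int j + 1) mod 4 = (if even j then 1 else 3)" by presburger
    then show ?thesis unfolding j by (cases "even j") (auto simp: cong_def add.commute)
  qed
  then show ?case using insert by (simp add: power_add cong_mult)
qed simp

lemma squarefree_abs_eq_prod:
  fixes D :: int
  assumes "squarefree D"
  shows "D = sgn D * (\<Prod>q\<in>prime_factors (nat \<bar>D\<bar>). int q)"
proof -
  define n where "n = nat \<bar>D\<bar>"
  have D0: "D \<noteq> 0" using assms by auto
  then have n0: "n \<noteq> 0" by (simp add: n_def)
  have "squarefree n"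
  proof (rule squarefreeI)
    fix x assume "x\<^sup>2 dvd n"
    then have "(int x)\<^sup>2 dvd \<bar>D\<bar>" unfolding n_def
      by (metis abs_ge_zero int_dvd_int_iff int_nat_eq of_nat_power)
    then have "is_unit (int x)" using assms by (auto simp: squarefree_def)
    then show "is_unit x" by simp
  qed
  then have "\<forall>p\<in>prime_factors n. multiplicity p n = 1"
    using n0 by (simp add: squarefree_factorial_semiring')
  then have "(\<Prod>q\<in>prime_factors n. q) = (\<Prod>q\<in>prime_factors n. q ^ multiplicity q n)"
    by (intro prod.cong) auto
  also have "\<dots> = n" using n0 by (subst prod_prime_factors) auto
  finally have "(\<Prod>q\<in>prime_factors n. int q) = \<bar>D\<bar>"
    by (simp add: n_def flip: of_nat_prod)
  then show ?thesis by (simp add: n_def abs_sgn mult.commute)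
qed

text \<open>Let D be the sign s times the product of its primes q. For odd p not dividing D,
  flipping every (q/p) and evaluating (s/p) leaves the total sign (s (-1)^S)^m with m = (p - 1) / 2,
  and s (-1)^S is congruent to D modulo 4, hence 1. If p divides D, both sides vanish. For p = 2 the
  supplementary law reduces the claim to multiplicativity of \<open>chi8\<close>, whose value 1 at
  -1 absorbs the sign of D.\<close>

lemma kronecker_prime_reciprocity:
  assumes D: "squarefree D" "D mod 4 = 1" and p: "prime p"
  shows "kronecker_prime D p = (\<Prod>q\<in>prime_factors (nat \<bar>D\<bar>). Legendre (int p) (int q))"
proof -
  define Q where "Q = prime_factors (nat \<bar>D\<bar>)"
  define s where "s = sgn D"
  have oddD: "odd D" using D(2) by presburger
  have D0: "D \<noteq> 0" using D(2) by auto
  have s: "s = 1 \<or> s = - 1" using D0 by (auto simp: s_def sgn_if)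
  have Dprod: "D = s * (\<Prod>q\<in>Q. int q)"
    unfolding s_def Q_def by (rule squarefree_abs_eq_prod[OF D(1)])
  have finQ: "finite Q" by (simp add: Q_def)
  have Q: "prime q" "int q dvd D" if "q \<in> Q" for q
    using that by (auto simp: Q_def in_prime_factors_iff)
  have Qodd: "odd q" "2 < q" if "q \<in> Q" for q
  proof -
    show "odd q" using Q(2)[OF that] oddD by (metis dvd_trans even_of_nat)
    then show "2 < q" using prime_ge_2_nat[OF Q(1)[OF that]] by (cases "q = 2") auto
  qed
  show ?thesis
  proof (cases "p = 2")
    case True
    have "chi8 D = chi8 (\<Prod>q\<in>Q. int q)"
      using s chi8_mult[of "- 1" "\<Prod>q\<in>Q. int q"] chi8_prod[OF finQ, of int] Qodd Dprod
      by (auto simp: chi8_def)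
    also have "\<dots> = (\<Prod>q\<in>Q. chi8 (int q))" using chi8_prod[OF finQ, of int] Qodd by simp
    also have "\<dots> = (\<Prod>q\<in>Q. Legendre (int p) (int q))"
      using Legendre_2 Q Qodd by (intro prod.cong) (auto simp: True)
    finally show ?thesis using True oddD by (simp add: kronecker_prime_def chi8_def Q_def)
  next
    case False
    then have p2: "2 < p" using prime_ge_2_nat[OF p] by simp
    have "kronecker_prime D p = Legendre D (int p)" using False by (simp add: kronecker_prime_def)
    also have "\<dots> = (\<Prod>q\<in>Q. Legendre (int p) (int q))"
    proof (cases "p \<in> Q")
      case True
      have "Legendre D (int p) = 0" using Q(2)[OF True] by (rule Legendre_eq_0)
      moreover have "(\<Prod>q\<in>Q. Legendre (int p) (int q)) = 0"
        using True finQ by (auto intro!: prod_zero bexI[of _ p] simp: Legendre_eq_0)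
      ultimately show ?thesis by simp
    next
      case notin: False
      define m where "m = (p - 1) div 2"
      define S where "S = (\<Sum>q\<in>Q. (q - 1) div 2)"
      have Lprod: "Legendre (\<Prod>q\<in>R. int q) (int p) = (\<Prod>q\<in>R. Legendre (int q) (int p))" if "finite R" for R
        using that by (induction R rule: finite_induct) (simp_all add: Legendre_1[OF p p2] Legendre_mult[OF p p2])
      have rec: "Legendre (int q) (int p) = Legendre (int p) (int q) * (- 1) ^ (m * ((q - 1) div 2))" if q: "q \<in> Q" for q
      proof -
        have "Legendre (int p) (int q) * Legendre (int q) (int p) = (- 1) ^ (m * ((q - 1) div 2))"
          unfolding m_def using Quadratic_Reciprocity[OF p p2 Q(1)[OF q] Qodd(2)[OF q]] notin q by auto
        moreover have "Legendre (int p) (int q) \<in> {-1, 0, 1}" by (rule Legendre_range)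
        ultimately show ?thesis by auto
      qed
      have "[s * (\<Prod>q\<in>Q. int q) = s * (- 1) ^ S] (mod 4)"
        unfolding S_def by (intro cong_mult cong_refl prod_odd_mod_4 finQ Qodd)
      then have "s * (- 1) ^ S mod 4 = 1" using D(2) unfolding Dprod[symmetric] by (simp add: cong_def)
      then have sS: "s * (- 1) ^ S = 1" using s by (cases "even S") auto
      have "Legendre D (int p) = Legendre s (int p) * (\<Prod>q\<in>Q. Legendre (int q) (int p))"
        using Dprod Legendre_mult[OF p p2] Lprod[OF finQ] by simp
      also have "Legendre s (int p) = s ^ m" unfolding m_def by (rule Legendre_sign[OF p p2 s])
      also have "(\<Prod>q\<in>Q. Legendre (int q) (int p)) = (\<Prod>q\<in>Q. Legendre (int p) (int q) * (- 1) ^ (m * ((q - 1) div 2)))"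
        by (intro prod.cong refl rec)
      also have "\<dots> = (\<Prod>q\<in>Q. Legendre (int p) (int q)) * ((- 1) ^ S) ^ m"
        by (simp add: prod.distrib S_def power_sum prod_power_distrib power_mult[symmetric] mult.commute[of m])
      also have "s ^ m * ((\<Prod>q\<in>Q. Legendre (int p) (int q)) * ((- 1) ^ S) ^ m) = (s * (- 1) ^ S) ^ m * (\<Prod>q\<in>Q. Legendre (int p) (int q))"
        by (simp add: power_mult_distrib)
      finally show ?thesis by (simp add: sS)
    qed
    finally show ?thesis by (simp add: Q_def)
  qed
qed

section \<open>Multiplicativity and periodicity of the Kronecker symbol\<close>

lemma kronecker_eq_prod_mset:
  assumes "n > 0"
  shows "kronecker D (int n) = prod_mset (image_mset (kronecker_prime D) (prime_factorization n))"
proof -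
  have "kronecker D (int n) = (\<Prod>p\<in>prime_factors n. kronecker_prime D p ^ multiplicity p n)"
    using assms by (simp add: kronecker_def)
  also have "\<dots> = (\<Prod>p\<in>prime_factors n. kronecker_prime D p ^ count (prime_factorization n) p)"
    by (intro prod.cong refl) (auto simp: count_prime_factorization_prime in_prime_factors_iff)
  also have "\<dots> = prod_mset (image_mset (kronecker_prime D) (prime_factorization n))"
    by (simp add: image_prod_mset_multiplicity)
  finally show ?thesis .
qed

lemma kronecker_1: "kronecker D 1 = 1"
  using kronecker_eq_prod_mset[of 1 D] by simp

text \<open>In the multiset form of the symbol this is the additivity of prime factorizations.
  Positive arguments stay clear of the special value at 0 and of the sign rule.\<close>

lemma kronecker_mult:
  assumes "m > 0" "n > 0"
  shows "kronecker D (int m * int n) = kronecker D (int m) * kronecker D (int n)"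
  using kronecker_eq_prod_mset[of "m * n" D] kronecker_eq_prod_mset[of m D] kronecker_eq_prod_mset[of n D] assms
  by (simp add: prime_factorization_mult)

lemma kronecker_prime_eq: "prime p \<Longrightarrow> kronecker D (int p) = kronecker_prime D p"
  using kronecker_eq_prod_mset[of p D] by (simp add: prime_factorization_prime prime_gt_0_nat)

lemma positive_prime_induct [consumes 1, case_names one prime_mult]:
  fixes n :: nat
  assumes "n > 0" "P 1" "\<And>p n. prime p \<Longrightarrow> n > 0 \<Longrightarrow> P n \<Longrightarrow> P (p * n)"
  shows "P n"
proof -
  have "n > 0 \<longrightarrow> P n"
  proof (induction n rule: prime_divisors_induct)
    case (factor p x)
    then show ?case using assms(3) by auto
  qed (use assms(2) in auto)
  then show ?thesis using assms(1) by simp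
qed

lemma abs_kronecker_le: "n > 0 \<Longrightarrow> \<bar>kronecker D (int n)\<bar> \<le> 1"
proof (induction n rule: positive_prime_induct)
  case (prime_mult p n)
  have "\<bar>kronecker_prime D p\<bar> \<le> 1" using abs_Legendre_le by (simp add: kronecker_prime_def)
  then show ?case using prime_mult
    by (simp add: kronecker_mult prime_gt_0_nat kronecker_prime_eq abs_mult mult_le_one)
qed (simp_all add: kronecker_1)

lemma kronecker_even:
  assumes "even D" "even n" "n > 0"
  shows "kronecker D (int n) = 0"
proof -
  obtain j where "n = 2 * j" using assms(2) by blast
  then have "kronecker D (int n) = kronecker D (int 2) * kronecker D (int j)"
    using assms(3) kronecker_mult[of 2 j D] by simp
  also have "kronecker D (int 2) = 0" using assms(1) by (subst kronecker_prime_eq) (auto simp: kronecker_prime_def)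
  finally show ?thesis by simp
qed

text \<open>Both sides are multiplicative over positive n, so the case of primes extends. The
  right-hand side sees n only modulo the primes dividing D, which exposes the period |D|.\<close>

lemma kronecker_reciprocity:
  assumes D: "squarefree D" "D mod 4 = 1" and n: "n > 0"
  shows "kronecker D (int n) = (\<Prod>q\<in>prime_factors (nat \<bar>D\<bar>). Legendre (int n) (int q))"
  using n
proof (induction n rule: positive_prime_induct)
  case one
  have "Legendre 1 (int q) = 1" if "q \<in> prime_factors (nat \<bar>D\<bar>)" for q
  proof -
    have q: "prime q" using that by (simp add: in_prime_factors_iff)
    moreover have "q \<noteq> 2" using that D(2) by (auto simp: in_prime_factors_iff) presburger
    ultimately show ?thesis using prime_ge_2_nat[OF q] by (intro Legendre_1) auto
  qed
  then show ?case by (simp add: kronecker_1)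
next
  case (prime_mult p n)
  have "Legendre (int (p * n)) (int q) = Legendre (int p) (int q) * Legendre (int n) (int q)"
    if "q \<in> prime_factors (nat \<bar>D\<bar>)" for q
  proof -
    have q: "prime q" using that by (simp add: in_prime_factors_iff)
    moreover have "q \<noteq> 2" using that D(2) by (auto simp: in_prime_factors_iff) presburger
    ultimately show ?thesis using prime_ge_2_nat[OF q] by (simp add: Legendre_mult)
  qed
  then have "(\<Prod>q\<in>prime_factors (nat \<bar>D\<bar>). Legendre (int (p * n)) (int q)) = kronecker_prime D p * kronecker D (int n)"
    using prime_mult by (simp add: prod.distrib kronecker_prime_reciprocity[OF D])
  then show ?case using prime_mult by (simp add: kronecker_mult prime_gt_0_nat kronecker_prime_eq)
qed

lemma kronecker_periodic:
  assumes D: "squarefree D" "D mod 4 = 1" and n: "n > 0"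
  shows "kronecker D (n + \<bar>D\<bar> * int j) = kronecker D n"
proof -
  define d where "d = nat \<bar>D\<bar>"
  have "kronecker D (int (nat n + d * j)) = kronecker D (int (nat n))"
    using n unfolding kronecker_reciprocity[OF D, of "nat n + d * j", simplified n]
  proof -
    assume n: "n > 0"
    have "Legendre (int (nat n + d * j)) (int q) = Legendre (int (nat n)) (int q)" if "q \<in> prime_factors (nat \<bar>D\<bar>)" for q
    proof (rule Legendre_cong)
      have "int q dvd int d * int j" using that by (metis d_def dvd_mult2 in_prime_factors_iff int_dvd_int_iff)
      then show "[int (nat n + d * j) = int (nat n)] (mod int q)" by (simp add: cong_iff_dvd_diff)
    qed
    then show ?thesis using n kronecker_reciprocity[OF D, of "nat n + d * j"] kronecker_reciprocity[OF D, of "nat n"] by simp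
  qed
  then show ?thesis using n by (simp add: d_def)
qed

text \<open>At 2 both sides vanish, -4 and D being even. At odd primes 4 is a square, so the symbols
  of 4m and m agree and multiply with that of -4 to the symbol of D. The alternative for
  \<open>D'\<close> reflects that a squarefree m is attached to the discriminant m or 4m.\<close>

lemma kronecker_minus4_mult:
  assumes "even D" "D' = 4 * m \<or> D' = m" "D = - 4 * m" "n > 0"
  shows "kronecker (- 4) (int n) * kronecker D' (int n) = kronecker D (int n)"
  using assms(4)
proof (induction n rule: positive_prime_induct)
  case (prime_mult p n)
  have "kronecker_prime (- 4) p * kronecker_prime D' p = kronecker_prime D p"
  proof (cases "p = 2")
    case False
    then have p: "prime p" "2 < p" using prime_mult prime_ge_2_nat[of p] by auto
    have "Legendre D' (int p) = Legendre m (int p)"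
      using assms(2) by (auto simp: Legendre_mult[OF p] Legendre_4[OF p])
    then show ?thesis using False
      by (simp only: kronecker_prime_def if_False assms(3) Legendre_mult[OF p])
  qed (use assms in \<open>simp add: kronecker_prime_def\<close>)
  then show ?case using prime_mult
    by (simp add: kronecker_mult prime_gt_0_nat kronecker_prime_eq mult_ac)
qed (simp_all add: kronecker_1)

section \<open>Change of modulus and the lifts\<close>

text \<open>The multiplier is the product P of the primes of N that divide neither M nor n. A prime
  of N dividing n divides neither M nor P; a prime of N not dividing n divides M P. Either way it
  does not divide n + M P.\<close>

lemma exists_coprime_in_residue_class:
  fixes n :: int and M N :: nat
  assumes N: "N > 0" and cop: "coprime n (int M)"
  obtains j :: nat where "coprime (n + int M * int j) (int N)"
proof
  define P where "P = {p \<in> prime_factors N. \<not> p dvd M \<and> \<not> int p dvd n}"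
  have fin: "finite P" by (simp add: P_def)
  show "coprime (n + int M * int (\<Prod>P)) (int N)"
  proof (rule ccontr)
    assume "\<not> coprime (n + int M * int (\<Prod>P)) (int N)"
    then have "gcd (n + int M * int (\<Prod>P)) (int N) \<noteq> 1" by (simp add: coprime_iff_gcd_eq_1)
    moreover have "gcd (n + int M * int (\<Prod>P)) (int N) \<ge> 0" by simp
    ultimately have "nat (gcd (n + int M * int (\<Prod>P)) (int N)) \<noteq> 1" by linarith
    then obtain p where p: "prime p" "p dvd nat (gcd (n + int M * int (\<Prod>P)) (int N))"
      using prime_factor_nat by blast
    then have "int p dvd gcd (n + int M * int (\<Prod>P)) (int N)"
      by (metis int_dvd_int_iff int_nat_eq gcd_ge_0_int)
    then have d: "int p dvd n + int M * int (\<Prod>P)" "p dvd N" by auto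
    have ip: "prime (int p)" using p by simp
    have pN: "p \<in> prime_factors N" using p d N by (simp add: in_prime_factors_iff)
    have notboth: "\<not> (int p dvd n \<and> int p dvd int M)"
    proof
      assume "int p dvd n \<and> int p dvd int M"
      then have "is_unit (int p)" using cop coprime_common_divisor by blast
      then show False using ip not_prime_unit by blast
    qed
    show False
    proof (cases "int p dvd n")
      case True
      then have "int p dvd int M * int (\<Prod>P)" using d(1) by (simp add: dvd_add_right_iff)
      then have "p dvd \<Prod>P" using notboth True ip prime_dvd_multD by (metis int_dvd_int_iff)
      then obtain q where q: "q \<in> P" "p dvd q" using prime_dvd_prod_iff[OF fin p(1), of id] by auto
      then have "p = q" using p(1) by (auto simp: P_def in_prime_factors_iff primes_dvd_imp_eq)
      then show False using q True by (simp add: P_def)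
    next
      case False
      have "int p dvd int M * int (\<Prod>P)"
      proof (cases "p dvd M")
        case False
        then have "p \<in> P" using pN \<open>\<not> int p dvd n\<close> by (simp add: P_def)
        then have "p dvd \<Prod>P" using fin by (intro dvd_prodI[of P p id, simplified])
        then have "int p dvd int (\<Prod>P)" by (simp only: int_dvd_int_iff)
        then show ?thesis by (rule dvd_mult)
      qed simp
      then show False using False d(1) by (simp add: dvd_add_left_iff)
    qed
  qed
qed

lemma dirichlet_char_add_mult:
  assumes "dirichlet_char M \<phi>" "M dvd L"
  shows "\<phi> (n + int L * int j) = \<phi> n"
proof (rule dirichlet_char_cong[OF assms(1)])
  have "int M dvd int L * int j" using assms(2) by simp
  then show "[n + int L * int j = n] (mod int M)" by (simp add: cong_iff_dvd_diff)
qed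

text \<open>Makes the definite description in \<open>primitive_char\<close> well defined: every
  class of units modulo M contains an integer prime to N, and there both characters are equal to
  \<psi>.\<close>

lemma induces_unique:
  assumes N: "N > 0" and "induces N M \<phi> \<psi>" "induces N M \<phi>' \<psi>"
  shows "\<phi> = \<phi>'"
proof
  fix n
  have \<phi>: "dirichlet_char M \<phi>" "\<And>n. coprime n (int N) \<Longrightarrow> \<psi> n = \<phi> n"
   and \<phi>': "dirichlet_char M \<phi>'" "\<And>n. coprime n (int N) \<Longrightarrow> \<psi> n = \<phi>' n"
    using assms by (auto simp: induces_def)
  show "\<phi> n = \<phi>' n"
  proof (cases "coprime n (int M)")
    case True
    then obtain j where j: "coprime (n + int M * int j) (int N)"
      using exists_coprime_in_residue_class[OF N] by blast
    have "\<phi> (n + int M * int j) = \<phi>' (n + int M * int j)" using \<phi>(2)[OF j] \<phi>'(2)[OF j] by simp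
    then show ?thesis using dirichlet_char_add_mult[OF \<phi>(1)] dirichlet_char_add_mult[OF \<phi>'(1)] by simp
  next
    case False
    then have "\<phi> n = 0" "\<phi>' n = 0" using \<phi>(1) \<phi>'(1) by (auto simp: dirichlet_char_def)
    then show ?thesis by simp
  qed
qed

lemma induces_primitive_char:
  assumes \<psi>: "dirichlet_char N \<psi>"
  shows "induces N (conductor N \<psi>) (primitive_char N \<psi>) \<psi>"
proof -
  have N: "N > 0" using \<psi> by (simp add: dirichlet_char_def)
  have "\<exists>\<phi>. induces N N \<phi> \<psi>" using \<psi> by (auto simp: induces_def)
  then have "\<exists>\<phi>. induces N (conductor N \<psi>) \<phi> \<psi>"
    unfolding conductor_def by (rule LeastI)
  then have "\<exists>!\<phi>. induces N (conductor N \<psi>) \<phi> \<psi>" using induces_unique[OF N] by blast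
  then show ?thesis unfolding primitive_char_def by (rule theI')
qed

text \<open>As the conductor divides M, the primitive character has period M as well, and cutting it
  off at integers not coprime to M keeps it multiplicative.\<close>

lemma dirichlet_char_to_modulus:
  assumes \<psi>: "dirichlet_char N \<psi>" and M: "conductor N \<psi> dvd M" "M dvd N"
  shows "dirichlet_char M (char_to_modulus N \<psi> M)"
    and "coprime n (int N) \<Longrightarrow> char_to_modulus N \<psi> M n = \<psi> n"
proof -
  define \<phi> where "\<phi> = primitive_char N \<psi>"
  define c where "c = conductor N \<psi>"
  have ind: "dirichlet_char c \<phi>" "\<And>n. coprime n (int N) \<Longrightarrow> \<psi> n = \<phi> n"
    using induces_primitive_char[OF \<psi>] by (auto simp: induces_def \<phi>_def c_def)
  have N: "N > 0" using \<psi> by (simp add: dirichlet_char_def)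
  then have Mpos: "M > 0" using M(2) by (cases M) auto
  have cop: "coprime n (int M) \<Longrightarrow> coprime n (int c)" for n
    using M(1) by (auto simp: c_def intro: coprime_divisors[OF dvd_refl])
  show "dirichlet_char M (char_to_modulus N \<psi> M)"
    unfolding dirichlet_char_def char_to_modulus_def \<phi>_def[symmetric]
  proof (intro conjI allI Mpos)
    fix m n :: int
    show "(if coprime (m * n) (int M) then \<phi> (m * n) else 0) =
        (if coprime m (int M) then \<phi> m else 0) * (if coprime n (int M) then \<phi> n else 0)"
      using ind(1) by (auto simp: dirichlet_char_def)
    have "\<phi> (n + int M) = \<phi> n"
      using dirichlet_char_add_mult[OF ind(1), of M n 1] M(1) by (simp add: c_def)
    then show "(if coprime (n + int M) (int M) then \<phi> (n + int M) else 0) = (if coprime n (int M) then \<phi> n else 0)"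
      by (simp add: coprime_iff_gcd_eq_1)
    show "(if coprime n (int M) then \<phi> n else 0) \<noteq> 0 \<longleftrightarrow> coprime n (int M)"
      using ind(1) cop by (auto simp: dirichlet_char_def)
  qed
  show "char_to_modulus N \<psi> M n = \<psi> n" if "coprime n (int N)"
  proof -
    have "coprime n (int M)" using that M(2) by (auto intro: coprime_divisors[OF dvd_refl])
    then show ?thesis using ind(2)[OF that] by (simp add: char_to_modulus_def \<phi>_def)
  qed
qed

section \<open>Coefficients of the lifts\<close>

lemma L_function_cong:
  assumes "\<And>n. n > 0 \<Longrightarrow> \<phi> n = \<phi>' n"
  shows "L_function \<phi> s = L_function \<phi>' s"
proof -
  have "\<phi> (int (Suc n)) = \<phi>' (int (Suc n))" for n by (rule assms) simp
  then show ?thesis unfolding L_function_def by simp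
qed

text \<open>The divisor sums and the L-series only see positive arguments, which is where the
  identities between Kronecker symbols are available.\<close>

lemma lift_coeff_cong:
  assumes "\<And>n. n > 0 \<Longrightarrow> \<phi> n = \<phi>' n"
  shows "lift_coeff k \<phi> c m = lift_coeff k \<phi>' c m"
proof
  fix n
  have "\<phi> (int d) = \<phi>' (int d)" if "d dvd n" "n \<noteq> 0" for d
    using that by (intro assms) (auto intro: Nat.gr0I)
  then have "n \<noteq> 0 \<Longrightarrow> (\<Sum>d | d dvd n. \<phi> (int d) * of_nat d ^ (k - 1) * c ((n div d)\<^sup>2 * m)) =
     (\<Sum>d | d dvd n. \<phi>' (int d) * of_nat d ^ (k - 1) * c ((n div d)\<^sup>2 * m))"
    by (intro sum.cong) auto
  then show "lift_coeff k \<phi> c m n = lift_coeff k \<phi>' c m n"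
    using L_function_cong[of \<phi> \<phi>'] assms by (simp add: lift_coeff_def)
qed

text \<open>This is how \<open>U2\<close> enters. Only odd d contribute, and these divide 2n exactly
  when they divide n; moreover (2n/d)^2 m = (n/d)^2 4m. The constant terms coincide because both use
  the same \<phi>.\<close>

lemma lift_coeff_double:
  assumes even: "\<And>d. even d \<Longrightarrow> d > 0 \<Longrightarrow> \<phi> (int d) = 0"
  shows "lift_coeff k \<phi> c (4 * m) n = lift_coeff k \<phi> c m (2 * n)"
proof (cases "n = 0")
  case False
  let ?f = "\<lambda>d. \<phi> (int d) * of_nat d ^ (k - 1) * c ((n div d)\<^sup>2 * (4 * m))"
  let ?g = "\<lambda>d. \<phi> (int d) * of_nat d ^ (k - 1) * c ((2 * n div d)\<^sup>2 * m)"
  have "lift_coeff k \<phi> c (4 * m) n = (\<Sum>d | d dvd n. ?f d)"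
    using False by (simp add: lift_coeff_def)
  also have "\<dots> = (\<Sum>d | d dvd n \<and> odd d. ?f d)"
    using False by (intro sum.mono_neutral_right) (auto intro!: even intro: Nat.gr0I)
  also have "\<dots> = (\<Sum>d | d dvd 2 * n \<and> odd d. ?g d)"
  proof (intro sum.cong)
    show "{d. d dvd n \<and> odd d} = {d. d dvd 2 * n \<and> odd d}"
      by (auto simp: coprime_dvd_mult_right_iff coprime_commute)
    fix d assume "d \<in> {d. d dvd 2 * n \<and> odd d}"
    then have "d dvd n" by (auto simp: coprime_dvd_mult_right_iff coprime_commute)
    then obtain e where "n = d * e" by blast
    then have "(2 * n div d)\<^sup>2 * m = (n div d)\<^sup>2 * (4 * m)"
      using False by (simp add: power2_eq_square)
    then show "?f d = ?g d" by (simp only:)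
  qed
  also have "\<dots> = (\<Sum>d | d dvd 2 * n. ?g d)"
    using False by (intro sum.mono_neutral_left) (auto intro!: even intro: Nat.gr0I)
  also have "\<dots> = lift_coeff k \<phi> c m (2 * n)"
    using False by (simp add: lift_coeff_def)
  finally show ?thesis .
qed (simp add: lift_coeff_def)

text \<open>The even divisors of n are the doubles of the divisors of n/2 and contribute \<phi>(2)
  2^(k-1) times the coefficient at n/2. At n = 0 the same formula expresses the Euler factor at s =
  1 - k, because 0 is even and \<open>0 div 2 = 0\<close>.\<close>

lemma lift_coeff_remove_2:
  assumes k: "k \<ge> 1" and q: "q > 0" and per: "\<And>n. n > 0 \<Longrightarrow> \<phi> (n + int q) = \<phi> n"
    and mult: "\<And>n. n > 0 \<Longrightarrow> \<phi> (2 * n) = \<phi> 2 * \<phi> n"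
    and \<eta>: "\<And>n. n > 0 \<Longrightarrow> \<eta> n = (if even n then 0 else \<phi> n)"
  shows "lift_coeff k \<eta> c m n = lift_coeff k \<phi> c m n -
    (if even n then \<phi> 2 * 2 ^ (k - 1) * lift_coeff k \<phi> c m (n div 2) else 0)"
proof (cases "n = 0")
  case True
  have "L_function \<eta> (1 - of_nat k) = (1 - \<phi> 2 * 2 powr (- (1 - of_nat k))) * L_function \<phi> (1 - of_nat k)"
  proof (rule L_function_remove_2[where q = q and \<phi> = \<phi> and \<eta> = \<eta>, OF q])
    show "\<phi> (n + int q) = \<phi> n" if "n > 0" for n by (rule per[OF that])
    show "\<phi> (2 * n) = \<phi> 2 * \<phi> n" if "n > 0" for n by (rule mult[OF that])
    show "\<eta> n = (if even n then 0 else \<phi> n)" if "n > 0" for n by (rule \<eta>[OF that])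
  qed (use k in auto)
  also have "(2 :: complex) powr (- (1 - of_nat k)) = 2 ^ (k - 1)"
  proof -
    have "- (1 - of_nat k) = (of_nat (k - 1) :: complex)" using k by (simp add: of_nat_diff)
    then show ?thesis by (simp add: powr_nat)
  qed
  finally have "L_function \<eta> (1 - of_nat k) = (1 - \<phi> 2 * 2 ^ (k - 1)) * L_function \<phi> (1 - of_nat k)" .
  then show ?thesis using True by (simp only: lift_coeff_def) (simp add: algebra_simps)
next
  case False
  let ?f = "\<lambda>\<phi> n d. \<phi> (int d) * of_nat d ^ (k - 1) * c ((n div d)\<^sup>2 * m)"
  have fin: "finite {d. d dvd n}" using False by simp
  have "lift_coeff k \<phi> c m n = (\<Sum>d | d dvd n. ?f \<phi> n d)"
    using False by (simp add: lift_coeff_def)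
  also have "\<dots> = (\<Sum>d \<in> {d. d dvd n \<and> odd d} \<union> {d. d dvd n \<and> even d}. ?f \<phi> n d)"
    by (intro sum.cong) auto
  also have "\<dots> = (\<Sum>d | d dvd n \<and> odd d. ?f \<phi> n d) + (\<Sum>d | d dvd n \<and> even d. ?f \<phi> n d)"
    using fin by (intro sum.union_disjoint) auto
  also have "(\<Sum>d | d dvd n \<and> odd d. ?f \<phi> n d) = (\<Sum>d | d dvd n. ?f \<eta> n d)"
  proof -
    have pos: "d > 0" if "d dvd n" for d using that False by (auto intro: Nat.gr0I)
    have "(\<Sum>d | d dvd n. ?f \<eta> n d) = (\<Sum>d | d dvd n \<and> odd d. ?f \<eta> n d)"
      using fin pos by (intro sum.mono_neutral_right) (auto simp: \<eta>)
    also have "\<dots> = (\<Sum>d | d dvd n \<and> odd d. ?f \<phi> n d)"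
      using pos by (intro sum.cong) (auto simp: \<eta>)
    finally show ?thesis by simp
  qed
  also have "(\<Sum>d | d dvd n. ?f \<eta> n d) = lift_coeff k \<eta> c m n"
    using False by (simp add: lift_coeff_def)
  also have "(\<Sum>d | d dvd n \<and> even d. ?f \<phi> n d) =
    (if even n then \<phi> 2 * 2 ^ (k - 1) * lift_coeff k \<phi> c m (n div 2) else 0)"
  proof (cases "even n")
    case False
    then have e: "{d. d dvd n \<and> even d} = {}" by auto
    show ?thesis unfolding e using False by simp
  next
    case True
    define e where "e = n div 2"
    have e: "n = 2 * e" "e \<noteq> 0" using True \<open>n \<noteq> 0\<close> by (auto simp: e_def)
    have "(\<Sum>d | d dvd n \<and> even d. ?f \<phi> n d) = (\<Sum>d | d dvd e. ?f \<phi> n (2 * d))"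
      by (rule sum.reindex_bij_witness[of _ "\<lambda>d. 2 * d" "\<lambda>d. d div 2"]) (auto simp: e)
    also have "\<dots> = (\<Sum>d | d dvd e. \<phi> 2 * 2 ^ (k - 1) * ?f \<phi> e d)"
    proof (intro sum.cong refl)
      fix d assume "d \<in> {d. d dvd e}"
      then have "d > 0" using e by (auto intro: Nat.gr0I)
      then have "\<phi> (int (2 * d)) = \<phi> 2 * \<phi> (int d)" using mult[of "int d"] by simp
      moreover have "n div (2 * d) = e div d" using e by simp
      ultimately show "?f \<phi> n (2 * d) = \<phi> 2 * 2 ^ (k - 1) * ?f \<phi> e d"
        by (simp only:) (simp add: power_mult_distrib mult_ac)
    qed
    also have "\<dots> = \<phi> 2 * 2 ^ (k - 1) * lift_coeff k \<phi> c m e"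
      using e by (simp add: lift_coeff_def sum_distrib_left)
    finally show ?thesis using True by (simp add: e_def)
  qed
  finally show ?thesis by simp
qed

section \<open>Convergence of q-series and operations on them\<close>

lemma summable_power_times_geometric:
  fixes r :: real
  assumes r: "0 < r" "r < 1"
  shows "summable (\<lambda>n. real n ^ K * r ^ n)"
proof -
  \<comment> \<open>Splitting r into K + 1 equal factors gives every factor n its own bounded
    product n s^n and leaves one s^n for convergence.\<close>
  define s where "s = root (Suc K) r"
  have "0 < s" "s < 1" using r by (auto simp: s_def)
  moreover have "s ^ Suc K = r" unfolding s_def by (rule real_root_pow_pos2) (use r in auto)
  ultimately have s: "0 < s" "s < 1" "s ^ Suc K = r" by auto
  have "(\<lambda>n. real n * s ^ n) \<longlonglongrightarrow> 0" using s by (intro powser_times_n_limit_0) auto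
  then have "Bseq (\<lambda>n. real n * s ^ n)" by (intro convergent_imp_Bseq) (auto simp: convergent_def)
  then obtain B where B: "\<And>n. norm (real n * s ^ n) \<le> B" by (auto simp: Bseq_def)
  show ?thesis
  proof (rule summable_comparison_test)
    show "summable (\<lambda>n. B ^ K * s ^ n)" using s by (intro summable_mult summable_geometric) auto
    have "real n ^ K * r ^ n \<le> B ^ K * s ^ n" for n
    proof -
      have "r ^ n = (s ^ n) ^ K * s ^ n"
        unfolding s(3)[symmetric] by (simp add: power_mult[symmetric] power_mult_distrib mult.commute)
      then have "real n ^ K * r ^ n = (real n * s ^ n) ^ K * s ^ n"
        by (simp add: power_mult_distrib)
      also have "\<dots> \<le> B ^ K * s ^ n"
        using B[of n] s by (intro mult_right_mono power_mono) auto
      finally show ?thesis .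
    qed
    then show "\<exists>N. \<forall>n\<ge>N. norm (real n ^ K * r ^ n) \<le> B ^ K * s ^ n"
      using r by simp
  qed
qed

text \<open>Restricted to n > 0: the constant term of a lift is an L-value, which a bound by a
  multiple of n^K with K > 0 would force to vanish.\<close>

definition poly_bounded :: "(nat \<Rightarrow> complex) \<Rightarrow> bool" where
  "poly_bounded a \<longleftrightarrow> (\<exists>B K. \<forall>n>0. norm (a n) \<le> B * real n ^ K)"

lemma qseries_sums:
  assumes a: "poly_bounded a" and \<tau>: "\<tau> \<in> upper_half_plane"
  shows "(\<lambda>n. a n * nome \<tau> ^ n) sums qseries a \<tau>"
proof -
  obtain B K where B: "\<And>n. n > 0 \<Longrightarrow> norm (a n) \<le> B * real n ^ K"
    using a by (auto simp: poly_bounded_def)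
  define r where "r = norm (nome \<tau>)"
  have r: "0 < r" "r < 1" using norm_nome_less_1[OF \<tau>] by (auto simp: r_def norm_nome)
  have "summable (\<lambda>n. a n * nome \<tau> ^ n)"
  proof (rule summable_comparison_test)
    show "summable (\<lambda>n. B * (real n ^ K * r ^ n))"
      by (intro summable_mult summable_power_times_geometric r)
    have "norm (a n * nome \<tau> ^ n) \<le> B * (real n ^ K * r ^ n)" if "n \<ge> 1" for n
      using mult_right_mono[OF B[of n], of "r ^ n"] that r
      by (simp add: norm_mult norm_power r_def mult_ac)
    then show "\<exists>N. \<forall>n\<ge>N. norm (a n * nome \<tau> ^ n) \<le> B * (real n ^ K * r ^ n)" by blast
  qed
  then show ?thesis unfolding qseries_def by (rule summable_sums)
qed

text \<open>There are at most n divisors, and each term is at most n^(k-1) B (n^2 m)^K. The exponent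
  k + 2K + 1 also accommodates k = 0, where the subtraction k - 1 is truncated.\<close>

lemma poly_bounded_lift_coeff:
  assumes c: "\<And>n. n > 0 \<Longrightarrow> norm (c n) \<le> B * real n ^ K" and B: "B \<ge> 0" and m: "m > 0"
    and \<phi>: "\<And>n. n > 0 \<Longrightarrow> norm (\<phi> (int n)) \<le> 1"
  shows "poly_bounded (lift_coeff k \<phi> c m)"
proof -
  have "norm (lift_coeff k \<phi> c m n) \<le> (B * real m ^ K) * real n ^ (k + 2 * K + 1)" if n: "n > 0" for n
  proof -
    have bound: "norm (\<phi> (int d) * of_nat d ^ (k - 1) * c ((n div d)\<^sup>2 * m)) \<le> real n ^ (k - 1) * (B * (real n ^ 2 * real m) ^ K)"
      if d: "d dvd n" for d
    proof -
      have d0: "d > 0" using d n by (auto intro: Nat.gr0I)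
      have dn: "d \<le> n" using d n by (simp add: dvd_imp_le)
      have nd: "n div d > 0" using dn d0 by (simp add: div_greater_zero_iff)
      have "norm (c ((n div d)\<^sup>2 * m)) \<le> B * real ((n div d)\<^sup>2 * m) ^ K"
        using nd m by (intro c) simp
      also have "\<dots> \<le> B * (real n ^ 2 * real m) ^ K"
      proof (intro mult_left_mono power_mono B)
        have "(n div d)\<^sup>2 * m \<le> n\<^sup>2 * m" by (intro mult_right_mono power_mono) auto
        then have "real ((n div d)\<^sup>2 * m) \<le> real (n\<^sup>2 * m)" by (simp only: of_nat_le_iff)
        then show "real ((n div d)\<^sup>2 * m) \<le> (real n)\<^sup>2 * real m" by simp
      qed auto
      finally have 1: "norm (c ((n div d)\<^sup>2 * m)) \<le> B * (real n ^ 2 * real m) ^ K" .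
      have "norm (\<phi> (int d) * of_nat d ^ (k - 1)) \<le> 1 * real n ^ (k - 1)"
        unfolding norm_mult norm_power using \<phi>[OF d0] dn by (intro mult_mono power_mono) auto
      then show ?thesis
        using 1 unfolding norm_mult[of _ "c _"] by (intro mult_mono) auto
    qed
    have "lift_coeff k \<phi> c m n = (\<Sum>d | d dvd n. \<phi> (int d) * of_nat d ^ (k - 1) * c ((n div d)\<^sup>2 * m))"
      using n by (simp add: lift_coeff_def)
    also have "norm \<dots> \<le> (\<Sum>d | d dvd n. real n ^ (k - 1) * (B * (real n ^ 2 * real m) ^ K))"
      by (rule sum_norm_le) (use bound in auto)
    also have "\<dots> = real (card {d. d dvd n}) * (real n ^ (k - 1) * (B * (real n ^ 2 * real m) ^ K))"
      by simp
    also have "\<dots> \<le> real n * (real n ^ (k - 1) * (B * (real n ^ 2 * real m) ^ K))"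
    proof (intro mult_right_mono)
      have "{d. d dvd n} \<subseteq> {1..n}" using n by (auto simp: dvd_imp_le Suc_le_eq intro: Nat.gr0I)
      then have "card {d. d dvd n} \<le> card {1..n}" by (intro card_mono) auto
      then show "real (card {d. d dvd n}) \<le> real n" by simp
    qed (use B in auto)
    also have "\<dots> = (B * real m ^ K) * (real n ^ (1 + (k - 1)) * real n ^ (2 * K))"
      by (simp add: power_mult_distrib power_mult[symmetric])
    also have "\<dots> \<le> (B * real m ^ K) * real n ^ (k + 2 * K + 1)"
      unfolding power_add[symmetric] using n B by (intro mult_left_mono power_increasing) auto
    finally show ?thesis .
  qed
  then show ?thesis unfolding poly_bounded_def by blast
qed

lemma nome_double: "nome (2 * \<tau>) = nome \<tau> ^ 2"
  by (simp add: nome_def exp_double[symmetric] mult_ac)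

text \<open>The nomes at \<tau>/2 and (\<tau> + 1)/2 are the two opposite square roots of
  \<open>nome \<tau>\<close>, so averaging cancels the odd powers.\<close>

lemma qseries_U2:
  assumes a: "poly_bounded a" and \<tau>: "\<tau> \<in> upper_half_plane"
  shows "qseries (U2 a) \<tau> = (qseries a (\<tau> / 2) + qseries a ((\<tau> + 1) / 2)) / 2"
proof -
  define x where "x = nome (\<tau> / 2)"
  have H: "\<tau> / 2 \<in> upper_half_plane" "(\<tau> + 1) / 2 \<in> upper_half_plane"
    using \<tau> by (simp_all add: upper_half_plane_def)
  have x2: "nome \<tau> = x ^ 2" using nome_double[of "\<tau> / 2"] by (simp add: x_def)
  have xm: "nome ((\<tau> + 1) / 2) = - x"
  proof -
    have "2 * of_real pi * \<i> * ((\<tau> + 1) / 2) = 2 * of_real pi * \<i> * (\<tau> / 2) + of_real pi * \<i>"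
      by (simp add: field_simps)
    then show ?thesis by (simp only: nome_def x_def exp_add) simp
  qed
  have "(\<lambda>n. (a n * x ^ n + a n * (- x) ^ n) / 2) sums ((qseries a (\<tau> / 2) + qseries a ((\<tau> + 1) / 2)) / 2)"
    using qseries_sums[OF a H(1)] qseries_sums[OF a H(2)] unfolding xm x_def[symmetric]
    by (intro sums_divide sums_add)
  moreover have "strict_mono (\<lambda>n::nat. 2 * n)" by (auto simp: strict_mono_def)
  moreover have "(a n * x ^ n + a n * (- x) ^ n) / 2 = 0" if "n \<notin> range (\<lambda>n. 2 * n)" for n
  proof -
    have "odd n" using that by (auto elim!: evenE)
    then show ?thesis by simp
  qed
  ultimately have "(\<lambda>n. (a (2 * n) * x ^ (2 * n) + a (2 * n) * (- x) ^ (2 * n)) / 2) sums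
      ((qseries a (\<tau> / 2) + qseries a ((\<tau> + 1) / 2)) / 2)"
    by (subst sums_mono_reindex[where f = "\<lambda>n. (a n * x ^ n + a n * (- x) ^ n) / 2"]) simp_all
  then have "(\<lambda>n. U2 a n * nome \<tau> ^ n) sums ((qseries a (\<tau> / 2) + qseries a ((\<tau> + 1) / 2)) / 2)"
    by (simp add: U2_def x2 power_mult)
  then show ?thesis unfolding qseries_def by (simp add: sums_iff)
qed

lemma qseries_minus_double:
  assumes b: "poly_bounded b" and \<tau>: "\<tau> \<in> upper_half_plane"
    and a: "\<And>n. a n = b n - (if even n then C * b (n div 2) else 0)"
  shows "qseries a \<tau> = qseries b \<tau> - C * qseries b (2 * \<tau>)"
proof -
  have H: "2 * \<tau> \<in> upper_half_plane" using \<tau> by (simp add: upper_half_plane_def)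
  have inj: "strict_mono (\<lambda>n::nat. 2 * n)" by (auto simp: strict_mono_def)
  have "(\<lambda>n. C * (b n * nome (2 * \<tau>) ^ n)) sums (C * qseries b (2 * \<tau>))"
    by (intro sums_mult qseries_sums b H)
  moreover have "nome (2 * \<tau>) ^ n = nome \<tau> ^ (2 * n)" for n by (simp add: nome_double power_mult)
  ultimately have "(\<lambda>n. (\<lambda>n. (if even n then C * b (n div 2) else 0) * nome \<tau> ^ n) (2 * n)) sums (C * qseries b (2 * \<tau>))"
    by (simp add: mult.assoc)
  then have "(\<lambda>n. (if even n then C * b (n div 2) else 0) * nome \<tau> ^ n) sums (C * qseries b (2 * \<tau>))"
    by (subst (asm) sums_mono_reindex[OF inj]) (auto elim!: evenE)
  from sums_diff[OF qseries_sums[OF b \<tau>] this]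
  have "(\<lambda>n. a n * nome \<tau> ^ n) sums (qseries b \<tau> - C * qseries b (2 * \<tau>))"
    by (simp add: a algebra_simps)
  then show ?thesis unfolding qseries_def by (simp add: sums_iff)
qed

section \<open>Fundamental discriminants attached to squarefree integers\<close>

lemma fundamental_discriminant_odd:
  "fundamental_discriminant D \<Longrightarrow> odd D \<Longrightarrow> D mod 4 = 1 \<and> squarefree D"
  by (auto simp: fundamental_discriminant_def)

lemma fundamental_discriminant_even:
  assumes "fundamental_discriminant D" "even D"
  obtains m where "D = 4 * m" "squarefree m" "m mod 4 = 2 \<or> m mod 4 = 3"
proof -
  have "D mod 4 \<noteq> 1" using assms(2) by presburger
  then show thesis using assms(1) that by (auto simp: fundamental_discriminant_def)
qed

text \<open>Exactly one of m and 4m is a fundamental discriminant, according to m modulo 4, so the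
  definite description in \<open>disc_of\<close> has a unique solution.\<close>

lemma disc_of_eq:
  assumes "(-1) ^ k * t = m" "squarefree m"
  shows "m mod 4 = 1 \<Longrightarrow> disc_of k t = m"
    and "m mod 4 = 2 \<or> m mod 4 = 3 \<Longrightarrow> disc_of k t = 4 * m"
proof -
  have set: "{(-1) ^ k * t, (-1) ^ k * (4 * t)} = {m, 4 * m}" using assms(1) by auto
  show "disc_of k t = m" if "m mod 4 = 1"
    unfolding disc_of_def set
    by (rule the_equality) (use that assms(2) in \<open>auto simp: fundamental_discriminant_def\<close>)
  show "disc_of k t = 4 * m" if "m mod 4 = 2 \<or> m mod 4 = 3"
  proof -
    have "m \<noteq> 4 * m'" for m' using that by presburger
    moreover have "m mod 4 \<noteq> 1" using that by auto
    ultimately have "\<not> fundamental_discriminant m" by (auto simp: fundamental_discriminant_def)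
    moreover have "fundamental_discriminant (4 * m)"
      using that assms(2) by (auto simp: fundamental_discriminant_def)
    ultimately show ?thesis unfolding disc_of_def set by (intro the_equality) auto
  qed
qed

lemma sgn_power_mult_abs: "sgn (D :: int) = (-1) ^ j \<Longrightarrow> (-1) ^ j * \<bar>D\<bar> = D"
  by (metis sgn_mult_abs)



section \<open>The comparisons of S0, S1, S2 and S3\<close>

theorem proposition3p10:
  fixes k N :: nat and \<psi> :: "int \<Rightarrow> complex" and h :: "complex \<Rightarrow> complex" and c :: "nat \<Rightarrow> complex"
  assumes "k \<ge> 1" and "N > 0" and "4 dvd N"
    and "dirichlet_char N \<psi>" and "\<psi> (-1) = 1"
    and "h \<in> half_integral_forms k N \<psi>"
    and "\<forall>\<tau>\<in>upper_half_plane. (\<lambda>n. c n * nome \<tau> ^ n) sums h \<tau>"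
  shows
    "(\<forall>D. fundamental_discriminant D \<and> sgn D = (-1) ^ k \<and> conductor N \<psi> dvd N div 4 \<longrightarrow>
        (\<forall>\<tau>\<in>upper_half_plane.
           S1 k \<psi> c D \<tau> =
           S2 k N \<psi> c D \<tau> -
             char_to_modulus N \<psi> (N div 4) 2 * kronecker_char D 2 * 2 ^ (k - 1) *
             S2 k N \<psi> c D (2 * \<tau>)) \<and>
        (even (N div 4) \<or> even D \<longrightarrow>
           (\<forall>\<tau>\<in>upper_half_plane. S1 k \<psi> c D \<tau> = S2 k N \<psi> c D \<tau>))) \<and>
     (\<forall>D. fundamental_discriminant D \<and> odd D \<and> sgn D = (-1) ^ k \<longrightarrow>
        (\<forall>\<tau>\<in>upper_half_plane.
           S1 k \<psi> c D \<tau> = S0 k \<psi> c ((-1) ^ k * D) \<tau> \<and>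
           S0 k \<psi> c ((-1) ^ k * D) \<tau> = S0 k \<psi> c \<bar>D\<bar> \<tau>)) \<and>
     (\<forall>D. fundamental_discriminant D \<and> even D \<and> sgn D = (-1) ^ k \<longrightarrow>
        (\<forall>\<tau>\<in>upper_half_plane.
           S1 k \<psi> c D \<tau> = qseries (U2 (S0_coeff k \<psi> c (\<bar>D\<bar> div 4))) \<tau> \<and>
           qseries (U2 (S0_coeff k \<psi> c (\<bar>D\<bar> div 4))) \<tau> =
             (S0 k \<psi> c (\<bar>D\<bar> div 4) (\<tau> / 2) + S0 k \<psi> c (\<bar>D\<bar> div 4) ((\<tau> + 1) / 2)) / 2)) \<and>
     (\<forall>\<psi>' D. dirichlet_char (N div 4) \<psi>' \<and> (\<forall>n. \<psi> n = kronecker_char (-4) n * \<psi>' n) \<and>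
        fundamental_discriminant D \<and> 4 dvd D \<and> sgn D = (-1) ^ (k + 1) \<longrightarrow>
        (\<forall>\<tau>\<in>upper_half_plane.
           S3 k \<psi>' c D \<tau> = qseries (U2 (S0_coeff k \<psi> c (\<bar>D\<bar> div 4))) \<tau> \<and>
           qseries (U2 (S0_coeff k \<psi> c (\<bar>D\<bar> div 4))) \<tau> =
             (S0 k \<psi> c (\<bar>D\<bar> div 4) (\<tau> / 2) + S0 k \<psi> c (\<bar>D\<bar> div 4) ((\<tau> + 1) / 2)) / 2))"
proof -
  note k = assms(1) and N = assms(2) and N4 = assms(3) and \<psi> = assms(4) and h = assms(6)
  define M where "M = N div 4"
  have NM: "N = 4 * M" using N4 by (simp add: M_def)
  have M: "M > 0" "M dvd N" using N NM by auto
  obtain B where B: "B \<ge> 0" "\<And>n. n > 0 \<Longrightarrow> norm (c n) \<le> B * real n ^ (k + 1)"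
    using half_integral_form_coeff_bound[OF h \<psi> N4, of c] assms(7) by blast
  have pb: "poly_bounded (lift_coeff k \<phi> c m)" if "m > 0" "\<And>n. n > 0 \<Longrightarrow> norm (\<phi> (int n)) \<le> 1" for \<phi> m
    by (rule poly_bounded_lift_coeff[of c B "k + 1" m \<phi>, OF B(2) B(1) that])
  have twist: "norm (\<phi> (int n) * kronecker_char D (int n)) \<le> 1" if "norm (\<phi> (int n)) \<le> 1" "n > 0" for \<phi> D n
  proof -
    have "norm (kronecker_char D (int n)) \<le> 1"
      using abs_kronecker_le[OF that(2), of D] unfolding kronecker_char_def norm_of_int by linarith
    then show ?thesis using that(1) by (simp add: norm_mult mult_le_one)
  qed
  \<comment> \<open>In (3) this supplies the vanishing at even divisors that turns the index 4m into
    \<open>U2\<close>.\<close>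
  have \<psi>_even: "\<psi> n = 0" if "even n" for n
  proof -
    have "\<not> coprime n (int N)" using that NM by (auto intro: not_coprimeI[of 2])
    then show ?thesis using \<psi> by (auto simp: dirichlet_char_def)
  qed
  \<comment> \<open>The character \<psi>' modulo N/4 may be nonzero at 2; in the comparison with S3
    it is the even discriminant D that kills the even divisors.\<close>
  have \<chi>_even: "kronecker_char D n = 0" if "even D" "even n" "n > 0" for D n
    using kronecker_even[of D "nat n"] that by (simp add: kronecker_char_def even_nat_iff)
  have part1: "S1 k \<psi> c D \<tau> = S2 k N \<psi> c D \<tau> - char_to_modulus N \<psi> M 2 * kronecker_char D 2 * 2 ^ (k - 1) * S2 k N \<psi> c D (2 * \<tau>)"
     and part1': "even M \<or> even D \<Longrightarrow> S1 k \<psi> c D \<tau> = S2 k N \<psi> c D \<tau>"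
    if D: "fundamental_discriminant D" and cond: "conductor N \<psi> dvd M" and \<tau>: "\<tau> \<in> upper_half_plane" for D \<tau>
  proof -
    define \<phi> where "\<phi> = char_to_modulus N \<psi> M"
    have \<phi>: "dirichlet_char M \<phi>" "\<And>n. coprime n (int N) \<Longrightarrow> \<phi> n = \<psi> n"
      unfolding \<phi>_def using dirichlet_char_to_modulus[OF \<psi> cond M(2)] by auto
    have copN: "coprime n (int N) \<longleftrightarrow> odd n \<and> coprime n (int M)" for n
    proof -
      have "coprime n 4 \<longleftrightarrow> odd n" using coprime_power_right_iff[of n 2 2] by simp
      then show ?thesis by (simp add: NM)
    qed
    have \<psi>\<phi>: "\<psi> n = (if even n then 0 else \<phi> n)" for n
    proof (cases "coprime n (int N)")
      case False
      then have "\<psi> n = 0" using \<psi> by (auto simp: dirichlet_char_def)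
      moreover have "odd n \<Longrightarrow> \<phi> n = 0" using False \<phi>(1) by (auto simp: dirichlet_char_def copN)
      ultimately show ?thesis by simp
    qed (auto simp: \<phi>(2) copN)
    define m where "m = nat \<bar>D\<bar>"
    have "D \<noteq> 0" using D by (auto simp: fundamental_discriminant_def)
    then have m: "m > 0" by (simp add: m_def)
    define f where "f = (\<lambda>n. \<phi> n * kronecker_char D n)"
    have S2: "S2 k N \<psi> c D = qseries (lift_coeff k f c m)"
      by (simp add: S2_def S2_coeff_def f_def \<phi>_def m_def M_def)
    have S1: "S1 k \<psi> c D = qseries (lift_coeff k (\<lambda>n. \<psi> n * kronecker_char D n) c m)"
      by (simp add: S1_def S1_coeff_def m_def)
    \<comment> \<open>If N/4 or D is even, \<open>f\<close> vanishes at positive even n as well, so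
      the two twisted characters agree at positive integers and no Euler factor is lost.\<close>
    have same: "S1 k \<psi> c D = S2 k N \<psi> c D" if "even M \<or> even D"
    proof -
      have "\<psi> n * kronecker_char D n = f n" if "n > 0" for n
      proof (cases "even n")
        case True
        have "\<phi> n * kronecker_char D n = 0"
        proof (cases "even D")
          case False
          then have "even M" using \<open>even M \<or> even D\<close> by simp
          then have "\<not> coprime n (int M)" using True by (auto intro: not_coprimeI[of 2])
          then show ?thesis using \<phi>(1) by (auto simp: dirichlet_char_def)
        qed (use \<chi>_even True that in auto)
        then show ?thesis using True by (simp add: f_def \<psi>_even)
      qed (simp add: f_def \<psi>\<phi>)
      then show ?thesis unfolding S1 S2 by (simp add: lift_coeff_cong[of "\<lambda>n. \<psi> n * kronecker_char D n" f])
    qed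
    then show "even M \<or> even D \<Longrightarrow> S1 k \<psi> c D \<tau> = S2 k N \<psi> c D \<tau>" by simp
    show "S1 k \<psi> c D \<tau> = S2 k N \<psi> c D \<tau> - char_to_modulus N \<psi> M 2 * kronecker_char D 2 * 2 ^ (k - 1) * S2 k N \<psi> c D (2 * \<tau>)"
    proof (cases "even M \<or> even D")
      case True
      have "\<phi> 2 * kronecker_char D 2 = 0"
      proof (cases "even D")
        case False
        then have "\<not> coprime 2 (int M)" using True by simp
        then have "\<phi> 2 = 0" using \<phi>(1) unfolding dirichlet_char_def by blast
        then show ?thesis by simp
      qed (use \<chi>_even in auto)
      then show ?thesis using same[OF True] by (simp add: \<phi>_def)
    next
      case False
      then have D': "squarefree D" "D mod 4 = 1" using fundamental_discriminant_odd[OF D] by auto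
      have "lift_coeff k (\<lambda>n. \<psi> n * kronecker_char D n) c m n = lift_coeff k f c m n -
          (if even n then f 2 * 2 ^ (k - 1) * lift_coeff k f c m (n div 2) else 0)" for n
      proof (rule lift_coeff_remove_2[OF k])
        \<comment> \<open>A common period: \<phi> has period M, and the Kronecker symbol has period
          m = |D| since D is squarefree and congruent to 1 modulo 4.\<close>
        show "M * m > 0" using M m by simp
        show "f (n + int (M * m)) = f n" if "n > 0" for n
        proof -
          have "\<phi> (n + int (M * m)) = \<phi> n"
            using dirichlet_char_add_mult[OF \<phi>(1), of M n m] by simp
          moreover have "kronecker D (n + int (M * m)) = kronecker D n"
            using kronecker_periodic[OF D' that, of M] by (simp add: m_def mult.commute)
          ultimately show ?thesis by (simp add: f_def kronecker_char_def)
        qed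
        show "f (2 * n) = f 2 * f n" if "n > 0" for n
        proof -
          have "kronecker D (2 * n) = kronecker D 2 * kronecker D n"
            using kronecker_mult[of 2 "nat n" D] that by simp
          moreover have "\<phi> (2 * n) = \<phi> 2 * \<phi> n" using \<phi>(1) by (simp add: dirichlet_char_def)
          ultimately show ?thesis by (simp add: f_def kronecker_char_def)
        qed
        show "\<psi> n * kronecker_char D n = (if even n then 0 else f n)" for n
          by (simp add: \<psi>\<phi> f_def)
      qed
      moreover have "poly_bounded (lift_coeff k f c m)"
        unfolding f_def by (intro pb m twist norm_dirichlet_char(2)[OF \<phi>(1)])
      ultimately have "S1 k \<psi> c D \<tau> = S2 k N \<psi> c D \<tau> - f 2 * 2 ^ (k - 1) * S2 k N \<psi> c D (2 * \<tau>)"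
        unfolding S1 S2 by (intro qseries_minus_double \<tau>)
      then show ?thesis by (simp add: f_def \<phi>_def)
    qed
  qed
  have part2: "S1 k \<psi> c D \<tau> = S0 k \<psi> c ((-1) ^ k * D) \<tau> \<and> S0 k \<psi> c ((-1) ^ k * D) \<tau> = S0 k \<psi> c \<bar>D\<bar> \<tau>"
    if D: "fundamental_discriminant D" "odd D" "sgn D = (-1) ^ k" for D \<tau>
  proof -
    have D': "D mod 4 = 1" "squarefree D" using fundamental_discriminant_odd D by auto
    have abs: "(-1) ^ k * D = \<bar>D\<bar>" using D(3) by (metis abs_sgn mult.commute)
    have "disc_of k \<bar>D\<bar> = D" by (rule disc_of_eq(1)[OF sgn_power_mult_abs[OF D(3)] D'(2,1)])
    then show ?thesis unfolding abs by (simp add: S1_def S0_def S1_coeff_def S0_coeff_def)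
  qed
  have U2_lift: "qseries (lift_coeff k f c (4 * m)) \<tau> = qseries (U2 (lift_coeff k f c m)) \<tau> \<and>
      qseries (U2 (lift_coeff k f c m)) \<tau> =
      (qseries (lift_coeff k f c m) (\<tau> / 2) + qseries (lift_coeff k f c m) ((\<tau> + 1) / 2)) / 2"
    if "\<And>d. even d \<Longrightarrow> d > 0 \<Longrightarrow> f (int d) = 0" "m > 0" "\<And>n. n > 0 \<Longrightarrow> norm (f (int n)) \<le> 1"
      "\<tau> \<in> upper_half_plane" for f m \<tau>
  proof
    have "lift_coeff k f c (4 * m) = U2 (lift_coeff k f c m)"
      using lift_coeff_double[of f k c m] that(1) by (simp add: fun_eq_iff U2_def)
    then show "qseries (lift_coeff k f c (4 * m)) \<tau> = qseries (U2 (lift_coeff k f c m)) \<tau>" by simp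
  qed (rule qseries_U2[OF pb[where m = m and \<phi> = f, OF that(2,3)] that(4)])
  have part3: "S1 k \<psi> c D \<tau> = qseries (U2 (S0_coeff k \<psi> c (\<bar>D\<bar> div 4))) \<tau> \<and>
      qseries (U2 (S0_coeff k \<psi> c (\<bar>D\<bar> div 4))) \<tau> =
        (S0 k \<psi> c (\<bar>D\<bar> div 4) (\<tau> / 2) + S0 k \<psi> c (\<bar>D\<bar> div 4) ((\<tau> + 1) / 2)) / 2"
    if D: "fundamental_discriminant D" "even D" "sgn D = (-1) ^ k" and \<tau>: "\<tau> \<in> upper_half_plane" for D \<tau>
  proof -
    obtain m where m: "D = 4 * m" "squarefree m" "m mod 4 = 2 \<or> m mod 4 = 3"
      using fundamental_discriminant_even[OF D(1,2)] .
    have "sgn m = (-1) ^ k" using D(3) by (simp add: m(1) sgn_mult)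
    then have "disc_of k \<bar>m\<bar> = 4 * m"
      by (intro disc_of_eq(2)[OF sgn_power_mult_abs m(2,3)])
    moreover have div: "\<bar>D\<bar> div 4 = \<bar>m\<bar>" "nat \<bar>D\<bar> = 4 * nat \<bar>m\<bar>" by (simp_all add: m(1) abs_mult nat_mult_distrib)
    ultimately have S0: "S0_coeff k \<psi> c (\<bar>D\<bar> div 4) = lift_coeff k (\<lambda>n. \<psi> n * kronecker_char D n) c (nat \<bar>m\<bar>)"
      by (simp add: S0_coeff_def m(1))
    have "nat \<bar>m\<bar> > 0" using m(2) by (auto intro: Nat.gr0I)
    then show ?thesis
      unfolding S1_def S0_def S0 S1_coeff_def div(2)
      by (intro U2_lift \<tau> twist norm_dirichlet_char(2)[OF \<psi>]) (auto simp: \<psi>_even)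
  qed
  have part4: "S3 k \<psi>' c D \<tau> = qseries (U2 (S0_coeff k \<psi> c (\<bar>D\<bar> div 4))) \<tau> \<and>
      qseries (U2 (S0_coeff k \<psi> c (\<bar>D\<bar> div 4))) \<tau> =
        (S0 k \<psi> c (\<bar>D\<bar> div 4) (\<tau> / 2) + S0 k \<psi> c (\<bar>D\<bar> div 4) ((\<tau> + 1) / 2)) / 2"
    if \<psi>': "dirichlet_char M \<psi>'" "\<And>n. \<psi> n = kronecker_char (-4) n * \<psi>' n"
      and D: "fundamental_discriminant D" "4 dvd D" "sgn D = (-1) ^ (k + 1)" and \<tau>: "\<tau> \<in> upper_half_plane" for \<psi>' D \<tau>
  proof -
    have evenD: "even D" using D(2) by (metis dvd_trans even_numeral)
    obtain m where m: "D = 4 * m" "squarefree m" "m mod 4 = 2 \<or> m mod 4 = 3"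
      using fundamental_discriminant_even[OF D(1) evenD] .
    have "sgn m = (-1) ^ (k + 1)" using D(3) by (simp add: m(1) sgn_mult)
    then have "(-1) ^ (k + 1) * \<bar>m\<bar> = m" by (rule sgn_power_mult_abs)
    then have sg: "(-1) ^ k * \<bar>m\<bar> = - m" by simp
    have sqf: "squarefree (- m)" using m(2) by simp
    \<comment> \<open>Since m has sign (-1)^(k+1), the discriminant used by S0 is the one attached
      to -m, namely -4m or -m, whereas D = 4m. The character of discriminant -4 contained in \<psi>
      bridges the two.\<close>
    define E where "E = disc_of k \<bar>m\<bar>"
    have E: "E = 4 * (- m) \<or> E = - m"
    proof (cases "m mod 4 = 2")
      case True
      then have "- m mod 4 = 2 \<or> - m mod 4 = 3" by presburger
      then show ?thesis unfolding E_def using disc_of_eq(2)[OF sg sqf] by simp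
    next
      case False
      then have "- m mod 4 = 1" using m(3) by presburger
      then show ?thesis unfolding E_def using disc_of_eq(1)[OF sg sqf] by simp
    qed
    have twist_eq: "\<psi> n * kronecker_char E n = \<psi>' n * kronecker_char D n" if "n > 0" for n
    proof -
      have "kronecker (- 4) n * kronecker E n = kronecker D n"
        using kronecker_minus4_mult[OF evenD E, of "nat n"] m(1) that by simp
      then have "kronecker_char (- 4) n * kronecker_char E n = kronecker_char D n"
        unfolding kronecker_char_def by (metis of_int_mult)
      then show ?thesis by (simp add: \<psi>'(2) mult_ac)
    qed
    have div: "\<bar>D\<bar> div 4 = \<bar>m\<bar>" "nat \<bar>D\<bar> = 4 * nat \<bar>m\<bar>" by (simp_all add: m(1) abs_mult nat_mult_distrib)
    have S0: "S0_coeff k \<psi> c (\<bar>D\<bar> div 4) = lift_coeff k (\<lambda>n. \<psi>' n * kronecker_char D n) c (nat \<bar>m\<bar>)"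
      unfolding S0_coeff_def div E_def[symmetric] by (rule lift_coeff_cong) (rule twist_eq)
    have "nat \<bar>m\<bar> > 0" using m(2) by (auto intro: Nat.gr0I)
    then show ?thesis
      unfolding S3_def S0_def S0 S3_coeff_def div(2)
      by (intro U2_lift \<tau> twist norm_dirichlet_char(2)[OF \<psi>'(1)]) (auto simp: \<chi>_even[OF evenD])
  qed
  show ?thesis
    unfolding M_def[symmetric] using part1 part1' part2 part3 part4 by blast
qed

end
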